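(* Let $(M^{2n},g,J)$ be an almost K\"ahler manifold in the class ${\cal{AK}}_2$. Then the torsion $T$ of $(g,J)$ is parallel with respect to the first canonical Hermitian connection $\overline{\nabla}$, i.e. $\overline{\nabla}T=0$.
   Context: An almost K\"ahler manifold $(M^{2n},g,J)$ is a Riemannian manifold $(M,g)$ of real dimension $2n$ with an almost complex structure $J$ that is compatible (orthogonal: $g(J\cdot,J\cdot)=g$) and whose K\"ahler form $\omega=g(J\cdot,\cdot)$ satisfies $d\omega=0$. Let $\nabla$ be the Levi-Civita connection of $g$ and $R$ its curvature tensor. Set $\eta_XY=\frac12(\nabla_XJ)JY$. The first canonical Hermitian connection is $\overline{\nabla}_XY=\nabla_XY+\eta_XY$; its torsion is $T_XY=\eta_XY-\eta_YX$. The almost K\"ahler manifold belongs to the class ${\cal{AK}}_2$ (second Gray condition) iff $R(X,Y,Z,U)-R(JX,JY,Z,U)=R(JX,Y,JZ,U)+R(JX,Y,Z,JU)$ for all $X,Y,Z,U$ in $TM$. *)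

theory Defs
  imports "HOL-Analysis.Analysis" "HOL-Library.Function_Algebras"
begin

text \<open>
  Geometric objects on a manifold M are rendered algebraically, as in most textbooks: vector
  fields are the derivations of the algebra of smooth functions, tensor fields are maps on vector
  fields that are linear over smooth functions, and a connection is an operator on vector fields.
  Functions and operators are added and multiplied pointwise (Function_Algebras).
\<close>

section \<open>Smooth manifolds\<close>

fun C_on :: "nat \<Rightarrow> 'v::real_normed_vector set \<Rightarrow> ('v \<Rightarrow> 'w::real_normed_vector) \<Rightarrow> bool" where
  "C_on 0 S f \<longleftrightarrow> continuous_on S f"
| "C_on (Suc k) S f \<longleftrightarrow> (\<forall>x\<in>S. f differentiable (at x)) \<and>
     (\<forall>v. C_on k S (\<lambda>x. frechet_derivative f (at x) v))"

text \<open>Only meaningful for open \<open>S\<close>, and only used for open \<open>S\<close>.\<close>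
definition smooth_on :: "'v::real_normed_vector set \<Rightarrow> ('v \<Rightarrow> 'w::real_normed_vector) \<Rightarrow> bool" where
  "smooth_on S f \<longleftrightarrow> (\<forall>k. C_on k S f)"

text \<open>A chart is a pair of its domain and its coordinate map (irrelevant outside the domain).\<close>
type_synonym ('a, 'm) chart = "'a set \<times> ('a \<Rightarrow> real ^ 'm)"

definition smooth_manifold :: "'a topology \<Rightarrow> ('a, 'm::finite) chart set \<Rightarrow> bool" where
  "smooth_manifold M A \<longleftrightarrow>
     Hausdorff_space M \<and> second_countable M \<and>
     (\<forall>(U, \<phi>)\<in>A. openin M U \<and> open (\<phi> ` U) \<and>
        homeomorphic_map (subtopology M U) (top_of_set (\<phi> ` U)) \<phi>) \<and>
     (\<Union>(U, \<phi>)\<in>A. U) = topspace M \<and>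
     (\<forall>(U, \<phi>)\<in>A. \<forall>(V, \<psi>)\<in>A. smooth_on (\<phi> ` (U \<inter> V)) (\<psi> \<circ> inv_into U \<phi>))"

text \<open>
  Smooth real functions on M are represented by total functions vanishing outside the carrier, so
  that equality of functions is equality on M.
\<close>
definition smooth_functions :: "'a topology \<Rightarrow> ('a, 'm::finite) chart set \<Rightarrow> ('a \<Rightarrow> real) set" where
  "smooth_functions M A =
     {f. (\<forall>p. p \<notin> topspace M \<longrightarrow> f p = 0) \<and>
         (\<forall>(U, \<phi>)\<in>A. smooth_on (\<phi> ` U) (f \<circ> inv_into U \<phi>))}"

section \<open>Vector fields, tensors and connections\<close>

type_synonym 'a vfield = "('a \<Rightarrow> real) \<Rightarrow> ('a \<Rightarrow> real)"

text \<open>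
  Derivations of the algebra of smooth functions; the value on non-smooth functions is normalised
  to \<open>0\<close>, so that equality of vector fields is equality as derivations.
\<close>
definition vector_fields :: "'a topology \<Rightarrow> ('a, 'm::finite) chart set \<Rightarrow> 'a vfield set" where
  "vector_fields M A = (let C = smooth_functions M A in
     {X. (\<forall>f\<in>C. X f \<in> C) \<and> (\<forall>f. f \<notin> C \<longrightarrow> X f = 0) \<and>
         (\<forall>f\<in>C. \<forall>h\<in>C. X (f + h) = X f + X h) \<and>
         (\<forall>c. \<forall>f\<in>C. X ((\<lambda>p. c) * f) = (\<lambda>p. c) * X f) \<and>
         (\<forall>f\<in>C. \<forall>h\<in>C. X (f * h) = f * X h + X f * h)})"

definition vscale :: "('a \<Rightarrow> real) \<Rightarrow> 'a vfield \<Rightarrow> 'a vfield" where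
  "vscale f X = (\<lambda>h. f * X h)"

definition lie_bracket :: "'a vfield \<Rightarrow> 'a vfield \<Rightarrow> 'a vfield" where
  "lie_bracket X Y = (\<lambda>f. X (Y f) - Y (X f))"

text \<open>
  The value at \<open>p\<close> of the vector field \<open>X\<close> is the tangent vector \<open>f \<mapsto> X f p\<close>; the last clause
  says that \<open>g\<close> is positive on every nonzero tangent vector.
\<close>
definition riemannian_metric ::
  "'a topology \<Rightarrow> ('a, 'm::finite) chart set \<Rightarrow> ('a vfield \<Rightarrow> 'a vfield \<Rightarrow> ('a \<Rightarrow> real)) \<Rightarrow> bool" where
  "riemannian_metric M A g \<longleftrightarrow> (let C = smooth_functions M A; V = vector_fields M A in
     (\<forall>X\<in>V. \<forall>Y\<in>V. g X Y \<in> C \<and> g X Y = g Y X) \<and>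
     (\<forall>X\<in>V. \<forall>Y\<in>V. \<forall>Z\<in>V. g (X + Y) Z = g X Z + g Y Z) \<and>
     (\<forall>f\<in>C. \<forall>X\<in>V. \<forall>Y\<in>V. g (vscale f X) Y = f * g X Y) \<and>
     (\<forall>X\<in>V. \<forall>p\<in>topspace M. (\<exists>f\<in>C. X f p \<noteq> 0) \<longrightarrow> g X X p > 0))"

definition almost_complex_structure ::
  "'a topology \<Rightarrow> ('a, 'm::finite) chart set \<Rightarrow> ('a vfield \<Rightarrow> 'a vfield) \<Rightarrow> bool" where
  "almost_complex_structure M A J \<longleftrightarrow> (let C = smooth_functions M A; V = vector_fields M A in
     (\<forall>X\<in>V. J X \<in> V) \<and>
     (\<forall>X\<in>V. \<forall>Y\<in>V. J (X + Y) = J X + J Y) \<and>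
     (\<forall>f\<in>C. \<forall>X\<in>V. J (vscale f X) = vscale f (J X)) \<and>
     (\<forall>X\<in>V. J (J X) = - X))"

definition kahler_form ::
  "('a vfield \<Rightarrow> 'a vfield \<Rightarrow> ('a \<Rightarrow> real)) \<Rightarrow> ('a vfield \<Rightarrow> 'a vfield) \<Rightarrow>
   'a vfield \<Rightarrow> 'a vfield \<Rightarrow> ('a \<Rightarrow> real)" where
  "kahler_form g J X Y = g (J X) Y"

definition ext_deriv2 ::
  "('a vfield \<Rightarrow> 'a vfield \<Rightarrow> ('a \<Rightarrow> real)) \<Rightarrow>
   'a vfield \<Rightarrow> 'a vfield \<Rightarrow> 'a vfield \<Rightarrow> ('a \<Rightarrow> real)" where
  "ext_deriv2 w X Y Z = X (w Y Z) - Y (w X Z) + Z (w X Y)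
     - w (lie_bracket X Y) Z + w (lie_bracket X Z) Y - w (lie_bracket Y Z) X"

definition almost_kahler ::
  "'a topology \<Rightarrow> ('a, 'm::finite) chart set \<Rightarrow> ('a vfield \<Rightarrow> 'a vfield \<Rightarrow> ('a \<Rightarrow> real)) \<Rightarrow>
   ('a vfield \<Rightarrow> 'a vfield) \<Rightarrow> bool" where
  "almost_kahler M A g J \<longleftrightarrow> (let V = vector_fields M A in
     smooth_manifold M A \<and> riemannian_metric M A g \<and> almost_complex_structure M A J \<and>
     (\<forall>X\<in>V. \<forall>Y\<in>V. g (J X) (J Y) = g X Y) \<and>
     (\<forall>X\<in>V. \<forall>Y\<in>V. \<forall>Z\<in>V. ext_deriv2 (kahler_form g J) X Y Z = 0))"

definition affine_connection ::
  "'a topology \<Rightarrow> ('a, 'm::finite) chart set \<Rightarrow> ('a vfield \<Rightarrow> 'a vfield \<Rightarrow> 'a vfield) \<Rightarrow> bool" where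
  "affine_connection M A D \<longleftrightarrow> (let C = smooth_functions M A; V = vector_fields M A in
     (\<forall>X\<in>V. \<forall>Y\<in>V. D X Y \<in> V) \<and>
     (\<forall>X\<in>V. \<forall>Y\<in>V. \<forall>Z\<in>V. D (X + Y) Z = D X Z + D Y Z) \<and>
     (\<forall>X\<in>V. \<forall>Y\<in>V. \<forall>Z\<in>V. D X (Y + Z) = D X Y + D X Z) \<and>
     (\<forall>f\<in>C. \<forall>X\<in>V. \<forall>Y\<in>V. D (vscale f X) Y = vscale f (D X Y)) \<and>
     (\<forall>f\<in>C. \<forall>X\<in>V. \<forall>Y\<in>V. D X (vscale f Y) = vscale (X f) Y + vscale f (D X Y)))"

definition levi_civita ::
  "'a topology \<Rightarrow> ('a, 'm::finite) chart set \<Rightarrow> ('a vfield \<Rightarrow> 'a vfield \<Rightarrow> ('a \<Rightarrow> real)) \<Rightarrow>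
   ('a vfield \<Rightarrow> 'a vfield \<Rightarrow> 'a vfield) \<Rightarrow> bool" where
  "levi_civita M A g D \<longleftrightarrow> (let V = vector_fields M A in
     affine_connection M A D \<and>
     (\<forall>X\<in>V. \<forall>Y\<in>V. D X Y - D Y X = lie_bracket X Y) \<and>
     (\<forall>X\<in>V. \<forall>Y\<in>V. \<forall>Z\<in>V. X (g Y Z) = g (D X Y) Z + g Y (D X Z)))"

definition curvature ::
  "('a vfield \<Rightarrow> 'a vfield \<Rightarrow> 'a vfield) \<Rightarrow> 'a vfield \<Rightarrow> 'a vfield \<Rightarrow> 'a vfield \<Rightarrow> 'a vfield" where
  "curvature D X Y Z = D X (D Y Z) - D Y (D X Z) - D (lie_bracket X Y) Z"

text \<open>
  The second Gray condition is homogeneous in the curvature, so the sign convention for the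
  curvature tensor is immaterial.
\<close>
definition AK2 ::
  "'a topology \<Rightarrow> ('a, 'm::finite) chart set \<Rightarrow> ('a vfield \<Rightarrow> 'a vfield \<Rightarrow> ('a \<Rightarrow> real)) \<Rightarrow>
   ('a vfield \<Rightarrow> 'a vfield) \<Rightarrow> ('a vfield \<Rightarrow> 'a vfield \<Rightarrow> 'a vfield) \<Rightarrow> bool" where
  "AK2 M A g J D \<longleftrightarrow> (let V = vector_fields M A; R = (\<lambda>X Y Z U. g (curvature D X Y Z) U) in
     \<forall>X\<in>V. \<forall>Y\<in>V. \<forall>Z\<in>V. \<forall>U\<in>V.
       R X Y Z U - R (J X) (J Y) Z U = R (J X) Y (J Z) U + R (J X) Y Z (J U))"

section \<open>The first canonical Hermitian connection\<close>

definition cov_deriv_endo ::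
  "('a vfield \<Rightarrow> 'a vfield \<Rightarrow> 'a vfield) \<Rightarrow> ('a vfield \<Rightarrow> 'a vfield) \<Rightarrow>
   'a vfield \<Rightarrow> 'a vfield \<Rightarrow> 'a vfield" where
  "cov_deriv_endo D F X Y = D X (F Y) - F (D X Y)"

definition eta ::
  "('a vfield \<Rightarrow> 'a vfield \<Rightarrow> 'a vfield) \<Rightarrow> ('a vfield \<Rightarrow> 'a vfield) \<Rightarrow>
   'a vfield \<Rightarrow> 'a vfield \<Rightarrow> 'a vfield" where
  "eta D J X Y = vscale (\<lambda>p. 1 / 2) (cov_deriv_endo D J X (J Y))"

definition canonical_connection ::
  "('a vfield \<Rightarrow> 'a vfield \<Rightarrow> 'a vfield) \<Rightarrow> ('a vfield \<Rightarrow> 'a vfield) \<Rightarrow>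
   'a vfield \<Rightarrow> 'a vfield \<Rightarrow> 'a vfield" where
  "canonical_connection D J X Y = D X Y + eta D J X Y"

definition canonical_torsion ::
  "('a vfield \<Rightarrow> 'a vfield \<Rightarrow> 'a vfield) \<Rightarrow> ('a vfield \<Rightarrow> 'a vfield) \<Rightarrow>
   'a vfield \<Rightarrow> 'a vfield \<Rightarrow> 'a vfield" where
  "canonical_torsion D J X Y = eta D J X Y - eta D J Y X"

definition cov_deriv_bilinear ::
  "('a vfield \<Rightarrow> 'a vfield \<Rightarrow> 'a vfield) \<Rightarrow> ('a vfield \<Rightarrow> 'a vfield \<Rightarrow> 'a vfield) \<Rightarrow>
   'a vfield \<Rightarrow> 'a vfield \<Rightarrow> 'a vfield \<Rightarrow> 'a vfield" where
  "cov_deriv_bilinear D T X Y Z = D X (T Y Z) - T (D X Y) Z - T Y (D X Z)"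

definition parallel_bilinear ::
  "'a topology \<Rightarrow> ('a, 'm::finite) chart set \<Rightarrow> ('a vfield \<Rightarrow> 'a vfield \<Rightarrow> 'a vfield) \<Rightarrow>
   ('a vfield \<Rightarrow> 'a vfield \<Rightarrow> 'a vfield) \<Rightarrow> bool" where
  "parallel_bilinear M A D T \<longleftrightarrow> (let V = vector_fields M A in
     \<forall>X\<in>V. \<forall>Y\<in>V. \<forall>Z\<in>V. cov_deriv_bilinear D T X Y Z = 0)"

end

theory Submission
  imports Defs "HOL-Analysis.Analysis"
begin

text \<open>
  Let \<open>D\<close> be the canonical Hermitian connection and \<open>eta = D - nabla\<close>. On an almost Kaehler
  manifold \<open>eta X\<close> is skew, \<open>J\<close> anticommutes with it, \<open>eta (J X) = - J (eta X)\<close> and the cyclic sum of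
  \<open>g (eta X Y) Z\<close> vanishes. Hence the torsion \<open>T\<close> and \<open>eta\<close> determine each other through
  \<open>g (T X Y) Z = - g (eta Z X) Y\<close>, and the claim is that the tensor \<open>A X Y Z = (D\<^sub>X eta)\<^sub>Y Z\<close> is zero.

  \<^bold>\<open>The Gray condition.\<close> Expressing the curvature of \<open>nabla\<close> through \<open>D\<close> and \<open>eta\<close> and separating the
  parts that commute and anticommute with \<open>J\<close>, the second Gray condition says precisely enough to
  make \<open>A\<close> symmetric in its first two arguments and complex antilinear in all of them (\<open>A_sym\<close>,
  \<open>A_J1\<close>), and the curvature \<open>Rbar\<close> of \<open>D\<close> invariant under \<open>(X, Y) \<mapsto> (J X, J Y)\<close>
  (\<open>Rbar_JJ\<close>). It is then convenient to work with \<open>K X Y = Rbar X Y - J (Rbar (J X) Y)\<close>, the part of the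
  curvature that is complex linear in \<open>X\<close> and antilinear in \<open>Y\<close>; the first Bianchi identity makes it
  symmetric up to terms quadratic in the torsion (\<open>K_adj\<close>, \<open>K_bianchi\<close>, \<open>K_pair\<close>). Comparing the Ricci
  identity for \<open>eta\<close> at \<open>(X, Y)\<close> and at \<open>(J X, J Y)\<close> gives \<open>A (T X Y) = 0\<close>. Consequently
  \<open>tau = D T\<close> takes values in the nullity \<open>{X. eta X = 0}\<close>, which is the orthogonal complement of
  the span of the torsion, and \<open>K\<close> acts on \<open>eta\<close> by a tensor (\<open>act\<close>) with strong symmetries.

  \<^bold>\<open>A pointwise argument.\<close> The identities just obtained involve only the values of \<open>eta\<close>, \<open>K\<close> and
  \<open>tau\<close> at one point. They imply that \<open>K X Z Y\<close> is in the nullity \<open>H\<close> whenever \<open>X, Y, Z\<close> are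
  (\<open>K_HHH_V\<close>). The proof is an extremal one: for vectors maximising suitable components of the torsion, \<open>K n n\<close>
  has known eigenvalues, while it is nonpositive on the nullity; this is contradictory unless
  those components vanish (\<open>eta_N_vanishes\<close>), and the statement on \<open>K\<close> follows by moving arguments around.

  \<^bold>\<open>Second derivatives.\<close> By this curvature property, the second Bianchi identity for \<open>D\<close>
  restricted to torsion vectors and the nullity shows that the complex antilinear part of \<open>D A\<close> vanishes on the values of \<open>tau\<close>
  (\<open>DA_anti_tau\<close>). The Ricci identity for \<open>A\<close> at \<open>(X, J X)\<close> then reads \<open>S\<^sup>3 (D X X) = 0\<close> for the
  symmetric endomorphism \<open>S a = eta a X\<close>, whence \<open>A X X X = - S (D X X) = 0\<close> (\<open>A_Core_cubic\<close>).
  Polarisation and \<open>g (tau X a b) Y = - g (A X Y a) b\<close> enlarge the set of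
  arguments on which \<open>A\<close> vanishes until it is everything (\<open>A_zero\<close>).

  \<^bold>\<open>From derivations to tangent vectors.\<close> Vector fields are derivations of the algebra of smooth
  functions, so the pointwise argument needs a finite-dimensional model of the tangent space at \<open>p\<close>: a map \<open>G\<close>
  from vector fields onto \<open>\<real>\<^sup>m\<close> with \<open>g X Y p = G X \<bullet> G Y\<close>. Bump
  functions and Hadamard's lemma expand \<open>\<rho>\<^sup>3 X\<close> in coordinate fields with smooth coefficients
  (\<open>field_expansion\<close>), and orthonormalisation gives \<open>G\<close> (\<open>frame_at\<close>).
\<close>

section \<open>Extremal values of linear and quadratic forms\<close>

lemma inner_all_0: "(\<forall>b. x \<bullet> b = 0) \<longleftrightarrow> x = (0::'a::real_inner)"
  by (metis inner_eq_zero_iff inner_zero_left)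

lemma linear_term_zero: assumes "\<And>t::real. t * a \<le> t\<^sup>2 * c" shows "a = 0"
proof -
  define k where "k = \<bar>c\<bar> + 1"
  define t where "t = a / (2 * k)"
  have k: "k > 0" by (simp add: k_def)
  then have a: "a = 2 * k * t" by (simp add: t_def)
  have "t * a \<le> t\<^sup>2 * c" by (rule assms)
  also have "\<dots> \<le> t\<^sup>2 * k" by (intro mult_left_mono) (auto simp: k_def)
  finally have "k * t\<^sup>2 \<le> 0" by (simp add: a power2_eq_square algebra_simps)
  then have "t = 0" using k by (simp add: mult_le_0_iff)
  then show ?thesis by (simp add: a)
qed

text \<open>
  The first order condition at a maximum \<open>n\<close> of \<open>f\<close> on the unit sphere of \<open>W\<close>: the
  competitors \<open>n + t *\<^sub>R m\<close> with \<open>m\<close> orthogonal to \<open>n\<close> have norm \<open>1 + O(t\<^sup>2)\<close>, so \<open>f\<close> kills \<open>m\<close>.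
\<close>
lemma linear_max:
  fixes f :: "'e::real_inner \<Rightarrow> real"
  assumes lin: "linear f" and W: "subspace W" and n: "n \<in> W" "n \<bullet> n = 1"
    and le: "\<And>x. x \<in> W \<Longrightarrow> f x \<le> s * norm x" and fn: "f n = s" and s: "s > 0"
    and x: "x \<in> W"
  shows "f x = s * (n \<bullet> x)"
proof -
  define m where "m = x - (n \<bullet> x) *\<^sub>R n"
  have m: "m \<in> W" "n \<bullet> m = 0"
    using W n x by (simp_all add: m_def subspace_diff subspace_scale inner_diff_right)
  have "t * (2 * s * f m) \<le> t\<^sup>2 * (s\<^sup>2 * (m \<bullet> m) - (f m)\<^sup>2)" for t
  proof -
    let ?x = "n + t *\<^sub>R m"
    have "?x \<in> W" using m n W by (intro subspace_add subspace_scale)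
    then have "- ?x \<in> W" by (rule subspace_neg[OF W])
    from le[OF \<open>?x \<in> W\<close>] le[OF this] have "\<bar>f ?x\<bar> \<le> s * norm ?x"
      unfolding linear_neg[OF lin] norm_minus_cancel by linarith
    then have "(f ?x)\<^sup>2 \<le> (s * norm ?x)\<^sup>2" by (metis abs_ge_zero power2_abs power_mono)
    also have "\<dots> = s\<^sup>2 * (?x \<bullet> ?x)" by (simp only: power_mult_distrib power2_norm_eq_inner)
    also have "?x \<bullet> ?x = 1 + t\<^sup>2 * (m \<bullet> m)"
      using m n by (simp add: inner_add_left inner_add_right inner_commute[of m n] power2_eq_square)
    also have "f ?x = s + t * f m" using fn by (simp add: linear_add[OF lin] linear_scale[OF lin])
    finally show ?thesis by (simp add: power2_eq_square algebra_simps)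
  qed
  then have "2 * s * f m = 0" by (rule linear_term_zero)
  then have "f m = 0" using s by simp
  then show ?thesis using fn by (simp add: m_def linear_diff[OF lin] linear_scale[OF lin])
qed

text \<open>
  A unit vector maximising a symmetric form is an eigenvector; perturbation as for linear forms.
\<close>
lemma quadratic_max:
  fixes b :: "'e::real_inner \<Rightarrow> 'e \<Rightarrow> real"
  assumes lin: "\<And>u. linear (b u)" "\<And>u. linear (\<lambda>w. b w u)"
    and sym: "\<And>u w. u \<in> W \<Longrightarrow> w \<in> W \<Longrightarrow> b u w = b w u"
    and W: "subspace W" and y: "y \<in> W" "y \<bullet> y = 1"
    and le: "\<And>x. x \<in> W \<Longrightarrow> b x x \<le> s * (x \<bullet> x)" and s: "b y y = s"
    and x: "x \<in> W"
  shows "b y x = s * (y \<bullet> x)"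
proof -
  define m where "m = x - (y \<bullet> x) *\<^sub>R y"
  have m: "m \<in> W" "y \<bullet> m = 0"
    using W x y by (simp_all add: m_def subspace_diff subspace_scale inner_diff_right)
  have "t * (2 * b y m) \<le> t\<^sup>2 * (s * (m \<bullet> m) - b m m)" for t
  proof -
    let ?x = "y + t *\<^sub>R m"
    have "?x \<in> W" using m y W by (intro subspace_add subspace_scale)
    then have "b ?x ?x \<le> s * (?x \<bullet> ?x)" by (rule le)
    also have "?x \<bullet> ?x = 1 + t\<^sup>2 * (m \<bullet> m)"
      using m y by (simp add: inner_add_left inner_add_right inner_commute[of m y] power2_eq_square)
    also have "b ?x ?x = s + t * (2 * b y m) + t\<^sup>2 * b m m"
      using s sym[OF m(1) y(1)]
      by (simp add: linear_add[OF lin(1)] linear_add[OF lin(2)] linear_scale[OF lin(1)]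
          linear_scale[OF lin(2)] power2_eq_square algebra_simps)
    finally show ?thesis by (simp add: algebra_simps)
  qed
  then have "2 * b y m = 0" by (rule linear_term_zero)
  then show ?thesis using s by (simp add: m_def linear_diff[OF lin(1)] linear_scale[OF lin(1)])
qed

lemma max_on_unit_spheres:
  fixes f :: "'e::euclidean_space \<Rightarrow> 'e \<Rightarrow> real"
  assumes "subspace W" "subspace U" "continuous_on UNIV (\<lambda>p. f (fst p) (snd p))"
    and "y0 \<in> W" "y0 \<noteq> 0" "n0 \<in> U" "n0 \<noteq> 0"
  shows "\<exists>y n. y \<in> W \<and> y \<bullet> y = 1 \<and> n \<in> U \<and> n \<bullet> n = 1 \<and>
    (\<forall>y' n'. y' \<in> W \<and> y' \<bullet> y' = 1 \<and> n' \<in> U \<and> n' \<bullet> n' = 1 \<longrightarrow> f y' n' \<le> f y n)"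
proof -
  let ?S = "\<lambda>W. W \<inter> sphere (0::'e) 1"
  have c: "compact (?S W \<times> ?S U)"
    using assms(1,2) by (intro compact_Times closed_Int_compact closed_subspace) auto
  have "y0 /\<^sub>R norm y0 \<in> ?S W" "n0 /\<^sub>R norm n0 \<in> ?S U"
    using assms by (auto simp: subspace_scale)
  then have ne: "?S W \<times> ?S U \<noteq> {}" by auto
  have u: "x \<bullet> x = 1 \<longleftrightarrow> norm x = 1" for x :: 'e by (simp add: norm_eq_1)
  from continuous_attains_sup[OF c ne continuous_on_subset[OF assms(3) subset_UNIV]]
  obtain p where "p \<in> ?S W \<times> ?S U" "\<And>q. q \<in> ?S W \<times> ?S U \<Longrightarrow> f (fst q) (snd q) \<le> f (fst p) (snd p)" by blast
  then show ?thesis by (intro exI[of _ "fst p"] exI[of _ "snd p"]) (auto simp: u)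
qed

section \<open>The pointwise algebra of torsion and curvature\<close>

text \<open>
  The values at one point of \<open>eta\<close>, of the curvature part \<open>K\<close> and of \<open>tau = D T\<close>, with the
  identities that hold between them on an almost Kaehler manifold with the second Gray condition. The two \<open>act\<close>
  axioms come from Ricci identities: they describe how \<open>K y x\<close> acts as a derivation on the
  trilinear form \<open>eta z a \<bullet> b\<close>.
\<close>
locale pointwise =
  fixes eta :: "'e::euclidean_space \<Rightarrow> 'e \<Rightarrow> 'e"
    and K :: "'e \<Rightarrow> 'e \<Rightarrow> 'e \<Rightarrow> 'e"
    and tau :: "'e \<Rightarrow> 'e \<Rightarrow> 'e \<Rightarrow> 'e"
  assumes eta_add1: "eta (x + y) z = eta x z + eta y z"
    and eta_skew: "eta x y \<bullet> z = - (eta x z \<bullet> y)"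
    and eta_cyc: "eta x y \<bullet> z + eta y z \<bullet> x + eta z x \<bullet> y = 0"
    and K_adj: "K x y z \<bullet> w = z \<bullet> K y x w"
    and K_bianchi: "K x y z - K z y x =
        2 *\<^sub>R (eta (eta z x - eta x z) y - eta y (eta z x - eta x z))"
    and K_pair: "K x y z \<bullet> w + 2 * (eta x z \<bullet> eta y w) = K z w x \<bullet> y + 2 * (eta z x \<bullet> eta w y)"
    and act_sym: "eta (K y x z) a \<bullet> b + eta z (K y x a) \<bullet> b + eta z a \<bullet> K y x b
               = eta (K z x y) a \<bullet> b + eta y (K z x a) \<bullet> b + eta y a \<bullet> K z x b"
    and act_tau: "eta (K (eta c d - eta d c) x y) a \<bullet> b + eta y (K (eta c d - eta d c) x a) \<bullet> b
               + eta y a \<bullet> K (eta c d - eta d c) x b = 2 * (tau x c d \<bullet> tau y a b)"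
    and tau_sym: "tau x a b \<bullet> y = tau y a b \<bullet> x"
    and tau_cyc: "tau x a b + tau a b x + tau b x a = 0"
    and eta_tau: "eta (tau x a b) y = 0"
begin

definition T where "T x y = eta x y - eta y x"
definition act where
  "act y x z a b = eta (K y x z) a \<bullet> b + eta z (K y x a) \<bullet> b + eta z a \<bullet> K y x b"

lemma T_inner: "T x y \<bullet> z = - (eta z x \<bullet> y)"
  unfolding T_def using eta_cyc[of x y z] eta_skew[of y x z] by (simp add: inner_diff_left)

lemma T_anti: "T x y = - T y x" by (simp add: T_def)

lemma linear_eta1: "linear (\<lambda>x. eta x y)"
proof -
  have *: "eta x y \<bullet> z = - (x \<bullet> T y z)" for x z
    using T_inner[of y z x] by (simp add: inner_commute)
  show ?thesis
    by (rule linearI; rule vector_eq_rdot[THEN iffD1])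
       (simp_all add: * inner_add_left)
qed

lemma linear_eta2: "linear (eta x)"
proof -
  have *: "eta x y \<bullet> z = - (y \<bullet> eta x z)" for y z
    using eta_skew[of x y z] by (simp add: inner_commute)
  show ?thesis
    by (rule linearI; rule vector_eq_rdot[THEN iffD1]) (simp_all add: * inner_add_left)
qed

lemmas eta_lin [simp] =
  linear_add[OF linear_eta1] linear_diff[OF linear_eta1] linear_scale[OF linear_eta1]
  linear_0[OF linear_eta1] linear_neg[OF linear_eta1]
  linear_add[OF linear_eta2] linear_diff[OF linear_eta2] linear_scale[OF linear_eta2]
  linear_0[OF linear_eta2] linear_neg[OF linear_eta2]

lemma linear_K3: "linear (K x y)"
  by (rule linearI; rule vector_eq_rdot[THEN iffD1]) (simp_all add: inner_add_left K_adj)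

lemma K_pair': "K x y z \<bullet> w = x \<bullet> K w z y + 2 * (eta z x \<bullet> eta w y) - 2 * (eta x z \<bullet> eta y w)"
  using K_pair[of x y z w] K_adj[of z w x y] by simp

lemma linear_K1: "linear (\<lambda>x. K x y z)"
  by (rule linearI; rule vector_eq_rdot[THEN iffD1])
     (simp_all add: inner_add_left K_pair' inner_add_right algebra_simps)

lemma linear_K2: "linear (\<lambda>y. K x y z)"
proof -
  have *: "K x y z \<bullet> w = z \<bullet> K y x w" for y w by (rule K_adj)
  show ?thesis
    by (rule linearI; rule vector_eq_rdot[THEN iffD1])
       (simp_all add: * inner_add_left inner_add_right linear_add[OF linear_K1] linear_scale[OF linear_K1])
qed

lemmas K_lin [simp] =
  linear_add[OF linear_K1] linear_diff[OF linear_K1] linear_scale[OF linear_K1] linear_0[OF linear_K1]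
  linear_add[OF linear_K2] linear_diff[OF linear_K2] linear_scale[OF linear_K2] linear_0[OF linear_K2]
  linear_add[OF linear_K3] linear_diff[OF linear_K3] linear_scale[OF linear_K3] linear_0[OF linear_K3]

lemma bianchi: "K x y z = K z y x + 2 *\<^sub>R T (T z x) y"
  using K_bianchi[of x y z] by (simp add: T_def algebra_simps)

text \<open>
  \<open>V\<close> is spanned by the torsion and \<open>H\<close> is the nullity of \<open>eta\<close>; since
  \<open>T x y \<bullet> z = - (eta z x \<bullet> y)\<close> they are orthogonal complements.
\<close>
definition V where "V = span {T a b | a b. True}"
definition H where "H = {x. \<forall>y. eta x y = 0}"

lemma subspace_V: "subspace V" by (simp add: V_def)
lemma T_V [simp]: "T a b \<in> V" unfolding V_def by (rule span_base) auto

lemma subspace_H: "subspace H" by (auto simp: H_def subspace_def)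

lemma H_eta: "h \<in> H \<Longrightarrow> eta h y = 0" by (simp add: H_def)

lemma H_iff: "h \<in> H \<longleftrightarrow> (\<forall>a b. T a b \<bullet> h = 0)"
proof -
  have "(\<forall>a b. T a b \<bullet> h = 0) \<longleftrightarrow> (\<forall>a b. eta h a \<bullet> b = 0)" by (simp add: T_inner)
  also have "\<dots> \<longleftrightarrow> (\<forall>a. eta h a = 0)" by (simp add: inner_all_0)
  finally show ?thesis by (simp add: H_def)
qed

lemma VH: assumes "v \<in> V" "h \<in> H" shows "v \<bullet> h = 0"
proof -
  have "v \<in> span {T a b | a b. True}" using assms V_def by simp
  then show ?thesis
    by (induction rule: span_induct_alt) (use assms(2) in \<open>auto simp: H_iff inner_add_left\<close>)
qed

lemma HV: "v \<in> V \<Longrightarrow> h \<in> H \<Longrightarrow> h \<bullet> v = 0" by (metis VH inner_commute)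

lemma H_I: "(\<And>v. v \<in> V \<Longrightarrow> h \<bullet> v = 0) \<Longrightarrow> h \<in> H" by (metis H_iff T_V inner_commute)

lemma V_H_decomp: obtains v h where "v \<in> V" "h \<in> H" "x = v + h"
proof -
  obtain v h where "v \<in> span V" "\<And>w. w \<in> span V \<Longrightarrow> orthogonal h w" "x = v + h"
    using orthogonal_subspace_decomp_exists[of V x] by metis
  then show thesis
    using that[of v h] span_eq_iff[THEN iffD2, OF subspace_V] by (simp add: orthogonal_def H_I)
qed

lemma V_I: assumes "\<And>h. h \<in> H \<Longrightarrow> x \<bullet> h = 0" shows "x \<in> V"
proof -
  obtain v h where *: "v \<in> V" "h \<in> H" "x = v + h" by (rule V_H_decomp)
  then have "h \<bullet> h = 0" using assms[of h] VH[of v h] by (simp add: inner_add_left)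
  with * show ?thesis by simp
qed

lemma VH_0: "x \<in> V \<Longrightarrow> x \<in> H \<Longrightarrow> x = 0" using VH[of x x] by simp

lemma eta_HH: "h \<in> H \<Longrightarrow> h' \<in> H \<Longrightarrow> eta x h \<bullet> h' = 0"
  using eta_cyc[of x h h'] by (simp add: H_eta)

lemma eta_V: "h \<in> H \<Longrightarrow> eta x h \<in> V" by (rule V_I) (rule eta_HH)

lemma tau_H: "tau x a b \<in> H" by (simp add: H_def eta_tau)

text \<open>
  By symmetry \<open>tau v a b \<bullet> y\<close> pairs \<open>v\<close> with a value of \<open>tau\<close>, which is in \<open>H\<close>.
\<close>
lemma tau_V1: assumes "v \<in> V" shows "tau v a b = 0"
proof -
  have "tau v a b \<bullet> y = 0" for y using tau_sym[of v a b y] HV[OF assms tau_H] by simp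
  then show ?thesis by (metis inner_eq_zero_iff)
qed

lemma tau_VV: "v \<in> V \<Longrightarrow> w \<in> V \<Longrightarrow> tau x v w = 0"
  using tau_cyc[of x v w] by (simp add: tau_V1)

lemma act_swap: "act y x z a b = act z x y a b"
  unfolding act_def by (rule act_sym)

lemma act_T: "act (T c d) x y a b = 2 * (tau x c d \<bullet> tau y a b)"
  unfolding act_def T_def by (rule act_tau)

lemma act_lin: "act (y + y') x z a b = act y x z a b + act y' x z a b"
  "act (c *\<^sub>R y) x z a b = c * act y x z a b" "act 0 x z a b = 0"
  by (simp_all add: act_def inner_add_left inner_add_right algebra_simps)

lemma act_skew: "act y x z a b = - act y x z b a"
  unfolding act_def
  using eta_skew[of "K y x z" a b] eta_skew[of z "K y x a" b] eta_skew[of z a "K y x b"] by linarith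

lemma act_cyc: "act y x a b c + act y x b c a + act y x c a b = 0"
  unfolding act_def
  using eta_cyc[of "K y x a" b c] eta_cyc[of a "K y x b" c] eta_cyc[of a b "K y x c"]
  by linarith

lemma act_V_zero:
  assumes "v \<in> V" "\<And>c d. act (T c d) x y a b = 0" shows "act v x y a b = 0"
proof -
  have "v \<in> span {T a b | a b. True}" using assms V_def by simp
  then show ?thesis
  proof (induction rule: span_induct_alt)
    case (step c v w)
    then show ?case using assms(2) by (auto simp: act_lin)
  qed (simp add: act_lin)
qed

text \<open>
  \<open>act (T c d) x y\<close> is an inner product of values of \<open>tau\<close>, and \<open>tau v = 0\<close> for \<open>v\<close> in
  \<open>V\<close>. So for \<open>v\<close>, \<open>w\<close> in \<open>V\<close> the endomorphism \<open>K v w\<close> is an infinitesimal symmetry of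
  \<open>eta\<close> and in particular preserves \<open>H\<close> and \<open>V\<close>.
\<close>
lemma act_VV1: "v \<in> V \<Longrightarrow> w \<in> V \<Longrightarrow> act v w z a b = 0"
  by (erule act_V_zero) (simp add: act_T tau_V1)

lemma act_VV2: "v \<in> V \<Longrightarrow> w \<in> V \<Longrightarrow> act v x w a b = 0"
  by (erule act_V_zero) (simp add: act_T tau_V1)

lemma act_H: "z \<in> H \<Longrightarrow> act y x z a b = eta (K y x z) a \<bullet> b"
  by (simp add: act_def H_eta)

lemma H_iff2: "h \<in> H \<longleftrightarrow> (\<forall>a b. eta h a \<bullet> b = 0)"
  by (simp add: H_def inner_all_0)

lemma K_VV_H: assumes "v \<in> V" "w \<in> V" "h \<in> H" shows "K v w h \<in> H"
  unfolding H_iff2 using act_VV1[OF assms(1,2), of h] act_H[OF assms(3), of v w] by simp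

lemma K_VV_V: assumes "v \<in> V" "w \<in> V" "u \<in> V" shows "K v w u \<in> V"
  by (rule V_I) (simp add: K_adj VH K_VV_H assms)

text \<open>
  The two quadratic terms, one from the pair symmetry and one from the Bianchi identity, cancel.
\<close>
lemma K_HH_swap: assumes "y \<in> H" "z \<in> H" shows "K v w y \<bullet> z = K v z y \<bullet> w"
proof -
  have "K v w y \<bullet> z = K y z v \<bullet> w - 2 * (eta v y \<bullet> eta w z)"
    using K_pair[of v w y z] assms by (simp add: H_eta)
  moreover have "K y z v \<bullet> w = K v z y \<bullet> w + 2 * (T (T v y) z \<bullet> w)"
    using bianchi[of y z v] by (simp add: inner_add_left)
  moreover have "T v y = eta v y" using assms by (simp add: T_def H_eta)
  moreover have "T (eta v y) z \<bullet> w = eta w z \<bullet> eta v y"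
    by (simp add: T_inner eta_skew[of w "eta v y" z])
  ultimately show ?thesis by (simp add: inner_commute)
qed

lemma K_HHT: assumes "y \<in> H" "z \<in> H"
  shows "K (T c d) z y \<bullet> T c' d' = - 2 * (tau z c d \<bullet> tau y c' d')"
proof -
  have "K (T c d) z y \<bullet> T c' d' = - act (T c d) z y c' d'"
    using T_inner[of c' d' "K (T c d) z y"] act_H[OF assms(1)] by (simp add: inner_commute)
  then show ?thesis by (simp add: act_T)
qed

text \<open>
  For \<open>v = \<Sum> c\<^sub>i T a\<^sub>i b\<^sub>i\<close> the value is \<open>- 2 |\<Sum> c\<^sub>i tau y a\<^sub>i b\<^sub>i|\<^sup>2\<close>.
\<close>
lemma K_VV_nonpos: assumes v: "v \<in> V" and y: "y \<in> H" shows "K v v y \<bullet> y \<le> 0"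
proof -
  \<comment> \<open>Pairs \<open>(v, t)\<close> with \<open>v = \<Sum> c\<^sub>i T a\<^sub>i b\<^sub>i\<close> and \<open>t = \<Sum> c\<^sub>i tau y a\<^sub>i b\<^sub>i\<close>: a relation, as \<open>t\<close> may depend on the representation of \<open>v\<close>.\<close>
  let ?W = "span {(T a b, tau y a b) | a b. True}"
  have 1: "K v y y \<bullet> w = - 2 * (t \<bullet> s)" if vt: "(v, t) \<in> ?W" and ws: "(w, s) \<in> ?W" for v t w s
  proof -
    have 2: "K (T a b) y y \<bullet> snd' = - 2 * (tau y a b \<bullet> s')"
      if "(snd', s') \<in> ?W" for a b snd' s'
    proof -
      have "K (T a b) y y \<bullet> fst q = - 2 * (tau y a b \<bullet> snd q)" if "q \<in> ?W" for q
        using that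
      proof (induction rule: span_induct_alt)
        case (step c x q)
        then show ?case using K_HHT[OF y y] by (auto simp: inner_add_right algebra_simps)
      qed simp
      from this[OF that] show ?thesis by simp
    qed
    have "K (fst p) y y \<bullet> w = - 2 * (snd p \<bullet> s)" if "p \<in> ?W" for p
      using that
    proof (induction rule: span_induct_alt)
      case (step c x q)
      then show ?case using 2[OF ws] by (auto simp: inner_add_left algebra_simps)
    qed simp
    from this[OF vt] show ?thesis by simp
  qed
  have "\<exists>t. (v, t) \<in> ?W"
  proof -
    have "v \<in> span (fst ` {(T a b, tau y a b) | a b. True})"
      using v unfolding V_def by (rule rev_subsetD) (rule span_mono, force)
    also have "\<dots> = fst ` ?W" by (rule linear_span_image[OF bounded_linear.linear[OF bounded_linear_fst]])
    finally show ?thesis by force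
  qed
  then obtain t where "(v, t) \<in> ?W" ..
  from 1[OF this this] have "K v y y \<bullet> v = - 2 * (t \<bullet> t)" .
  then show ?thesis using K_HH_swap[OF y y, of v v] by simp
qed

text \<open>
  \<open>V2\<close> is spanned by the torsion of vectors in \<open>V\<close>, and \<open>N\<close> is its orthogonal complement in
  \<open>V\<close>. For \<open>n\<close> in \<open>N\<close> the form \<open>eta u n \<bullet> w\<close> is symmetric in \<open>u\<close>, \<open>w\<close> from
  \<open>V\<close>.
\<close>
definition V2 where "V2 = span {T a b | a b. a \<in> V \<and> b \<in> V}"
definition N where "N = {n \<in> V. \<forall>u\<in>V. \<forall>w\<in>V. eta n u \<bullet> w = 0}"

lemma subspace_N: "subspace N"
  using subspace_V by (auto simp: N_def subspace_def inner_add_left)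

lemma N_V: "n \<in> N \<Longrightarrow> n \<in> V" by (simp add: N_def)
lemma N_0: "n \<in> N \<Longrightarrow> u \<in> V \<Longrightarrow> w \<in> V \<Longrightarrow> eta n u \<bullet> w = 0" by (simp add: N_def)

lemma V2_V: "v \<in> V2 \<Longrightarrow> v \<in> V"
  unfolding V2_def V_def by (rule rev_subsetD) (auto intro!: span_mono)

lemma V2_T: "a \<in> V \<Longrightarrow> b \<in> V \<Longrightarrow> T a b \<in> V2"
  unfolding V2_def by (rule span_base) auto

lemma V2_N: assumes "v \<in> V2" "n \<in> N" shows "v \<bullet> n = 0"
proof -
  have "v \<in> span {T a b | a b. a \<in> V \<and> b \<in> V}" using assms V2_def by simp
  then show ?thesis
    by (induction rule: span_induct_alt) (use assms(2) in \<open>auto simp: T_inner N_def inner_add_left\<close>)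
qed

lemma V_decomp: assumes "x \<in> V" obtains v n where "v \<in> V2" "n \<in> N" "x = v + n"
proof -
  obtain v n where *: "v \<in> V2" "\<And>w. w \<in> V2 \<Longrightarrow> orthogonal n w" "x = v + n"
    using orthogonal_subspace_decomp_exists[of V2 x] unfolding V2_def span_span by blast
  have "x - v \<in> V" using assms V2_V[OF *(1)] by (rule subspace_diff[OF subspace_V])
  then have "n \<in> V" by (simp add: *(3))
  moreover have "eta n u \<bullet> w = 0" if "u \<in> V" "w \<in> V" for u w
    using *(2)[OF V2_T[OF that]] T_inner[of u w n] by (simp add: orthogonal_def inner_commute)
  ultimately show thesis using that[of v n] * by (simp add: N_def)
qed

text \<open>
  Stronger than on \<open>V\<close>, because \<open>tau x\<close> vanishes on pairs of vectors of \<open>V\<close>.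
\<close>
lemma act_V2_zero: assumes "v \<in> V2" shows "act v x y a b = 0"
proof -
  have "v \<in> span {T a b | a b. a \<in> V \<and> b \<in> V}" using assms V2_def by simp
  then show ?thesis
    by (induction rule: span_induct_alt) (auto simp: act_lin act_T tau_VV)
qed

lemma N_sym: "n \<in> N \<Longrightarrow> u \<in> V \<Longrightarrow> w \<in> V \<Longrightarrow> eta u n \<bullet> w = eta w n \<bullet> u"
  using eta_cyc[of u n w] eta_skew[of w n u] by (simp add: N_0)

lemma N_NN: assumes "n \<in> N" "n' \<in> N" "u \<in> V" shows "eta u n \<bullet> n' = 0"
  using eta_cyc[of u n n'] assms by (simp add: N_0 N_V)

lemma K_VV_N: assumes "v \<in> V" "w \<in> V" "n \<in> N" shows "K v w n \<in> N"
proof -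
  have "K v w n \<in> V" using assms(1,2) N_V[OF assms(3)] by (rule K_VV_V)
  moreover have "eta (K v w n) a \<bullet> b = 0" if "a \<in> V" "b \<in> V" for a b
  proof -
    have "eta n (K v w a) \<bullet> b = 0" "eta n a \<bullet> K v w b = 0"
      using that assms(1,2) by (auto intro!: N_0[OF assms(3)] K_VV_V)
    then show ?thesis using act_VV1[OF assms(1,2), of n a b] by (simp add: act_def)
  qed
  ultimately show ?thesis by (simp add: N_def)
qed

text \<open>
  \<open>K z n n\<close> lies in \<open>N\<close>, so on \<open>V2\<close> only the quadratic term of the Bianchi identity
  remains.
\<close>
lemma K_nn_V2: assumes "n \<in> N" "z \<in> V2" "u \<in> V2"
  shows "K n n z \<bullet> u = 2 * (T z n \<bullet> T u n)"
proof -
  have "K z n n \<in> N" using assms K_VV_N V2_V N_V by blast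
  then have "K z n n \<bullet> u = 0" using V2_N[OF assms(3)] by (metis inner_commute)
  then have "K n n z \<bullet> u = 2 * (T (T z n) n \<bullet> u)"
    by (simp add: bianchi[of n n z] inner_add_left)
  also have "T (T z n) n \<bullet> u = eta u n \<bullet> T z n"
    by (simp add: T_inner eta_skew[of u "T z n" n])
  also have "\<dots> = eta (T z n) n \<bullet> u"
    using assms V2_V by (intro N_sym) auto
  also have "\<dots> = T u n \<bullet> T z n"
    by (simp add: T_inner eta_skew[of "T z n" n u])
  finally show ?thesis by (simp add: inner_commute)
qed

lemma T_n: "T y n \<bullet> x = eta x n \<bullet> y"
  by (simp add: T_inner eta_skew[of x n y])

lemma K_V2_V2: assumes "n \<in> N" "z \<in> V2" shows "K n n z \<in> V2"
proof -
  have z: "K n n z \<in> V" using assms K_VV_V V2_V N_V by blast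
  then obtain v m where *: "v \<in> V2" "m \<in> N" "K n n z = v + m" using V_decomp by blast
  have "K n n z \<bullet> m = z \<bullet> K n n m" by (rule K_adj)
  also have "\<dots> = 0" using assms * K_VV_N N_V V2_N by blast
  finally have "m \<bullet> m = 0" using V2_N[OF *(1,2)] *(3) by (simp add: inner_add_left)
  with * show ?thesis by simp
qed

section \<open>Vectors of maximal torsion\<close>

lemma unit_inner: "x \<noteq> 0 \<Longrightarrow> (x /\<^sub>R norm x) \<bullet> (x /\<^sub>R norm x) = 1" for x :: 'e
  using norm_eq_1[of "x /\<^sub>R norm x"] by simp

lemma bounded_bilinear_eta: "bounded_bilinear eta"
  unfolding bilinear_conv_bounded_bilinear[symmetric] bilinear_def
  using linear_eta1 linear_eta2 by simp

lemmas continuous_eta [continuous_intros] = bounded_bilinear.continuous_on[OF bounded_bilinear_eta]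

text \<open>
  Maximise the form \<open>eta y n \<bullet> y\<close> over unit vectors \<open>y\<close> in \<open>V\<close> and \<open>n\<close> in \<open>M\<close>. The
  first order condition in \<open>n\<close> determines the form at \<open>y\<close>, the one in \<open>y\<close> says that
  \<open>y\<close> is an eigenvector of the symmetric operator \<open>z \<mapsto> T z n\<close>, whose norm is then \<open>s\<close>.
\<close>
lemma extremal_torsion:
  assumes M: "subspace M" "M \<subseteq> N" and "n0 \<in> M" "y0 \<in> V" "eta y0 n0 \<bullet> y0 \<noteq> 0"
  obtains s n y where "s > 0" "n \<in> M" "n \<bullet> n = 1" "y \<in> V2" "y \<bullet> y = 1"
    "\<And>n'. n' \<in> M \<Longrightarrow> eta y n' \<bullet> y = s * (n \<bullet> n')"
    "T y n = s *\<^sub>R y" "\<And>z. z \<in> V \<Longrightarrow> T z n \<bullet> T z n \<le> s\<^sup>2 * (z \<bullet> z)"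
proof -
  let ?f = "\<lambda>y n. eta y n \<bullet> y"
  have y0: "y0 \<noteq> 0" and n0: "n0 \<noteq> 0" using assms(5) by auto
  have cont: "continuous_on UNIV (\<lambda>p. ?f (fst p) (snd p))" by (intro continuous_intros)
  obtain y n where yn: "y \<in> V" "y \<bullet> y = 1" "n \<in> M" "n \<bullet> n = 1"
    and max: "\<And>y' n'. y' \<in> V \<Longrightarrow> y' \<bullet> y' = 1 \<Longrightarrow> n' \<in> M \<Longrightarrow> n' \<bullet> n' = 1 \<Longrightarrow> ?f y' n' \<le> ?f y n"
    using max_on_unit_spheres[OF subspace_V M(1) cont assms(4) y0 assms(3) n0] by auto
  define s where "s = ?f y n"
  have nN: "n \<in> N" using M yn by auto
  have bound: "?f y' n' \<le> s * (y' \<bullet> y') * norm n'" if "y' \<in> V" "n' \<in> M" for y' n'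
  proof (cases "y' = 0 \<or> n' = 0")
    case False
    then have nz: "norm y' > 0" "norm n' > 0" by auto
    have "?f (y' /\<^sub>R norm y') (n' /\<^sub>R norm n') \<le> s"
      unfolding s_def using that False
      by (intro max unit_inner subspace_scale[OF subspace_V] subspace_scale[OF M(1)]) auto
    then have "?f y' n' / (norm y' * norm y' * norm n') \<le> s"
      by (simp add: divide_inverse mult.commute mult.left_commute)
    then have "?f y' n' \<le> s * (norm y' * norm y' * norm n')"
      using nz by (simp add: pos_divide_le_eq)
    also have "norm y' * norm y' = y' \<bullet> y'" by (metis norm_eq_sqrt_inner real_sqrt_mult_self abs_of_nonneg inner_ge_zero)
    finally show ?thesis by (simp add: mult.assoc)
  qed auto
  have s: "s > 0"
  proof (rule ccontr)
    assume "\<not> s > 0"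
    then have *: "s * (y0 \<bullet> y0) * norm n0 \<le> 0" by (simp add: mult_nonpos_nonneg)
    have "?f y0 n0 \<le> 0" using bound[OF assms(4,3)] * by linarith
    moreover have "?f y0 (- n0) \<le> 0"
      using bound[OF assms(4) subspace_neg[OF M(1) assms(3)]] * by (metis norm_minus_cancel order.trans)
    ultimately show False using assms by simp
  qed
  have 1: "eta y n' \<bullet> y = s * (n \<bullet> n')" if "n' \<in> M" for n'
  proof (rule linear_max[where W = M])
    show "linear (\<lambda>n. ?f y n)"
      by (rule linearI) (simp_all add: inner_add_left)
    show "eta y x \<bullet> y \<le> s * norm x" if "x \<in> M" for x using bound[OF yn(1) that] yn by simp
  qed (use yn that s M(1) in \<open>simp_all add: s_def\<close>)
  have lo: "- (s * (x \<bullet> x)) \<le> ?f x n" "?f x n \<le> s * (x \<bullet> x)" if "x \<in> V" for x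
  proof -
    have "norm n = 1" using yn(4) by (simp add: norm_eq_1)
    then show "- (s * (x \<bullet> x)) \<le> ?f x n" "?f x n \<le> s * (x \<bullet> x)"
      using bound[OF that yn(3)] bound[OF that subspace_neg[OF M(1) yn(3)]] by simp_all
  qed
  have 2: "eta y n \<bullet> x = s * (y \<bullet> x)" if "x \<in> V" for x
  proof (rule quadratic_max[where b = "\<lambda>y x. eta y n \<bullet> x" and W = V])
    show "linear (\<lambda>x. eta u n \<bullet> x)" for u by (rule linearI) (simp_all add: inner_add_right)
    show "linear (\<lambda>w. eta w n \<bullet> u)" for u by (rule linearI) (simp_all add: inner_add_left)
  qed (use yn that s subspace_V lo N_sym in \<open>simp_all add: s_def nN\<close>)
  have y: "y \<in> V2"
  proof -
    obtain v m where *: "v \<in> V2" "m \<in> N" "y = v + m" using V_decomp yn by blast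
    have "s * (y \<bullet> m) = 0" using 2[OF N_V[OF *(2)]] N_NN[OF nN *(2) yn(1)] by simp
    then have "m \<bullet> m = 0" using s * V2_N[OF *(1,2)] by (simp add: inner_add_left)
    with * show ?thesis by simp
  qed
  have Ty: "T y n = s *\<^sub>R y"
  proof -
    have "T y n - s *\<^sub>R y \<in> V" using yn by (intro subspace_diff subspace_scale subspace_V) auto
    moreover have "(T y n - s *\<^sub>R y) \<bullet> x = 0" if "x \<in> V" for x
      using 2[OF that] N_sym[OF nN yn(1) that] by (simp add: inner_diff_left T_n)
    ultimately have "(T y n - s *\<^sub>R y) \<bullet> (T y n - s *\<^sub>R y) = 0" by blast
    then show ?thesis by simp
  qed
  have Tz: "T z n \<bullet> T z n \<le> s\<^sup>2 * (z \<bullet> z)" if z: "z \<in> V" for z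
  proof -
    let ?w = "T z n"
    let ?z = "s *\<^sub>R z"
    have zV: "?z \<in> V" "?w + ?z \<in> V" "?w - ?z \<in> V" "?w \<in> V"
      using z subspace_V by (auto intro: subspace_scale subspace_add subspace_diff)
    \<comment> \<open>A symmetric operator is bounded by the maximum of its quadratic form: polarise between \<open>T z n\<close> and \<open>s *\<^sub>R z\<close>.\<close>
    have polar: "?f (w + x) n - ?f (w - x) n = 4 * (eta w n \<bullet> x)" if "w \<in> V" "x \<in> V" for w x
      using N_sym[OF nN that]
      by (simp add: inner_add_left inner_add_right inner_diff_left inner_diff_right)
    have h1: "?f (?w + ?z) n - ?f (?w - ?z) n = 4 * (eta ?w n \<bullet> ?z)"
      using zV(4,1) by (rule polar)
    have h2: "eta ?w n \<bullet> ?z = s * (?w \<bullet> ?w)" by (simp add: T_n[of z n ?w])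
    have h3: "?f (?w + ?z) n - ?f (?w - ?z) n \<le> s * ((?w + ?z) \<bullet> (?w + ?z)) + s * ((?w - ?z) \<bullet> (?w - ?z))"
      using lo(2)[OF zV(2)] lo(1)[OF zV(3)] by linarith
    have "(w + x) \<bullet> (w + x) + (w - x) \<bullet> (w - x) = 2 * (w \<bullet> w) + 2 * (x \<bullet> x)" for w x :: 'e
      by (simp add: inner_add_left inner_add_right inner_diff_left inner_diff_right inner_commute)
    then have h4: "(?w + ?z) \<bullet> (?w + ?z) + (?w - ?z) \<bullet> (?w - ?z) = 2 * (?w \<bullet> ?w) + 2 * (s\<^sup>2 * (z \<bullet> z))"
      by (simp add: power2_eq_square)
    have "4 * (s * (?w \<bullet> ?w)) \<le> s * (2 * (?w \<bullet> ?w) + 2 * (s\<^sup>2 * (z \<bullet> z)))"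
      using h1 h2 h3 unfolding h4[symmetric] distrib_left by linarith
    then have "s * (4 * (?w \<bullet> ?w)) \<le> s * (2 * (?w \<bullet> ?w) + 2 * (s\<^sup>2 * (z \<bullet> z)))"
      by (simp add: mult.left_commute)
    then show ?thesis using s unfolding mult_le_cancel_left_pos[OF s] by linarith
  qed
  show thesis by (rule that[OF s yn(3,4) y yn(2) 1 Ty Tz])
qed

lemma bilinear_max:
  fixes f :: "'e \<Rightarrow> 'e \<Rightarrow> real"
  assumes f: "bilinear f" and W: "subspace W" and U: "subspace U"
    and "y0 \<in> W" "n0 \<in> U" "f y0 n0 \<noteq> 0"
  shows "\<exists>s y n. s > 0 \<and> y \<in> W \<and> y \<bullet> y = 1 \<and> n \<in> U \<and> n \<bullet> n = 1 \<and>
    (\<forall>y'\<in>W. f y' n = s * (y \<bullet> y')) \<and> (\<forall>n'\<in>U. f y n' = s * (n \<bullet> n'))"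
proof -
  have bf: "bounded_bilinear f" using f by (simp add: bilinear_conv_bounded_bilinear)
  interpret bounded_bilinear f by fact
  have lin: "linear (f y)" "linear (\<lambda>y. f y n)" for y n using f by (simp_all add: bilinear_def)
  have y0: "y0 \<noteq> 0" and n0: "n0 \<noteq> 0" using assms(6) by (auto simp: zero_left zero_right)
  have cont: "continuous_on UNIV (\<lambda>p. f (fst p) (snd p))" by (intro continuous_on continuous_intros)
  obtain y n where yn: "y \<in> W" "y \<bullet> y = 1" "n \<in> U" "n \<bullet> n = 1"
    and max: "\<And>y' n'. y' \<in> W \<Longrightarrow> y' \<bullet> y' = 1 \<Longrightarrow> n' \<in> U \<Longrightarrow> n' \<bullet> n' = 1 \<Longrightarrow> f y' n' \<le> f y n"
    using max_on_unit_spheres[OF W U cont assms(4) y0 assms(5) n0] by auto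
  define s where "s = f y n"
  have bound: "f y' n' \<le> s * (norm y' * norm n')" if "y' \<in> W" "n' \<in> U" for y' n'
  proof (cases "y' = 0 \<or> n' = 0")
    case False
    then have nz: "norm y' > 0" "norm n' > 0" by auto
    have "f (y' /\<^sub>R norm y') (n' /\<^sub>R norm n') \<le> s"
      unfolding s_def using that False
      by (intro max unit_inner subspace_scale[OF W] subspace_scale[OF U]) auto
    then have "f y' n' / (norm y' * norm n') \<le> s"
      by (simp add: scaleR_left scaleR_right divide_inverse mult.commute mult.left_commute)
    then show ?thesis using nz by (simp add: pos_divide_le_eq)
  qed (auto simp: zero_left zero_right)
  have s: "s > 0"
  proof (rule ccontr)
    assume "\<not> s > 0"
    then have *: "s * (norm y0 * norm n0) \<le> 0" by (simp add: mult_nonpos_nonneg)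
    have "f y0 n0 \<le> 0" using bound[OF assms(4,5)] * by linarith
    moreover have "f y0 (- n0) \<le> 0"
      using bound[OF assms(4) subspace_neg[OF U assms(5)]] * unfolding norm_minus_cancel by linarith
    ultimately show False using assms(6) by (simp add: minus_right)
  qed
  have nn: "norm y = 1" "norm n = 1" using yn by (simp_all add: norm_eq_1)
  have "f y' n = s * (y \<bullet> y')" if "y' \<in> W" for y'
    by (rule linear_max[OF lin(2) W yn(1,2) _ _ s that]) (use bound[OF _ yn(3)] nn in \<open>simp_all add: s_def\<close>)
  moreover have "f y n' = s * (n \<bullet> n')" if "n' \<in> U" for n'
    by (rule linear_max[OF lin(1) U yn(3,4) _ _ s that]) (use bound[OF yn(1)] nn in \<open>simp_all add: s_def\<close>)
  ultimately show ?thesis using s yn by blast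
qed

lemma N_form_zero:
  assumes n: "n \<in> N" and z: "\<And>y. y \<in> V \<Longrightarrow> eta y n \<bullet> y = 0" and u: "u \<in> V" and w: "w \<in> V"
  shows "eta u n \<bullet> w = 0"
proof -
  have "eta (u + w) n \<bullet> (u + w) = 0" using subspace_add[OF subspace_V u w] by (rule z)
  then show ?thesis
    using z[OF u] z[OF w] N_sym[OF n u w] by (simp add: inner_add_left inner_add_right)
qed

text \<open>
  Suppose not, and let \<open>y\<close>, \<open>n\<close> be extremal with value \<open>s > 0\<close>; put \<open>R = K n n\<close>. The operator
  \<open>R\<close> is symmetric, acts trivially on \<open>eta\<close> as a derivation, and satisfies \<open>R y = 2 s\<^sup>2 y\<close>; the derivation property
  at \<open>(y, n, y)\<close> forces \<open>R n = - 4 s\<^sup>2 n\<close>. As \<open>n\<close> is not in the nullity, \<open>eta n\<close> pairs \<open>H\<close>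
  with \<open>V\<close> nontrivially, and at unit vectors \<open>X\<close>, \<open>z\<close> maximising this pairing the derivation property gives
  \<open>X \<bullet> R X + z \<bullet> R z = 4 s\<^sup>2\<close>. But \<open>R\<close> is at most \<open>0\<close> on \<open>H\<close> and at most \<open>2 s\<^sup>2\<close> on \<open>V\<close>.
\<close>
lemma eta_N_vanishes: assumes n: "n \<in> N" and u: "u \<in> V" and w: "w \<in> V" shows "eta u n \<bullet> w = 0"
proof (rule ccontr)
  assume ne: "eta u n \<bullet> w \<noteq> 0"
  have "\<exists>y\<in>V. eta y n \<bullet> y \<noteq> 0"
    using N_form_zero[OF n _ u w] ne by blast
  then obtain y0 where "y0 \<in> V" "eta y0 n \<bullet> y0 \<noteq> 0" ..
  from extremal_torsion[OF subspace_N order.refl n this] obtain s n y where s: "s > 0" and n: "n \<in> N" "n \<bullet> n = 1"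
    and y: "y \<in> V2" "y \<bullet> y = 1" and 1: "\<And>n'. n' \<in> N \<Longrightarrow> eta y n' \<bullet> y = s * (n \<bullet> n')"
    and Ty: "T y n = s *\<^sub>R y" and Tz: "\<And>z. z \<in> V \<Longrightarrow> T z n \<bullet> T z n \<le> s\<^sup>2 * (z \<bullet> z)" by blast
  have nV: "n \<in> V" and yV: "y \<in> V" using n y N_V V2_V by auto
  let ?R = "K n n"
  have R_adj: "?R a \<bullet> b = a \<bullet> ?R b" for a b by (rule K_adj)
  have Ry: "?R y = (2 * s\<^sup>2) *\<^sub>R y"
  proof -
    define d where "d = ?R y - (2 * s\<^sup>2) *\<^sub>R y"
    have d: "d \<in> V2" unfolding d_def using K_V2_V2[OF n(1) y(1)] y(1)
      unfolding V2_def by (intro span_diff span_scale)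
    have "?R y \<bullet> d = 2 * (s * (y \<bullet> T d n))" using K_nn_V2[OF n(1) y(1) d] Ty by simp
    also have "y \<bullet> T d n = eta y n \<bullet> d" by (metis T_n inner_commute)
    also have "\<dots> = eta d n \<bullet> y" using N_sym[OF n(1) yV V2_V[OF d]] .
    also have "\<dots> = T y n \<bullet> d" by (simp add: T_n)
    also have "\<dots> = s * (y \<bullet> d)" by (simp add: Ty)
    finally have "d \<bullet> d = 0" by (simp add: d_def inner_diff_left power2_eq_square)
    then show ?thesis by (simp add: d_def)
  qed
  have act0: "act n n a b c = 0" for a b c using act_VV1[OF nV nV] .
  have Rn: "?R n = - (4 * s\<^sup>2) *\<^sub>R n"
  proof -
    define d where "d = ?R n + (4 * s\<^sup>2) *\<^sub>R n"
    have RN: "?R x \<in> N" if "x \<in> N" for x using K_VV_N[OF nV nV that] .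
    have d: "d \<in> N" unfolding d_def using RN[OF n(1)] n(1)
      by (intro subspace_add subspace_scale subspace_N)
    have "2 * s\<^sup>2 * (s * (n \<bullet> d)) + s * (n \<bullet> ?R d) + 2 * s\<^sup>2 * (s * (n \<bullet> d)) = 0"
      using act0[of y d y] 1[OF d] 1[OF RN[OF d]] by (simp add: act_def Ry)
    then have "s * (?R n \<bullet> d + 4 * s\<^sup>2 * (n \<bullet> d)) = 0"
      using R_adj[of n d] by (simp add: algebra_simps)
    then have "d \<bullet> d = 0" using s by (simp add: d_def inner_add_left)
    then have "d = 0" by simp
    then show ?thesis by (simp add: d_def eq_neg_iff_add_eq_0)
  qed
  \<comment> \<open>A positive top eigenvalue \<open>k\<close> of \<open>R\<close> on \<open>N\<close>, with eigenvector \<open>m\<close>, is impossible: derivation property and \<open>R \<ge> 0\<close> on \<open>V2\<close> make the form of \<open>m\<close> vanish, then two applications of the Bianchi identity identify \<open>k\<close> with the \<open>n\<close>-component of \<open>K m m n\<close>, which is zero.\<close>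
  have RN_le: "?R x \<bullet> x \<le> 0" if x: "x \<in> N" for x
  proof (rule ccontr)
    assume pos: "\<not> ?R x \<bullet> x \<le> 0"
    then have "x \<noteq> 0" by auto
    let ?f = "\<lambda>(u::'e) x. ?R x \<bullet> x"
    have "bounded_linear ?R" using linear_K3 by (simp add: linear_conv_bounded_linear)
    then have cont: "continuous_on UNIV (\<lambda>p. ?f (fst p) (snd p))"
      unfolding split by (intro continuous_on_inner continuous_on_snd continuous_on_id)
        (rule bounded_linear.continuous_on[OF _ continuous_on_snd[OF continuous_on_id]])
    from max_on_unit_spheres[OF subspace_N subspace_N cont x \<open>x \<noteq> 0\<close> x \<open>x \<noteq> 0\<close>]
    obtain m u where m: "m \<in> N" "m \<bullet> m = 1" and u: "u \<in> N" "u \<bullet> u = 1" and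
      max: "\<forall>x. x \<in> N \<and> x \<bullet> x = 1 \<longrightarrow> ?R x \<bullet> x \<le> ?R m \<bullet> m" by auto
    define k where "k = ?R m \<bullet> m"
    have bound: "?R x \<bullet> x \<le> k * (x \<bullet> x)" if x: "x \<in> N" for x
    proof (cases "x = 0")
      case False
      then have nz: "norm x > 0" by simp
      have "?R (x /\<^sub>R norm x) \<bullet> (x /\<^sub>R norm x) \<le> k"
        unfolding k_def using max unit_inner[OF False] subspace_scale[OF subspace_N x] by blast
      then have "?R x \<bullet> x / (norm x * norm x) \<le> k"
        by (simp add: divide_inverse mult.commute mult.left_commute)
      then have "?R x \<bullet> x \<le> k * (norm x * norm x)" using nz by (simp add: pos_divide_le_eq)
      then show ?thesis by (simp add: power2_norm_eq_inner[symmetric] power2_eq_square)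
    qed simp
    have k: "k > 0"
    proof (rule ccontr)
      assume "\<not> k > 0"
      then have "k * (x \<bullet> x) \<le> 0" by (simp add: mult_nonpos_nonneg)
      then show False using bound[OF x] pos by linarith
    qed
    have Rm: "?R m = k *\<^sub>R m"
    proof -
      have *: "?R m \<bullet> x = k * (m \<bullet> x)" if "x \<in> N" for x
      proof (rule quadratic_max[where b = "\<lambda>m x. ?R m \<bullet> x" and W = N])
        show "linear (\<lambda>x. ?R u \<bullet> x)" for u by (rule linearI) (simp_all add: inner_add_right)
        show "linear (\<lambda>w. ?R w \<bullet> u)" for u by (rule linearI) (simp_all add: inner_add_left)
        show "?R u \<bullet> w = ?R w \<bullet> u" for u w using R_adj[of u w] by (simp add: inner_commute)
      qed (use that m bound subspace_N in \<open>simp_all add: k_def\<close>)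
      define d where "d = ?R m - k *\<^sub>R m"
      have "d \<in> N" unfolding d_def using K_VV_N[OF nV nV m(1)] m(1)
        by (intro subspace_diff subspace_scale subspace_N)
      from *[OF this] have "d \<bullet> d = 0" by (simp add: d_def inner_diff_left)
      then show ?thesis by (simp add: d_def)
    qed
    have mV: "m \<in> V" using m N_V by auto
    have b0: "eta a m \<bullet> a = 0" if a: "a \<in> V" for a
    proof (rule ccontr)
      assume ne: "eta a m \<bullet> a \<noteq> 0"
      \<comment> \<open>An extremal vector for the form of \<open>m\<close> alone.\<close>
      have S: "span {m} \<subseteq> N" using m(1) subspace_N by (simp add: span_minimal)
      from extremal_torsion[OF subspace_span S span_base[OF insertI1] a ne]
      obtain r m' y' where r: "r > 0" and m': "m' \<in> span {m}" "m' \<bullet> m' = 1"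
        and y': "y' \<in> V2" "y' \<bullet> y' = 1" and Tm': "T y' m' = r *\<^sub>R y'" by metis
      from m'(1) obtain c where c: "m' = c *\<^sub>R m" by (auto simp: span_singleton)
      have T': "eta x m' \<bullet> y' = r * (y' \<bullet> x)" for x using T_n[of y' m' x] Tm' by simp
      have T'': "eta y' m' \<bullet> x = r * (y' \<bullet> x)" if "x \<in> V" for x
        using T'[of x] N_sym[OF _ V2_V[OF y'(1)] that, of m'] m'(1) S by auto
      have "c * act n n y' m y' = act n n y' m' y'" by (simp add: act_def c algebra_simps)
      also have "\<dots> = eta (?R y') m' \<bullet> y' + k * (eta y' m' \<bullet> y') + eta y' m' \<bullet> ?R y'"
        by (simp add: act_def c Rm)
      also have "\<dots> = r * (2 * (?R y' \<bullet> y') + k)"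
        using T'[of "?R y'"] T'[of y'] T''[OF V2_V[OF K_V2_V2[OF n(1) y'(1)]]] y'(2)
        by (simp add: inner_commute algebra_simps)
      finally have "2 * (?R y' \<bullet> y') + k = 0" using r by (simp add: act0)
      moreover have "?R y' \<bullet> y' \<ge> 0" using K_nn_V2[OF n(1) y'(1) y'(1)] by simp
      ultimately show False using k by linarith
    qed
    have bm: "eta u m \<bullet> w = 0" if "u \<in> V" "w \<in> V" for u w
      using N_form_zero[OF m(1) b0 that] .
    have Tzm: "T z m = 0" if "z \<in> V" for z
    proof -
      have "T z m \<bullet> T z m = 0" using T_n[of z m "T z m"] bm[OF T_V that] by simp
      then show ?thesis by simp
    qed
    have Tmn: "T m n = 0"
    proof -
      have "T m n \<bullet> T m n = 0" using T_n[of m n "T m n"] N_NN[OF n(1) m(1) T_V] by simp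
      then show ?thesis by simp
    qed
    have Kmy: "K m m y = 0"
    proof -
      have d: "K m m y \<in> V2" using K_V2_V2[OF m(1) y(1)] .
      have "K m m y \<bullet> K m m y = 0" using K_nn_V2[OF m(1) y(1) d] Tzm[OF yV] by simp
      then show ?thesis by simp
    qed
    have "k = K m n n \<bullet> m" using bianchi[of n n m] Tmn by (simp add: k_def T_def[of 0])
    also have "\<dots> = n \<bullet> K n m m" by (rule K_adj)
    also have "K n m m = K m m n" using bianchi[of n m m] Tmn by (simp add: T_def[of 0])
    finally have "s * k = eta y (K m m n) \<bullet> y" using 1[OF K_VV_N[OF mV mV n(1)]] by simp
    also have "\<dots> = act m m y n y" by (simp add: act_def Kmy)
    also have "\<dots> = 0" using act_VV1[OF mV mV] .
    finally show False using s k by simp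
  qed
  \<comment> \<open>Inside \<open>V\<close> the form \<open>eta n\<close> vanishes by definition of \<open>N\<close>, and inside \<open>H\<close> always.\<close>
  have "\<exists>X\<in>H. \<exists>z\<in>V. eta n X \<bullet> z \<noteq> 0"
  proof (rule ccontr)
    assume "\<not> ?thesis"
    then have 0: "eta n X \<bullet> z = 0" if "X \<in> H" "z \<in> V" for X z using that by blast
    have "eta n a \<bullet> b = 0" for a b
    proof -
      obtain v h v' h' where *: "v \<in> V" "h \<in> H" "a = v + h" "v' \<in> V" "h' \<in> H" "b = v' + h'"
        using V_H_decomp by metis
      have "eta n v \<bullet> v' = 0" using n(1) *(1,4) by (rule N_0)
      moreover have "eta n h \<bullet> v' = 0" "eta n h' \<bullet> v = 0" using 0 * by auto
      moreover have "eta n v \<bullet> h' = 0" using eta_skew[of n v h'] calculation by simp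
      moreover have "eta n h \<bullet> h' = 0" using *(2,5) by (rule eta_HH)
      ultimately show ?thesis by (simp add: *(3,6) inner_add_left inner_add_right)
    qed
    then have "n \<in> H" by (simp add: H_iff2)
    from VH_0[OF nV this] n(2) show False by simp
  qed
  then obtain X0 z0 where X0: "X0 \<in> H" "z0 \<in> V" "eta n X0 \<bullet> z0 \<noteq> 0" by blast
  have "bilinear (\<lambda>X z. eta n X \<bullet> z)"
    unfolding bilinear_def by (auto intro!: linearI simp: inner_add_left inner_add_right)
  from bilinear_max[OF this subspace_H subspace_V X0]
  obtain r X z where r: "r > 0" and X: "X \<in> H" "X \<bullet> X = 1" and z: "z \<in> V" "z \<bullet> z = 1"
    and X': "\<forall>X'\<in>H. eta n X' \<bullet> z = r * (X \<bullet> X')" and z': "\<forall>z'\<in>V. eta n X \<bullet> z' = r * (z \<bullet> z')" by blast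
  have "eta (?R n) X \<bullet> z = - (4 * s\<^sup>2) * r" using z' z by (simp add: Rn)
  moreover have "eta n (?R X) \<bullet> z = r * (X \<bullet> ?R X)" using X' K_VV_H[OF nV nV X(1)] by blast
  moreover have "eta n X \<bullet> ?R z = r * (z \<bullet> ?R z)" using z' K_VV_V[OF nV nV z(1)] by blast
  ultimately have "r * (X \<bullet> ?R X + z \<bullet> ?R z - 4 * s\<^sup>2) = 0"
    using act0[of n X z] by (simp add: act_def algebra_simps)
  then have eq: "X \<bullet> ?R X + z \<bullet> ?R z = 4 * s\<^sup>2" using r by simp
  have "X \<bullet> ?R X \<le> 0" using K_VV_nonpos[OF nV X(1)] by (simp add: inner_commute)
  \<comment> \<open>On \<open>V2\<close> the bound is that of \<open>T z n\<close>, on \<open>N\<close> it is nonpositivity; \<open>R\<close> preserves both.\<close>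
  moreover have "z \<bullet> ?R z \<le> 2 * s\<^sup>2"
  proof -
    obtain v m where *: "v \<in> V2" "m \<in> N" "z = v + m" using V_decomp[OF z(1)] by blast
    have "?R v \<bullet> m = 0" "m \<bullet> ?R v = 0" using V2_N[OF K_V2_V2[OF n(1) *(1)] *(2)] by (simp_all add: inner_commute)
    moreover have "v \<bullet> ?R m = 0" using V2_N[OF *(1) K_VV_N[OF nV nV *(2)]] .
    ultimately have "z \<bullet> ?R z = ?R v \<bullet> v + ?R m \<bullet> m"
      by (simp add: *(3) inner_add_left inner_add_right inner_commute)
    also have "\<dots> \<le> 2 * (s\<^sup>2 * (v \<bullet> v))"
      using RN_le[OF *(2)] K_nn_V2[OF n(1) *(1,1)] Tz[OF V2_V[OF *(1)]] by linarith
    also have "v \<bullet> v \<le> 1"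
    proof -
      have "z \<bullet> z = v \<bullet> v + m \<bullet> m" using V2_N[OF *(1,2)]
        by (simp add: *(3) inner_add_left inner_add_right inner_commute)
      then show ?thesis using z(2) inner_ge_zero[of m] by linarith
    qed
    finally show ?thesis by (simp add: mult_left_mono)
  qed
  ultimately have "4 * s\<^sup>2 \<le> 2 * s\<^sup>2" using eq by linarith
  then show False using s by simp
qed

section \<open>Curvature on the nullity\<close>

lemma act_HH_swap:
  assumes "x \<in> H" "y \<in> H" "z \<in> H" shows "act x u y z b = act x u z y b"
proof -
  have "act x u b y z = act b u x y z" by (rule act_swap)
  also have "\<dots> = eta (K b u x) y \<bullet> z" by (rule act_H[OF assms(1)])
  also have "\<dots> = 0" using assms(2,3) by (rule eta_HH)
  finally show ?thesis using act_cyc[of x u y z b] act_skew[of x u z b y] by linarith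
qed

text \<open>
  Components along \<open>N\<close> vanish by \<open>eta_N_vanishes\<close>. On \<open>V2\<close>, the cyclic identity for \<open>act\<close> moves
  \<open>Y\<close> to the other slots, where the swap symmetry produces \<open>act a\<close> with \<open>a\<close> in
  \<open>V2\<close>.
\<close>
lemma K_HHH_N: assumes X: "X \<in> H" and Y: "Y \<in> H" and u: "u \<in> V" and w: "w \<in> V"
  shows "eta (K X Z Y) u \<bullet> w = 0"
proof -
  obtain v h where vh: "v \<in> V" "h \<in> H" "K X Z Y = v + h" by (rule V_H_decomp)
  have f: "eta (K X Z Y) a \<bullet> b = act X Z Y a b" for a b by (simp add: act_H[OF Y])
  have n: "eta (K X Z Y) a \<bullet> m = 0" if "m \<in> N" "a \<in> V" for a m
    using eta_N_vanishes[OF that(1) vh(1) that(2)] eta_skew[of v a m] H_eta[OF vh(2)] vh(3) by simp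
  have z: "eta (K X Z Y) a \<bullet> b = 0" if "a \<in> V2" "b \<in> V2" for a b
  proof -
    have "act X Z a b Y = 0" using act_swap[of X Z a b Y] act_V2_zero[OF that(1), of Z X b Y] by simp
    moreover have "act X Z b Y a = 0" using act_swap[of X Z b Y a] act_V2_zero[OF that(2), of Z X Y a] by simp
    ultimately show ?thesis using act_cyc[of X Z Y a b] f by simp
  qed
  obtain a m where am: "a \<in> V2" "m \<in> N" "u = a + m" using V_decomp[OF u] by blast
  obtain b l where bl: "b \<in> V2" "l \<in> N" "w = b + l" using V_decomp[OF w] by blast
  have "eta (K X Z Y) m \<bullet> b = 0"
    using n[OF am(2) V2_V[OF bl(1)]] eta_skew[of "K X Z Y" m b] by simp
  then show ?thesis
    using z[OF am(1) bl(1)] n[OF bl(2) V2_V[OF am(1)]] n[OF bl(2) N_V[OF am(2)]]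
    by (simp add: am(3) bl(3) inner_add_left inner_add_right)
qed

text \<open>
  \<open>K n Y\<close> maps \<open>V\<close> to \<open>H\<close>, so that two of the three terms of \<open>act n Y u X w = 0\<close> drop out.
\<close>
lemma K_NH_form: assumes n: "n \<in> N" and X: "X \<in> H" and Y: "Y \<in> H" and u: "u \<in> V" and w: "w \<in> V"
  shows "eta u (K n Y X) \<bullet> w = 0"
proof -
  have KV: "K n Y a \<in> H" if a: "a \<in> V" for a
  proof (rule H_I)
    fix z assume z: "z \<in> V"
    have "K n z a \<bullet> Y = 0" using K_VV_V[OF N_V[OF n] z a] Y by (rule VH)
    then have "K a Y n \<bullet> z = 2 * (eta n a \<bullet> eta z Y)"
      using K_pair[of n z a Y] by (simp add: H_eta[OF Y])
    moreover have "K n Y a = K a Y n + 2 *\<^sub>R T (T a n) Y" by (rule bianchi)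
    moreover have "T (T a n) Y \<bullet> z = eta z Y \<bullet> T a n"
      using T_inner[of "T a n" Y z] eta_skew[of z "T a n" Y] by simp
    moreover have "T a n \<bullet> eta z Y = eta a n \<bullet> eta z Y - eta n a \<bullet> eta z Y"
      by (simp add: T_def inner_diff_left)
    moreover have "eta a n \<bullet> eta z Y = 0" using eta_N_vanishes[OF n a eta_V[OF Y]] .
    ultimately show "K n Y a \<bullet> z = 0" by (simp add: inner_add_left inner_add_right inner_commute)
  qed
  have nV: "n \<in> V" using n by (rule N_V)
  have "act n Y u X w = 0" using act_VV2[OF nV u] .
  moreover have "eta (K n Y u) X \<bullet> w = 0" using H_eta[OF KV[OF u]] by simp
  moreover have "eta u X \<bullet> K n Y w = 0" using X KV[OF w] by (rule eta_HH)
  ultimately show ?thesis by (simp add: act_def)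
qed

text \<open>
  The \<open>V\<close>-component of \<open>K n Y X\<close> is orthogonal to \<open>V2\<close> because \<open>tau\<close> vanishes on
  pairs of vectors in \<open>V\<close>. So it is in \<open>N\<close>, has zero form, and the \<open>H\<close>-component carries everything.
\<close>
lemma K_NH_Hpart: assumes n: "n \<in> N" and X: "X \<in> H" and Y: "Y \<in> H"
  and d: "K n Y X = v + h" "v \<in> V" "h \<in> H" and u: "u \<in> V" and w: "w \<in> V"
  shows "eta u h \<bullet> w = 0"
proof -
  have "v \<bullet> T a b = 0" if ab: "a \<in> V" "b \<in> V" for a b
  proof -
    have tw: "K (T c e) (T a b) X \<bullet> Y = 0" for c e
      using K_HH_swap[OF X Y, of "T c e" "T a b"] K_HHT[OF X Y, of c e a b] tau_VV[OF ab] by simp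
    have "K n Y X \<bullet> T a b = K n (T a b) X \<bullet> Y" using K_HH_swap[OF X Y, of n "T a b"] by simp
    also have "\<dots> = 0"
    proof -
      have "n \<in> span {T a b | a b. True}" using N_V[OF n] by (simp add: V_def)
      then show ?thesis
      proof (induction rule: span_induct_alt)
        case (step c x y)
        then show ?case using tw by (auto simp: inner_add_left)
      qed simp
    qed
    finally show ?thesis using VH[OF T_V d(3), of a b] by (simp add: d(1) inner_add_left inner_commute)
  qed
  then have "v \<in> N" using d(2) T_inner by (auto simp: N_def inner_commute)
  then have "eta u v \<bullet> w = 0" using u w by (rule eta_N_vanishes)
  then show ?thesis using K_NH_form[OF n X Y u w] by (simp add: d(1) inner_add_left)
qed

text \<open>
  Let \<open>s1\<close> be the \<open>V\<close>-component of \<open>K X Z Y\<close>; it is in \<open>N\<close>, and its squared norm is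
  \<open>X \<bullet> K s1 Y Z\<close>. Let \<open>h\<close> be the \<open>H\<close>-component of \<open>K s1 Y Z\<close>; its squared norm is
  \<open>K h Z Y \<bullet> s1\<close>. The \<open>V\<close>-component \<open>s2\<close> of \<open>K h Z Y\<close> is in \<open>N\<close> too, and the symmetries of
  \<open>act\<close> show that \<open>eta s2\<close> vanishes on \<open>H\<close> also. Hence \<open>s2\<close> is in \<open>H\<close>, so \<open>s2 = 0\<close>, then
  \<open>h = 0\<close>, then \<open>s1 = 0\<close>.
\<close>
theorem K_HHH_V:
  assumes X: "X \<in> H" and Y: "Y \<in> H" and Z: "Z \<in> H" and v: "v \<in> V"
  shows "K X Z Y \<bullet> v = 0"
proof -
  have chain: "K X Z Y \<bullet> v = X \<bullet> K v Y Z" if "X \<in> H" "Y \<in> H" for X Y v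
    using K_pair[of X Z Y v] K_adj[of Y v X Z] that by (simp add: H_eta)
  have Npart: "s \<in> N" if "X \<in> H" "Y \<in> H" "K X Z Y = s + r" "s \<in> V" "r \<in> H" for X Y s r
  proof -
    have "eta s u \<bullet> w = 0" if "u \<in> V" "w \<in> V" for u w
      using K_HHH_N[OF \<open>X \<in> H\<close> \<open>Y \<in> H\<close> that, of Z] \<open>K X Z Y = s + r\<close> \<open>r \<in> H\<close> by (simp add: H_eta)
    with that show ?thesis by (simp add: N_def)
  qed
  obtain s1 r1 where s1: "s1 \<in> V" "r1 \<in> H" "K X Z Y = s1 + r1" by (rule V_H_decomp)
  have s1N: "s1 \<in> N" using Npart[OF X Y s1(3,1,2)] .
  obtain k h where h: "k \<in> V" "h \<in> H" "K s1 Y Z = k + h" by (rule V_H_decomp)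
  have h0: "eta u h \<bullet> w = 0" if "u \<in> V" "w \<in> V" for u w
    using K_NH_Hpart[OF s1N Z Y h(3,1,2) that] .
  obtain s2 r2 where s2: "s2 \<in> V" "r2 \<in> H" "K h Z Y = s2 + r2" by (rule V_H_decomp)
  have s2N: "s2 \<in> N" using Npart[OF h(2) Y s2(3,1,2)] .
  have s2HV: "eta s2 W \<bullet> u = 0" if "W \<in> H" "u \<in> V" for W u
  proof -
    obtain p q where pq: "p \<in> V" "q \<in> H" "K W Z Y = p + q" by (rule V_H_decomp)
    have "eta s2 W \<bullet> u = act h Z Y W u" using act_H[OF Y] s2 by (simp add: H_eta)
    also have "\<dots> = act h Z W Y u" using h(2) Y that(1) by (rule act_HH_swap)
    also have "\<dots> = act W Z h Y u" by (rule act_swap)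
    also have "\<dots> = act W Z Y h u" using that(1) h(2) Y by (rule act_HH_swap)
    also have "\<dots> = eta p h \<bullet> u" using act_H[OF Y] pq by (simp add: H_eta)
    also have "\<dots> = 0" using h0[OF pq(1) that(2)] .
    finally show ?thesis .
  qed
  have "eta s2 a \<bullet> b = 0" for a b
  proof -
    obtain v h v' h' where *: "v \<in> V" "h \<in> H" "a = v + h" "v' \<in> V" "h' \<in> H" "b = v' + h'"
      using V_H_decomp[of a] V_H_decomp[of b] by metis
    have "eta s2 v \<bullet> v' = 0" using s2N *(1,4) by (rule N_0)
    moreover have "eta s2 h \<bullet> v' = 0" "eta s2 h' \<bullet> v = 0" using s2HV * by auto
    moreover have "eta s2 v \<bullet> h' = 0" using eta_skew[of s2 v h'] calculation by simp
    moreover have "eta s2 h \<bullet> h' = 0" using *(2,5) by (rule eta_HH)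
    ultimately show ?thesis by (simp add: *(3,6) inner_add_left inner_add_right)
  qed
  then have "s2 \<in> H" by (simp add: H_iff2)
  then have s20: "s2 = 0" using s2(1) VH_0 by simp
  have "h \<bullet> h = h \<bullet> K s1 Y Z" using HV[OF h(1,2)] by (simp add: h(3) inner_add_right)
  also have "\<dots> = K h Z Y \<bullet> s1" using chain[OF h(2) Y] by simp
  also have "\<dots> = 0" using HV[OF s1(1) s2(2)] by (simp add: s2(3) s20)
  finally have h00: "h = 0" by simp
  have "s1 \<bullet> s1 = K X Z Y \<bullet> s1" using HV[OF s1(1,2)] by (simp add: s1(3) inner_add_left)
  also have "\<dots> = X \<bullet> K s1 Y Z" using chain[OF X Y] .
  also have "\<dots> = 0" using HV[OF h(1) X] by (simp add: h(3) h00)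
  finally have "s1 = 0" by simp
  then show ?thesis using HV[OF v s1(2)] by (simp add: s1(3))
qed

end

section \<open>Hermitian connections with the second Gray condition\<close>

text \<open>
  The algebra of an almost Kaehler manifold with the second Gray condition, seen through its canonical connection \<open>D\<close>.
  The tensor calculus rests on additivity in each argument, and equality of fields is tested with \<open>g\<close>.
  In \<open>gray\<close> the operator \<open>R\<close> is the curvature of
  \<open>D - eta\<close>, the Levi-Civita connection.
\<close>
locale hermitian_ak2 =
  fixes V :: "'v::ab_group_add set" and C :: "('p \<Rightarrow> real) set"
    and g :: "'v \<Rightarrow> 'v \<Rightarrow> 'p \<Rightarrow> real"
    and J :: "'v \<Rightarrow> 'v" and D eta br :: "'v \<Rightarrow> 'v \<Rightarrow> 'v"
    and der :: "'v \<Rightarrow> ('p \<Rightarrow> real) \<Rightarrow> ('p \<Rightarrow> real)"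
  assumes V_zero [simp]: "0 \<in> V"
    and V_add [simp]: "X \<in> V \<Longrightarrow> Y \<in> V \<Longrightarrow> X + Y \<in> V"
    and V_minus [simp]: "X \<in> V \<Longrightarrow> - X \<in> V"
    and V_J [simp]: "X \<in> V \<Longrightarrow> J X \<in> V"
    and V_D [simp]: "X \<in> V \<Longrightarrow> Y \<in> V \<Longrightarrow> D X Y \<in> V"
    and V_eta [simp]: "X \<in> V \<Longrightarrow> Y \<in> V \<Longrightarrow> eta X Y \<in> V"
    and C_g [simp]: "X \<in> V \<Longrightarrow> Y \<in> V \<Longrightarrow> g X Y \<in> C"
    and C_add [simp]: "f \<in> C \<Longrightarrow> h \<in> C \<Longrightarrow> f + h \<in> C"
    and C_der [simp]: "X \<in> V \<Longrightarrow> f \<in> C \<Longrightarrow> der X f \<in> C"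
    and der_add: "X \<in> V \<Longrightarrow> f \<in> C \<Longrightarrow> h \<in> C \<Longrightarrow> der X (f + h) = der X f + der X h"
    and g_sym: "X \<in> V \<Longrightarrow> Y \<in> V \<Longrightarrow> g X Y p = g Y X p"
    and g_add1 [simp]: "X \<in> V \<Longrightarrow> Y \<in> V \<Longrightarrow> Z \<in> V \<Longrightarrow> g (X + Y) Z p = g X Z p + g Y Z p"
    and g_def: "X \<in> V \<Longrightarrow> (\<And>p. g X X p = 0) \<Longrightarrow> X = 0"
    and g_J: "X \<in> V \<Longrightarrow> Y \<in> V \<Longrightarrow> g (J X) (J Y) p = g X Y p"
    and J_add [simp]: "X \<in> V \<Longrightarrow> Y \<in> V \<Longrightarrow> J (X + Y) = J X + J Y"
    and J_J [simp]: "X \<in> V \<Longrightarrow> J (J X) = - X"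
    and eta_add1 [simp]: "X \<in> V \<Longrightarrow> Y \<in> V \<Longrightarrow> Z \<in> V \<Longrightarrow> eta (X + Y) Z = eta X Z + eta Y Z"
    and eta_add2 [simp]: "X \<in> V \<Longrightarrow> Y \<in> V \<Longrightarrow> Z \<in> V \<Longrightarrow> eta X (Y + Z) = eta X Y + eta X Z"
    and eta_J1 [simp]: "X \<in> V \<Longrightarrow> Y \<in> V \<Longrightarrow> eta (J X) Y = - J (eta X Y)"
    and eta_J2 [simp]: "X \<in> V \<Longrightarrow> Y \<in> V \<Longrightarrow> eta X (J Y) = - J (eta X Y)"
    and eta_skew: "X \<in> V \<Longrightarrow> Y \<in> V \<Longrightarrow> Z \<in> V \<Longrightarrow> g (eta X Y) Z p = - g (eta X Z) Y p"
    and eta_cyc: "X \<in> V \<Longrightarrow> Y \<in> V \<Longrightarrow> Z \<in> V \<Longrightarrow> g (eta X Y) Z p + g (eta Y Z) X p + g (eta Z X) Y p = 0"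
    and D_add1 [simp]: "X \<in> V \<Longrightarrow> Y \<in> V \<Longrightarrow> Z \<in> V \<Longrightarrow> D (X + Y) Z = D X Z + D Y Z"
    and D_add2 [simp]: "X \<in> V \<Longrightarrow> Y \<in> V \<Longrightarrow> Z \<in> V \<Longrightarrow> D X (Y + Z) = D X Y + D X Z"
    and D_J [simp]: "X \<in> V \<Longrightarrow> Y \<in> V \<Longrightarrow> D X (J Y) = J (D X Y)"
    and D_metric: "X \<in> V \<Longrightarrow> Y \<in> V \<Longrightarrow> Z \<in> V \<Longrightarrow> der X (g Y Z) = g (D X Y) Z + g Y (D X Z)"
    and br_eq: "X \<in> V \<Longrightarrow> Y \<in> V \<Longrightarrow> br X Y = D X Y - D Y X - (eta X Y - eta Y X)"
    and br_jacobi: "X \<in> V \<Longrightarrow> Y \<in> V \<Longrightarrow> Z \<in> V \<Longrightarrow> br X (br Y Z) + br Y (br Z X) + br Z (br X Y) = 0"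
    and der_br: "X \<in> V \<Longrightarrow> Y \<in> V \<Longrightarrow> f \<in> C \<Longrightarrow> der (br X Y) f = der X (der Y f) - der Y (der X f)"
    and gray: "X \<in> V \<Longrightarrow> Y \<in> V \<Longrightarrow> Z \<in> V \<Longrightarrow> U \<in> V \<Longrightarrow>
      R = (\<lambda>X Y Z. (D X (D Y Z - eta Y Z) - eta X (D Y Z - eta Y Z))
          - (D Y (D X Z - eta X Z) - eta Y (D X Z - eta X Z)) - (D (br X Y) Z - eta (br X Y) Z)) \<Longrightarrow>
      g (R X Y Z) U p - g (R (J X) (J Y) Z) U p = g (R (J X) Y (J Z)) U p + g (R (J X) Y Z) (J U) p"
begin

lemma additive_on:
  fixes f :: "'v \<Rightarrow> 'w::ab_group_add"
  assumes "\<And>x y. x \<in> V \<Longrightarrow> y \<in> V \<Longrightarrow> f (x + y) = f x + f y"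
  shows "f 0 = 0" "x \<in> V \<Longrightarrow> f (- x) = - f x" "x \<in> V \<Longrightarrow> y \<in> V \<Longrightarrow> f (x - y) = f x - f y"
proof -
  show 0: "f 0 = 0" using assms[of 0 0] by simp
  show m: "f (- x) = - f x" if "x \<in> V" for x
    using assms[of x "- x"] that 0 by (simp add: add_eq_0_iff2)
  show "f (x - y) = f x - f y" if "x \<in> V" "y \<in> V"
    using assms[of x "- y"] m[of y] that by simp
qed

lemma trilinear_on:
  fixes f :: "'v \<Rightarrow> 'v \<Rightarrow> 'v \<Rightarrow> 'v"
  assumes "\<And>X X' Y Z. X \<in> V \<Longrightarrow> X' \<in> V \<Longrightarrow> Y \<in> V \<Longrightarrow> Z \<in> V \<Longrightarrow> f (X + X') Y Z = f X Y Z + f X' Y Z"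
    "\<And>X X' Y Z. X \<in> V \<Longrightarrow> X' \<in> V \<Longrightarrow> Y \<in> V \<Longrightarrow> Z \<in> V \<Longrightarrow> f Y (X + X') Z = f Y X Z + f Y X' Z"
    "\<And>X X' Y Z. X \<in> V \<Longrightarrow> X' \<in> V \<Longrightarrow> Y \<in> V \<Longrightarrow> Z \<in> V \<Longrightarrow> f Y Z (X + X') = f Y Z X + f Y Z X'"
    and "Y \<in> V" "Z \<in> V"
  shows "f 0 Y Z = 0" "X \<in> V \<Longrightarrow> f (- X) Y Z = - f X Y Z" "X \<in> V \<Longrightarrow> X' \<in> V \<Longrightarrow> f (X - X') Y Z = f X Y Z - f X' Y Z"
    "f Y 0 Z = 0" "X \<in> V \<Longrightarrow> f Y (- X) Z = - f Y X Z" "X \<in> V \<Longrightarrow> X' \<in> V \<Longrightarrow> f Y (X - X') Z = f Y X Z - f Y X' Z"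
    "f Y Z 0 = 0" "X \<in> V \<Longrightarrow> f Y Z (- X) = - f Y Z X" "X \<in> V \<Longrightarrow> X' \<in> V \<Longrightarrow> f Y Z (X - X') = f Y Z X - f Y Z X'"
proof -
  show "f 0 Y Z = 0" "X \<in> V \<Longrightarrow> f (- X) Y Z = - f X Y Z" "X \<in> V \<Longrightarrow> X' \<in> V \<Longrightarrow> f (X - X') Y Z = f X Y Z - f X' Y Z"
    by (rule additive_on[of "\<lambda>X. f X Y Z"]; simp add: assms)+
  show "f Y 0 Z = 0" "X \<in> V \<Longrightarrow> f Y (- X) Z = - f Y X Z" "X \<in> V \<Longrightarrow> X' \<in> V \<Longrightarrow> f Y (X - X') Z = f Y X Z - f Y X' Z"
    by (rule additive_on[of "\<lambda>X. f Y X Z"]; simp add: assms)+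
  show "f Y Z 0 = 0" "X \<in> V \<Longrightarrow> f Y Z (- X) = - f Y Z X" "X \<in> V \<Longrightarrow> X' \<in> V \<Longrightarrow> f Y Z (X - X') = f Y Z X - f Y Z X'"
    by (rule additive_on[of "\<lambda>X. f Y Z X"]; simp add: assms)+
qed

lemma V_diff [simp]: "X \<in> V \<Longrightarrow> Y \<in> V \<Longrightarrow> X - Y \<in> V"
  using V_add[of X "- Y"] by simp

lemma g_add2 [simp]: "X \<in> V \<Longrightarrow> Y \<in> V \<Longrightarrow> Z \<in> V \<Longrightarrow> g X (Y + Z) p = g X Y p + g X Z p"
  using g_sym[of X "Y + Z"] g_sym[of X Y] g_sym[of X Z] by simp

lemma g_lin1: assumes "Z \<in> V"
  shows "g 0 Z p = 0" "X \<in> V \<Longrightarrow> g (- X) Z p = - g X Z p" "X \<in> V \<Longrightarrow> Y \<in> V \<Longrightarrow> g (X - Y) Z p = g X Z p - g Y Z p"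
  by (rule additive_on[of "\<lambda>X. g X Z p"]; simp add: assms)+

lemma g_lin2: assumes "Z \<in> V"
  shows "g Z 0 p = 0" "X \<in> V \<Longrightarrow> g Z (- X) p = - g Z X p" "X \<in> V \<Longrightarrow> Y \<in> V \<Longrightarrow> g Z (X - Y) p = g Z X p - g Z Y p"
  by (rule additive_on[of "\<lambda>X. g Z X p"]; simp add: assms)+

lemma J_lin: "J 0 = 0" "X \<in> V \<Longrightarrow> J (- X) = - J X" "X \<in> V \<Longrightarrow> Y \<in> V \<Longrightarrow> J (X - Y) = J X - J Y"
  by (rule additive_on[of J]; simp)+

lemma eta_lin1: assumes "Z \<in> V"
  shows "eta 0 Z = 0" "X \<in> V \<Longrightarrow> eta (- X) Z = - eta X Z" "X \<in> V \<Longrightarrow> Y \<in> V \<Longrightarrow> eta (X - Y) Z = eta X Z - eta Y Z"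
  by (rule additive_on[of "\<lambda>X. eta X Z"]; simp add: assms)+

lemma eta_lin2: assumes "Z \<in> V"
  shows "eta Z 0 = 0" "X \<in> V \<Longrightarrow> eta Z (- X) = - eta Z X" "X \<in> V \<Longrightarrow> Y \<in> V \<Longrightarrow> eta Z (X - Y) = eta Z X - eta Z Y"
  by (rule additive_on[of "\<lambda>X. eta Z X"]; simp add: assms)+

lemma D_lin1: assumes "Z \<in> V"
  shows "D 0 Z = 0" "X \<in> V \<Longrightarrow> D (- X) Z = - D X Z" "X \<in> V \<Longrightarrow> Y \<in> V \<Longrightarrow> D (X - Y) Z = D X Z - D Y Z"
  by (rule additive_on[of "\<lambda>X. D X Z"]; simp add: assms)+

lemma D_lin2: assumes "Z \<in> V"
  shows "D Z 0 = 0" "X \<in> V \<Longrightarrow> D Z (- X) = - D Z X" "X \<in> V \<Longrightarrow> Y \<in> V \<Longrightarrow> D Z (X - Y) = D Z X - D Z Y"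
  by (rule additive_on[of "\<lambda>X. D Z X"]; simp add: assms)+

lemmas lin [simp] = g_lin1 g_lin2 J_lin eta_lin1 eta_lin2 D_lin1 D_lin2

lemma eq_I: assumes "X \<in> V" "Y \<in> V" "\<And>Z p. Z \<in> V \<Longrightarrow> g X Z p = g Y Z p" shows "X = Y"
  using g_def[of "X - Y"] assms by simp

lemma g_J_left: assumes "X \<in> V" "Y \<in> V" shows "g (J X) Y p = - g X (J Y) p"
  using g_J[of X "J Y" p] assms by simp

lemma double_0: assumes "X \<in> V" "X + X = 0" shows "X = 0"
proof -
  have "g X X p = 0" for p
    using g_add1[of X X X p] assms by simp
  then show ?thesis using assms g_def by blast
qed

lemma double_cancel: assumes "X \<in> V" "Y \<in> V" "X + X = Y + Y" shows "X = Y"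
  using double_0[of "X - Y"] assms by (simp add: algebra_simps)

definition T where "T X Y = eta X Y - eta Y X"

lemma V_T [simp]: "X \<in> V \<Longrightarrow> Y \<in> V \<Longrightarrow> T X Y \<in> V" by (simp add: T_def)

lemma T_inner: assumes "X \<in> V" "Y \<in> V" "Z \<in> V" shows "g (T X Y) Z p = - g (eta Z X) Y p"
  using eta_cyc[of X Y Z p] eta_skew[of Y X Z p] assms by (simp add: T_def)

lemma T_add [simp]: "X \<in> V \<Longrightarrow> Y \<in> V \<Longrightarrow> Z \<in> V \<Longrightarrow> T (X + Y) Z = T X Z + T Y Z"
  "X \<in> V \<Longrightarrow> Y \<in> V \<Longrightarrow> Z \<in> V \<Longrightarrow> T Z (X + Y) = T Z X + T Z Y" by (simp_all add: T_def)

lemma T_lin1: assumes "Z \<in> V"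
  shows "T 0 Z = 0" "X \<in> V \<Longrightarrow> T (- X) Z = - T X Z" "X \<in> V \<Longrightarrow> Y \<in> V \<Longrightarrow> T (X - Y) Z = T X Z - T Y Z"
  by (rule additive_on[of "\<lambda>X. T X Z"]; simp add: assms)+

lemma T_lin2: assumes "Z \<in> V"
  shows "T Z 0 = 0" "X \<in> V \<Longrightarrow> T Z (- X) = - T Z X" "X \<in> V \<Longrightarrow> Y \<in> V \<Longrightarrow> T Z (X - Y) = T Z X - T Z Y"
  by (rule additive_on[of "\<lambda>X. T Z X"]; simp add: assms)+

lemmas [simp] = T_lin1 T_lin2

lemma T_J [simp]: "X \<in> V \<Longrightarrow> Y \<in> V \<Longrightarrow> T (J X) Y = - J (T X Y)" "X \<in> V \<Longrightarrow> Y \<in> V \<Longrightarrow> T X (J Y) = - J (T X Y)"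
  by (simp_all add: T_def algebra_simps)

lemma T_anti: "T X Y = - T Y X" by (simp add: T_def)

lemma br_T: "X \<in> V \<Longrightarrow> Y \<in> V \<Longrightarrow> br X Y = D X Y - D Y X - T X Y" by (simp add: br_eq T_def)

lemma V_br [simp]: "X \<in> V \<Longrightarrow> Y \<in> V \<Longrightarrow> br X Y \<in> V" by (simp add: br_T)

lemma C_0: "(0::'p \<Rightarrow> real) \<in> C"
proof -
  have "g 0 0 = 0" by (simp add: fun_eq_iff)
  then show ?thesis using C_g[of 0 0] by (simp del: C_g)
qed

lemma der_0: "X \<in> V \<Longrightarrow> der X 0 = 0"
  using der_add[of X 0 0] C_0 by (simp del: mult_2 add: fun_eq_iff)

text \<open>
  Differentiation of relations between inner products. Only sums of values of \<open>g\<close> occur, since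
  \<open>C\<close> is merely an additive set of functions.
\<close>
lemma D_sum1:
  assumes "X \<in> V" "a \<in> V" "b \<in> V" "\<And>q. g a b q = 0"
  shows "g (D X a) b p + g a (D X b) p = 0"
proof -
  have "g a b = 0" using assms(4) by (simp add: fun_eq_iff)
  then have "der X (g a b) p = 0" using der_0 assms by simp
  then show ?thesis using D_metric[of X a b] assms by simp
qed

lemma D_sum2:
  assumes "X \<in> V" "a \<in> V" "b \<in> V" "c \<in> V" "d \<in> V" "\<And>q. g a b q + g c d q = 0"
  shows "g (D X a) b p + g a (D X b) p + (g (D X c) d p + g c (D X d) p) = 0"
proof -
  have "g a b + g c d = 0" using assms(6) by (simp add: fun_eq_iff)
  then have "der X (g a b + g c d) p = 0" using der_0 assms by simp
  then show ?thesis using D_metric[of X a b] D_metric[of X c d] assms by (simp add: der_add)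
qed

lemma D_sum3:
  assumes "X \<in> V" "a \<in> V" "b \<in> V" "c \<in> V" "d \<in> V" "e \<in> V" "f \<in> V"
    "\<And>q. g a b q + g c d q + g e f q = 0"
  shows "g (D X a) b p + g a (D X b) p + (g (D X c) d p + g c (D X d) p) + (g (D X e) f p + g e (D X f) p) = 0"
proof -
  have "g a b + g c d + g e f = 0" using assms(8) by (simp add: fun_eq_iff)
  then have "der X (g a b + g c d + g e f) p = 0" using der_0 assms by simp
  then show ?thesis using D_metric[of X a b] D_metric[of X c d] D_metric[of X e f] assms by (simp add: der_add)
qed

text \<open>
  The covariant derivative of \<open>eta\<close> with respect to \<open>D\<close>.
\<close>
definition A where "A X Y Z = D X (eta Y Z) - eta (D X Y) Z - eta Y (D X Z)"

lemma V_A [simp]: "X \<in> V \<Longrightarrow> Y \<in> V \<Longrightarrow> Z \<in> V \<Longrightarrow> A X Y Z \<in> V" by (simp add: A_def)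

lemma A_add [simp]:
  "X \<in> V \<Longrightarrow> X' \<in> V \<Longrightarrow> Y \<in> V \<Longrightarrow> Z \<in> V \<Longrightarrow> A (X + X') Y Z = A X Y Z + A X' Y Z"
  "X \<in> V \<Longrightarrow> X' \<in> V \<Longrightarrow> Y \<in> V \<Longrightarrow> Z \<in> V \<Longrightarrow> A Y (X + X') Z = A Y X Z + A Y X' Z"
  "X \<in> V \<Longrightarrow> X' \<in> V \<Longrightarrow> Y \<in> V \<Longrightarrow> Z \<in> V \<Longrightarrow> A Y Z (X + X') = A Y Z X + A Y Z X'"
  by (simp_all add: A_def)

lemmas A_lin [simp] = trilinear_on[of A, OF A_add]

lemma A_J2 [simp]: "X \<in> V \<Longrightarrow> Y \<in> V \<Longrightarrow> Z \<in> V \<Longrightarrow> A X (J Y) Z = - J (A X Y Z)"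
  and A_J3 [simp]: "X \<in> V \<Longrightarrow> Y \<in> V \<Longrightarrow> Z \<in> V \<Longrightarrow> A X Y (J Z) = - J (A X Y Z)"
  by (simp_all add: A_def)

lemma A_skew: assumes "X \<in> V" "Y \<in> V" "Z \<in> V" "U \<in> V" shows "g (A X Y Z) U p = - g (A X Y U) Z p"
proof -
  have s: "g (eta a b) c q = - g (eta a c) b q" if "a \<in> V" "b \<in> V" "c \<in> V" for a b c q using eta_skew that by blast
  have "g (eta Y Z) U q + g (eta Y U) Z q = 0" for q using s[of Y Z U q] assms by simp
  from D_sum2[OF _ _ _ _ _ this, of X p] assms
  have "g (D X (eta Y Z)) U p + g (eta Y Z) (D X U) p + (g (D X (eta Y U)) Z p + g (eta Y U) (D X Z) p) = 0" by simp
  then show ?thesis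
    using s[of Y Z "D X U" p] s[of Y U "D X Z" p] s[of "D X Y" Z U p] assms by (simp add: A_def)
qed

lemma A_cyc: assumes "X \<in> V" "Y \<in> V" "Z \<in> V" "U \<in> V"
  shows "g (A X Y Z) U p + g (A X Z U) Y p + g (A X U Y) Z p = 0"
proof -
  note c = eta_cyc
  from D_sum3[OF _ _ _ _ _ _ _ c, of X Y Z U p] assms
  have "g (D X (eta Y Z)) U p + g (eta Y Z) (D X U) p + (g (D X (eta Z U)) Y p + g (eta Z U) (D X Y) p)
    + (g (D X (eta U Y)) Z p + g (eta U Y) (D X Z) p) = 0" by simp
  then show ?thesis
    using c[of "D X Y" Z U p] c[of Y "D X Z" U p] c[of Y Z "D X U" p] assms by (simp add: A_def)
qed

text \<open>
  The curvature of \<open>D\<close>.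
\<close>
definition Rbar where "Rbar X Y Z = D X (D Y Z) - D Y (D X Z) - D (br X Y) Z"

lemma br_lin [simp]:
  "X \<in> V \<Longrightarrow> X' \<in> V \<Longrightarrow> Y \<in> V \<Longrightarrow> br (X + X') Y = br X Y + br X' Y"
  "X \<in> V \<Longrightarrow> X' \<in> V \<Longrightarrow> Y \<in> V \<Longrightarrow> br Y (X + X') = br Y X + br Y X'"
  by (simp_all add: br_T)

lemma V_Rbar [simp]: "X \<in> V \<Longrightarrow> Y \<in> V \<Longrightarrow> Z \<in> V \<Longrightarrow> Rbar X Y Z \<in> V" by (simp add: Rbar_def)

lemma Rbar_add [simp]:
  "X \<in> V \<Longrightarrow> X' \<in> V \<Longrightarrow> Y \<in> V \<Longrightarrow> Z \<in> V \<Longrightarrow> Rbar (X + X') Y Z = Rbar X Y Z + Rbar X' Y Z"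
  "X \<in> V \<Longrightarrow> X' \<in> V \<Longrightarrow> Y \<in> V \<Longrightarrow> Z \<in> V \<Longrightarrow> Rbar Y (X + X') Z = Rbar Y X Z + Rbar Y X' Z"
  "X \<in> V \<Longrightarrow> X' \<in> V \<Longrightarrow> Y \<in> V \<Longrightarrow> Z \<in> V \<Longrightarrow> Rbar Y Z (X + X') = Rbar Y Z X + Rbar Y Z X'"
  by (simp_all add: Rbar_def algebra_simps)

lemmas Rbar_lin [simp] = trilinear_on[of Rbar, OF Rbar_add]

lemma Rbar_J3 [simp]: "X \<in> V \<Longrightarrow> Y \<in> V \<Longrightarrow> Z \<in> V \<Longrightarrow> Rbar X Y (J Z) = J (Rbar X Y Z)"
  by (simp add: Rbar_def)

lemma br_anti: "X \<in> V \<Longrightarrow> Y \<in> V \<Longrightarrow> br X Y = - br Y X" by (simp add: br_T T_def)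

lemma Rbar_anti: assumes "X \<in> V" "Y \<in> V" "Z \<in> V" shows "Rbar X Y Z = - Rbar Y X Z"
  using assms br_anti[of X Y] by (simp add: Rbar_def)

lemma Rbar_skew: assumes "X \<in> V" "Y \<in> V" "Z \<in> V" "U \<in> V" shows "g (Rbar X Y Z) U p = - g Z (Rbar X Y U) p"
proof -
  have 2: "der X (der Y (g Z U)) p = g (D X (D Y Z)) U p + g (D Y Z) (D X U) p + (g (D X Z) (D Y U) p + g Z (D X (D Y U)) p)"
    if "X \<in> V" "Y \<in> V" for X Y
    using that assms by (simp add: D_metric der_add)
  have "der (br X Y) (g Z U) p = der X (der Y (g Z U)) p - der Y (der X (g Z U)) p"
    using der_br[of X Y "g Z U"] assms by simp
  moreover have "der (br X Y) (g Z U) p = g (D (br X Y) Z) U p + g Z (D (br X Y) U) p"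
    using D_metric[of "br X Y" Z U] assms by simp
  ultimately show ?thesis using 2[of X Y] 2[of Y X] assms by (simp add: Rbar_def)
qed

text \<open>
  The covariant derivative of the torsion, see \<open>leibniz_T\<close>.
\<close>
definition tau where "tau X a b = A X a b - A X b a"

lemma V_tau [simp]: "X \<in> V \<Longrightarrow> a \<in> V \<Longrightarrow> b \<in> V \<Longrightarrow> tau X a b \<in> V" by (simp add: tau_def)

lemma leibniz_T: assumes "X \<in> V" "a \<in> V" "b \<in> V" shows "D X (T a b) = tau X a b + T (D X a) b + T a (D X b)"
  using assms by (simp add: tau_def A_def T_def)

text \<open>
  \<open>T\<close> is dual to \<open>eta\<close>, hence so are their derivatives.
\<close>
lemma tau_inner: assumes "X \<in> V" "a \<in> V" "b \<in> V" "Y \<in> V" shows "g (tau X a b) Y p = - g (A X Y a) b p"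
  using A_cyc[of X a b Y p] A_skew[of X b a Y p] assms by (simp add: tau_def)

text \<open>
  The first Bianchi identity of a connection with torsion, from the Jacobi identity.
\<close>
lemma bianchi_Rbar: assumes "X \<in> V" "Y \<in> V" "Z \<in> V"
  shows "Rbar X Y Z + Rbar Y Z X + Rbar Z X Y
    = tau X Y Z + tau Y Z X + tau Z X Y + (T (T X Y) Z + T (T Y Z) X + T (T Z X) Y)"
proof -
  have b: "br X (br Y Z) = D X (D Y Z) - D X (D Z Y) - (tau X Y Z + T (D X Y) Z + T Y (D X Z))
       - D (br Y Z) X - (T X (D Y Z) - T X (D Z Y) - T X (T Y Z))" if "X \<in> V" "Y \<in> V" "Z \<in> V" for X Y Z
  proof -
    have "br X (br Y Z) = D X (br Y Z) - D (br Y Z) X - T X (br Y Z)" using that by (simp add: br_T[of X])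
    moreover have "D X (br Y Z) = D X (D Y Z) - D X (D Z Y) - D X (T Y Z)"
      using that by (simp add: br_T)
    moreover have "T X (br Y Z) = T X (D Y Z) - T X (D Z Y) - T X (T Y Z)"
      using that by (simp add: br_T)
    ultimately show ?thesis using that by (simp add: leibniz_T)
  qed
  have "br X (br Y Z) + br Y (br Z X) + br Z (br X Y) = 0" using br_jacobi assms by blast
  then show ?thesis
    unfolding b[OF assms] b[OF assms(2,3,1)] b[OF assms(3,1,2)] Rbar_def
    using T_anti[of Z "D X Y"] T_anti[of X "D Y Z"] T_anti[of Y "D Z X"] T_anti[of Y "D X Z"]
      T_anti[of Z "D Y X"] T_anti[of X "D Z Y"] T_anti[of X "T Y Z"] T_anti[of Y "T Z X"] T_anti[of Z "T X Y"]
    by (simp add: algebra_simps)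
qed

section \<open>Consequences of the Gray condition\<close>

text \<open>
  The curvature of \<open>D - eta\<close> in terms of \<open>D\<close> and \<open>eta\<close>, see \<open>Rlc_eq\<close>.
\<close>
definition Rlc where "Rlc X Y Z = Rbar X Y Z - (A X Y Z - A Y X Z + eta (T X Y) Z) + eta X (eta Y Z) - eta Y (eta X Z)"

lemma leibniz_eta: "X \<in> V \<Longrightarrow> Y \<in> V \<Longrightarrow> Z \<in> V \<Longrightarrow> D X (eta Y Z) = A X Y Z + eta (D X Y) Z + eta Y (D X Z)"
  by (simp add: A_def)

lemma Rlc_eq: assumes "X \<in> V" "Y \<in> V" "Z \<in> V"
  shows "Rlc X Y Z = (D X (D Y Z - eta Y Z) - eta X (D Y Z - eta Y Z))
          - (D Y (D X Z - eta X Z) - eta Y (D X Z - eta X Z)) - (D (br X Y) Z - eta (br X Y) Z)"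
  using assms by (simp add: Rlc_def Rbar_def leibniz_eta br_T algebra_simps)

lemma V_Rlc [simp]: "X \<in> V \<Longrightarrow> Y \<in> V \<Longrightarrow> Z \<in> V \<Longrightarrow> Rlc X Y Z \<in> V" by (simp add: Rlc_def)

lemma Rlc_bianchi: assumes "X \<in> V" "Y \<in> V" "Z \<in> V"
  shows "Rlc X Y Z + Rlc Y Z X + Rlc Z X Y = 0"
  using bianchi_Rbar[OF assms] assms
  by (simp add: Rlc_def tau_def T_def algebra_simps)

lemma Rlc_skew: assumes V: "X \<in> V" "Y \<in> V" "Z \<in> V" "U \<in> V" shows "g (Rlc X Y Z) U p = - g (Rlc X Y U) Z p"
proof -
  have r: "g (Rlc X Y Z) U p = g (Rbar X Y Z) U p - (g (A X Y Z) U p - g (A Y X Z) U p + g (eta (T X Y) Z) U p)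
      - g (eta X U) (eta Y Z) p + g (eta Y U) (eta X Z) p" if "Z \<in> V" "U \<in> V" for Z U
    using V that eta_skew[of X "eta Y Z" U p] eta_skew[of Y "eta X Z" U p] by (simp add: Rlc_def)
  have "g (A X Y Z) U p = - g (A X Y U) Z p" "g (A Y X Z) U p = - g (A Y X U) Z p"
    "g (eta (T X Y) Z) U p = - g (eta (T X Y) U) Z p" "g (Rbar X Y Z) U p = - g (Rbar X Y U) Z p"
    using V A_skew[OF V, of p] A_skew[OF V(2,1,3,4), of p] eta_skew[OF V_T[OF V(1,2)] V(3,4), of p]
      Rbar_skew[OF V, of p] g_sym[of Z "Rbar X Y U" p] by simp_all
  moreover have "g (eta X U) (eta Y Z) p = g (eta Y Z) (eta X U) p" "g (eta Y U) (eta X Z) p = g (eta X Z) (eta Y U) p"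
    using V by (auto intro: g_sym)
  ultimately show ?thesis using r[OF V(3,4)] r[OF V(4,3)] by linarith
qed

lemma Rlc_pair: assumes "X \<in> V" "Y \<in> V" "Z \<in> V" "U \<in> V" shows "g (Rlc X Y Z) U p = g (Rlc Z U X) Y p"
proof -
  have b: "g (Rlc a b c) d p + g (Rlc b c a) d p + g (Rlc c a b) d p = 0"
    if "a \<in> V" "b \<in> V" "c \<in> V" "d \<in> V" for a b c d
  proof -
    have "g (Rlc a b c + Rlc b c a + Rlc c a b) d p = 0" using Rlc_bianchi that by simp
    then show ?thesis using that by simp
  qed
  have an: "g (Rlc a b c) d p = - g (Rlc b a c) d p" if "a \<in> V" "b \<in> V" "c \<in> V" "d \<in> V" for a b c d
  proof -
    have "Rlc a b c = - Rlc b a c" using Rbar_anti[of a b c] T_anti[of a b] that by (simp add: Rlc_def)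
    then show ?thesis using that by simp
  qed
  have s: "g (Rlc a b c) d p = - g (Rlc a b d) c p" if "a \<in> V" "b \<in> V" "c \<in> V" "d \<in> V" for a b c d
    using Rlc_skew that by blast
  show ?thesis
    using b[OF assms(1,2,3,4)] b[OF assms(2,3,4,1)] b[OF assms(3,4,1,2)] b[OF assms(4,1,2,3)]
      an[OF assms(2,4,1,3)] an[OF assms(3,4,1,2)] an[OF assms(3,4,2,1)] an[OF assms(3,1,2,4)]
      s[OF assms(4,1,3,2)] s[OF assms(4,2,3,1)] s[OF assms(4,3,2,1)] s[OF assms(1,2,3,4)] s[OF assms(1,3,2,4)] s[OF assms(2,3,1,4)]
    by linarith
qed

lemma gray_vec: assumes "X \<in> V" "Y \<in> V" "Z \<in> V"
  shows "Rlc X Y Z - Rlc (J X) (J Y) Z = Rlc (J X) Y (J Z) - J (Rlc (J X) Y Z)"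
proof (rule eq_I)
  fix U p assume U: "U \<in> V"
  have "g (Rlc X Y Z) U p - g (Rlc (J X) (J Y) Z) U p = g (Rlc (J X) Y (J Z)) U p + g (Rlc (J X) Y Z) (J U) p"
    using gray[OF assms U refl, of p]
    by (simp only: Rlc_eq[OF assms] Rlc_eq[OF V_J V_J, OF assms] Rlc_eq[OF V_J _ V_J, OF assms]
        Rlc_eq[OF V_J, OF assms])
  then show "g (Rlc X Y Z - Rlc (J X) (J Y) Z) U p = g (Rlc (J X) Y (J Z) - J (Rlc (J X) Y Z)) U p"
    using assms U by (simp add: g_J_left)
qed (use assms in simp_all)

text \<open>
  The parts of \<open>Rlc X Y\<close> that anticommute and commute with \<open>J\<close>.
\<close>
definition Rlc_anti where "Rlc_anti X Y Z = A X Y Z - A Y X Z + eta (T X Y) Z"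
definition Rlc_lin where "Rlc_lin X Y Z = Rbar X Y Z + eta X (eta Y Z) - eta Y (eta X Z)"

lemma V_Rlc_anti [simp]: "X \<in> V \<Longrightarrow> Y \<in> V \<Longrightarrow> Z \<in> V \<Longrightarrow> Rlc_anti X Y Z \<in> V" by (simp add: Rlc_anti_def)
lemma V_Rlc_lin [simp]: "X \<in> V \<Longrightarrow> Y \<in> V \<Longrightarrow> Z \<in> V \<Longrightarrow> Rlc_lin X Y Z \<in> V" by (simp add: Rlc_lin_def)
lemma Rlc_parts_minus [simp]: assumes "X \<in> V" "Y \<in> V" "Z \<in> V"
  shows "Rlc_anti (- X) Y Z = - Rlc_anti X Y Z" "Rlc_anti X Y (- Z) = - Rlc_anti X Y Z" "Rlc_lin (- X) Y Z = - Rlc_lin X Y Z" "Rlc_lin X Y (- Z) = - Rlc_lin X Y Z"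
  using assms by (simp_all add: Rlc_anti_def Rlc_lin_def algebra_simps)
lemma Rlc_parts: "Rlc X Y Z = Rlc_lin X Y Z - Rlc_anti X Y Z" by (simp add: Rlc_def Rlc_anti_def Rlc_lin_def)
lemma Rlc_anti_J: "X \<in> V \<Longrightarrow> Y \<in> V \<Longrightarrow> Z \<in> V \<Longrightarrow> Rlc_anti X Y (J Z) = - J (Rlc_anti X Y Z)" by (simp add: Rlc_anti_def)
lemma Rlc_lin_J: "X \<in> V \<Longrightarrow> Y \<in> V \<Longrightarrow> Z \<in> V \<Longrightarrow> Rlc_lin X Y (J Z) = J (Rlc_lin X Y Z)" by (simp add: Rlc_lin_def)
lemma Rlc_anti_swap: "X \<in> V \<Longrightarrow> Y \<in> V \<Longrightarrow> Z \<in> V \<Longrightarrow> Rlc_anti X Y Z = - Rlc_anti Y X Z"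
  using T_anti[of X Y] by (simp add: Rlc_anti_def)

text \<open>
  Replacing \<open>Z\<close> by \<open>J Z\<close> in the Gray condition separates the two parts.
\<close>
lemma Rlc_parts_gray: assumes "X \<in> V" "Y \<in> V" "Z \<in> V"
  shows "Rlc_lin (J X) (J Y) Z = Rlc_lin X Y Z" "Rlc_anti X Y Z - Rlc_anti (J X) (J Y) Z = - (J (Rlc_anti (J X) Y Z) + J (Rlc_anti (J X) Y Z))"
proof -
  define f where "f = Rlc_lin X Y Z - Rlc_lin (J X) (J Y) Z"
  define e where "e = Rlc_anti X Y Z - Rlc_anti (J X) (J Y) Z"
  define j where "j = J (Rlc_anti (J X) Y Z)"
  have V: "f \<in> V" "e \<in> V" "j \<in> V" using assms by (simp_all add: f_def e_def j_def)
  have 1: "f - e = j + j"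
    using gray_vec[OF assms] assms by (simp add: f_def e_def j_def Rlc_parts Rlc_lin_J Rlc_anti_J algebra_simps)
  have "J f + J e = Rlc_anti (J X) Y Z + Rlc_anti (J X) Y Z"
    using gray_vec[of X Y "J Z"] assms by (simp add: f_def e_def Rlc_parts Rlc_lin_J Rlc_anti_J algebra_simps)
  then have "J (J f + J e) = j + j" using assms by (simp add: j_def)
  then have 2: "- f - e = j + j" using V by simp
  have "f = e + (j + j)" "- f = e + (j + j)" using 1 2 by (metis add.commute diff_add_cancel)+
  then have "f = - f" by (rule trans[OF _ sym])
  then have "f + f = 0" by (metis add.right_inverse)
  then have f: "f = 0" using V double_0 by blast
  then show "Rlc_lin (J X) (J Y) Z = Rlc_lin X Y Z" by (simp add: f_def)
  have "e = - (j + j)" using 1 f by (metis minus_diff_eq diff_0 minus_minus)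
  then show "Rlc_anti X Y Z - Rlc_anti (J X) (J Y) Z = - (J (Rlc_anti (J X) Y Z) + J (Rlc_anti (J X) Y Z))"
    by (simp add: e_def j_def)
qed

lemma Rlc_anti_J1: assumes V: "X \<in> V" "Y \<in> V" "Z \<in> V"
  shows "Rlc_anti (J X) Y Z = J (Rlc_anti X Y Z)" "Rlc_anti X (J Y) Z = J (Rlc_anti X Y Z)"
proof -
  have 1: "J (Rlc_anti (J X) Y Z) = J (Rlc_anti X (J Y) Z)" if V: "X \<in> V" "Y \<in> V" "Z \<in> V" for X Y
  proof (rule double_cancel)
    have "Rlc_anti Y X Z - Rlc_anti (J Y) (J X) Z = - (Rlc_anti X Y Z - Rlc_anti (J X) (J Y) Z)"
      using Rlc_anti_swap[of Y X Z] Rlc_anti_swap[of "J Y" "J X" Z] V by simp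
    then have "- (J (Rlc_anti (J Y) X Z) + J (Rlc_anti (J Y) X Z)) = J (Rlc_anti (J X) Y Z) + J (Rlc_anti (J X) Y Z)"
      unfolding Rlc_parts_gray(2)[OF V] Rlc_parts_gray(2)[OF V(2,1,3)] by (simp only: minus_minus)
    moreover have "J (Rlc_anti (J Y) X Z) = - J (Rlc_anti X (J Y) Z)" using Rlc_anti_swap[of "J Y" X Z] V by simp
    ultimately show "J (Rlc_anti (J X) Y Z) + J (Rlc_anti (J X) Y Z) = J (Rlc_anti X (J Y) Z) + J (Rlc_anti X (J Y) Z)"
      by simp
  qed (use V in simp_all)
  have 2: "Rlc_anti (J X) Y Z = Rlc_anti X (J Y) Z" if V: "X \<in> V" "Y \<in> V" "Z \<in> V" for X Y
  proof -
    have "J (J (Rlc_anti (J X) Y Z)) = J (J (Rlc_anti X (J Y) Z))" using 1[OF V] by simp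
    then show ?thesis using V by simp
  qed
  show 3: "Rlc_anti (J X) Y Z = J (Rlc_anti X Y Z)"
  proof (rule double_cancel)
    show "Rlc_anti (J X) Y Z + Rlc_anti (J X) Y Z = J (Rlc_anti X Y Z) + J (Rlc_anti X Y Z)"
      using Rlc_parts_gray(2)[of "J X" Y Z] V 2[OF V] by simp
  qed (use V in simp_all)
  then show "Rlc_anti X (J Y) Z = J (Rlc_anti X Y Z)" using 2[OF V] by simp
qed

lemma A_J1_aux: assumes V: "X \<in> V" "Y \<in> V" "Z \<in> V"
  shows "A (J X) Y Z = J (A X Y Z) - (J (A Y X Z) + J (A Y X Z))"
  using Rlc_anti_J1(1)[OF V] V by (simp add: Rlc_anti_def algebra_simps)

text \<open>
  With \<open>G = A X Y Z - A Y X Z\<close>, complex bilinearity of \<open>Rlc_anti\<close> gives \<open>- G\<close> for the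
  arguments \<open>J X\<close>, \<open>J Y\<close>, whereas moving \<open>J\<close> through \<open>A\<close> directly gives \<open>3 G\<close>.
\<close>
lemma A_sym: assumes V: "X \<in> V" "Y \<in> V" "Z \<in> V" shows "A X Y Z = A Y X Z"
proof -
  define G where "G = A X Y Z - A Y X Z"
  have GV: "G \<in> V" using V by (simp add: G_def)
  have "Rlc_anti (J X) (J Y) Z = - Rlc_anti X Y Z" using Rlc_anti_J1(1)[of X "J Y" Z] Rlc_anti_J1(2)[OF V] V by simp
  then have "A (J X) (J Y) Z - A (J Y) (J X) Z = - G" using V by (simp add: Rlc_anti_def G_def algebra_simps)
  moreover have "A (J X) (J Y) Z - A (J Y) (J X) Z = G + G + G"
    using V by (simp add: A_J1_aux G_def algebra_simps)
  ultimately have "(G + G) + (G + G) = 0" by (simp add: algebra_simps add_eq_0_iff2)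
  then have "G = 0" using double_0 GV V_add by blast
  then show ?thesis by (simp add: G_def)
qed

lemma A_J1 [simp]: assumes V: "X \<in> V" "Y \<in> V" "Z \<in> V" shows "A (J X) Y Z = - J (A X Y Z)"
  using A_J1_aux[OF V] A_sym[OF V] by simp

lemma Rbar_JJ: assumes V: "X \<in> V" "Y \<in> V" "Z \<in> V" shows "Rbar (J X) (J Y) Z = Rbar X Y Z"
  using Rlc_parts_gray(1)[OF V] V by (simp add: Rlc_lin_def)

lemma Rbar_J12: assumes V: "X \<in> V" "Y \<in> V" "Z \<in> V" shows "Rbar X (J Y) Z = - Rbar (J X) Y Z"
  proof -
  have "- Rbar X (J Y) Z = Rbar (J X) Y Z" using Rbar_JJ[of "J X" Y Z] V by simp
  then show ?thesis by (metis minus_minus)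
qed

text \<open>
  The pair symmetry of the Levi-Civita curvature is inherited by its \<open>J\<close>-invariant part, which is
  obtained by averaging over \<open>J\<close> in either pair of arguments.
\<close>
lemma Rlc_lin_pair: assumes "X \<in> V" "Y \<in> V" "Z \<in> V" "W \<in> V" shows "g (Rlc_lin X Y Z) W p = g (Rlc_lin Z W X) Y p"
proof -
  have r: "Rlc X Y Z = Rlc_lin X Y Z - eta (T X Y) Z" if "X \<in> V" "Y \<in> V" "Z \<in> V" for X Y Z
    using A_sym[OF that] by (simp add: Rlc_parts Rlc_anti_def)
  have 1: "2 * g (Rlc_lin X Y Z) W p = g (Rlc X Y Z) W p + g (Rlc (J X) (J Y) Z) W p"
    if "X \<in> V" "Y \<in> V" "Z \<in> V" "W \<in> V" for X Y Z W
    using that Rlc_parts_gray(1)[OF that(1,2,3)] by (simp add: r)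
  have 2: "2 * g (Rlc_lin X Y Z) W p = g (Rlc X Y Z) W p + g (Rlc X Y (J Z)) (J W) p"
    if "X \<in> V" "Y \<in> V" "Z \<in> V" "W \<in> V" for X Y Z W
    using that by (simp add: r Rlc_lin_J g_J)
  have "2 * g (Rlc_lin X Y Z) W p = 2 * g (Rlc_lin Z W X) Y p"
    using 1[OF assms] 2[of Z W X Y] Rlc_pair[of X Y Z W p] Rlc_pair[of "J X" "J Y" Z W p] assms by simp
  then show ?thesis by simp
qed

lemma tau_J [simp]: assumes "X \<in> V" "a \<in> V" "b \<in> V"
  shows "tau (J X) a b = - J (tau X a b)" "tau X (J a) b = - J (tau X a b)" "tau X a (J b) = - J (tau X a b)"
  using assms by (simp_all add: tau_def algebra_simps)

lemma tau_add [simp]: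
  "X \<in> V \<Longrightarrow> X' \<in> V \<Longrightarrow> Y \<in> V \<Longrightarrow> Z \<in> V \<Longrightarrow> tau (X + X') Y Z = tau X Y Z + tau X' Y Z"
  "X \<in> V \<Longrightarrow> X' \<in> V \<Longrightarrow> Y \<in> V \<Longrightarrow> Z \<in> V \<Longrightarrow> tau Y (X + X') Z = tau Y X Z + tau Y X' Z"
  "X \<in> V \<Longrightarrow> X' \<in> V \<Longrightarrow> Y \<in> V \<Longrightarrow> Z \<in> V \<Longrightarrow> tau Y Z (X + X') = tau Y Z X + tau Y Z X'"
  by (simp_all add: tau_def algebra_simps)

lemmas tau_lin [simp] = trilinear_on[of tau, OF tau_add]

lemma tau_cyc: assumes "X \<in> V" "Y \<in> V" "Z \<in> V" shows "tau X Y Z + tau Y Z X + tau Z X Y = 0"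
  using A_sym[of X Y Z] A_sym[of Y Z X] A_sym[of Z X Y] assms by (simp add: tau_def)

lemma tau_sym: assumes "X \<in> V" "Y \<in> V" "a \<in> V" "b \<in> V" shows "g (tau X a b) Y p = g (tau Y a b) X p"
  using assms A_sym[of X Y a] by (simp add: tau_inner)

text \<open>
  Twice the component of the curvature of \<open>D\<close> that is complex linear in \<open>X\<close> and antilinear in
  \<open>Y\<close>; by \<open>J\<close>-invariance it carries the same information as \<open>Rbar\<close>, but the Bianchi identity
  takes a simpler form.
\<close>
definition K where "K X Y Z = Rbar X Y Z - J (Rbar (J X) Y Z)"

lemma V_K [simp]: "X \<in> V \<Longrightarrow> Y \<in> V \<Longrightarrow> Z \<in> V \<Longrightarrow> K X Y Z \<in> V" by (simp add: K_def)

lemma K_add [simp]: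
  "X \<in> V \<Longrightarrow> X' \<in> V \<Longrightarrow> Y \<in> V \<Longrightarrow> Z \<in> V \<Longrightarrow> K (X + X') Y Z = K X Y Z + K X' Y Z"
  "X \<in> V \<Longrightarrow> X' \<in> V \<Longrightarrow> Y \<in> V \<Longrightarrow> Z \<in> V \<Longrightarrow> K Y (X + X') Z = K Y X Z + K Y X' Z"
  "X \<in> V \<Longrightarrow> X' \<in> V \<Longrightarrow> Y \<in> V \<Longrightarrow> Z \<in> V \<Longrightarrow> K Y Z (X + X') = K Y Z X + K Y Z X'"
  by (simp_all add: K_def algebra_simps)

lemmas K_lin [simp] = trilinear_on[of K, OF K_add]

lemma K_J [simp]: assumes "X \<in> V" "Y \<in> V" "Z \<in> V"
  shows "K (J X) Y Z = J (K X Y Z)" "K X (J Y) Z = - J (K X Y Z)" "K X Y (J Z) = J (K X Y Z)"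
  using assms by (simp_all add: K_def Rbar_JJ) (simp add: Rbar_J12)

lemma K_adj: assumes "X \<in> V" "Y \<in> V" "Z \<in> V" "W \<in> V" shows "g (K X Y Z) W p = g Z (K Y X W) p"
proof -
  have "Rbar (J Y) X W = Rbar (J X) Y W" using Rbar_anti[of "J Y" X W] Rbar_J12[of X Y W] assms by simp
  then have "K Y X W = - Rbar X Y W - J (Rbar (J X) Y W)" using Rbar_anti[of Y X W] assms by (simp add: K_def)
  then show ?thesis
    using Rbar_skew[of X Y Z W p] Rbar_skew[of "J X" Y Z "J W" p] g_J_left[of "Rbar (J X) Y Z" W p] assms
    by (simp add: K_def)
qed

text \<open>
  Combine the first Bianchi identity at \<open>(X, Y, Z)\<close>, \<open>(J X, Y, Z)\<close> and \<open>(X, Y, J Z)\<close>; the terms with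
  \<open>tau\<close> drop out since \<open>A\<close> is symmetric.
\<close>
lemma K_bianchi: assumes V: "X \<in> V" "Y \<in> V" "Z \<in> V"
  shows "K X Y Z - K Z Y X = T (T Z X) Y + T (T Z X) Y"
proof -
  have b: "Rbar X Y Z + Rbar Y Z X + Rbar Z X Y = T (T X Y) Z + T (T Y Z) X + T (T Z X) Y"
    if "X \<in> V" "Y \<in> V" "Z \<in> V" for X Y Z using bianchi_Rbar[OF that] tau_cyc[OF that] by simp
  have 2: "Rbar (J X) Y Z + J (Rbar Y Z X) + Rbar Z (J X) Y = J (T (T X Y) Z - T (T Y Z) X + T (T Z X) Y)"
    using b[of "J X" Y Z] V by simp
  have 3: "J (Rbar X Y Z) + Rbar Y (J Z) X + Rbar (J Z) X Y = J (- T (T X Y) Z + T (T Y Z) X + T (T Z X) Y)"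
    using b[of X Y "J Z"] V by simp
  have 4: "Rbar (J Z) Y X = - Rbar Y (J Z) X" "Rbar Z (J X) Y = - Rbar (J Z) X Y" "Rbar Z Y X = - Rbar Y Z X"
    using Rbar_anti[of "J Z" Y X] Rbar_J12[of Z X Y] Rbar_anti[of Z Y X] V by simp_all
  have "Rbar (J X) Y Z = J (T (T X Y) Z - T (T Y Z) X + T (T Z X) Y) - J (Rbar Y Z X) + Rbar (J Z) X Y"
    using 2 4(2) by (simp add: algebra_simps)
  then have j1: "J (Rbar (J X) Y Z) = Rbar Y Z X + J (Rbar (J Z) X Y) - (T (T X Y) Z - T (T Y Z) X + T (T Z X) Y)"
    using V by simp
  have "Rbar Y (J Z) X = J (- T (T X Y) Z + T (T Y Z) X + T (T Z X) Y) - J (Rbar X Y Z) - Rbar (J Z) X Y"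
    using 3 by (simp add: algebra_simps)
  then have j2: "J (Rbar Y (J Z) X) = Rbar X Y Z - J (Rbar (J Z) X Y) - (- T (T X Y) Z + T (T Y Z) X + T (T Z X) Y)"
    using V by simp
  show ?thesis using V by (simp add: K_def 4 j1 j2 algebra_simps)
qed

lemma K_pair: assumes "X \<in> V" "Y \<in> V" "Z \<in> V" "W \<in> V"
  shows "g (K X Y Z) W p + 2 * g (eta X Z) (eta Y W) p = g (K Z W X) Y p + 2 * g (eta Z X) (eta W Y) p"
proof -
  have f: "g (Rlc_lin X Y Z) W p = g (Rbar X Y Z) W p - g (eta X W) (eta Y Z) p + g (eta Y W) (eta X Z) p"
    if "X \<in> V" "Y \<in> V" "Z \<in> V" "W \<in> V" for X Y Z W
    using that eta_skew[of X "eta Y Z" W p] eta_skew[of Y "eta X Z" W p] by (simp add: Rlc_lin_def)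
  have 1: "g (K X Y Z) W p + 2 * g (eta X Z) (eta Y W) p = g (Rlc_lin X Y Z) W p + g (Rlc_lin (J X) Y Z) (J W) p"
    if "X \<in> V" "Y \<in> V" "Z \<in> V" "W \<in> V" for X Y Z W
    using that g_sym[of "eta Y W" "eta X Z" p] by (simp add: f K_def g_J_left g_J)
  have FJ: "Rlc_lin X (J Y) Z = - Rlc_lin (J X) Y Z" if "X \<in> V" "Y \<in> V" "Z \<in> V" for X Y Z
    using that by (simp add: Rlc_lin_def Rbar_J12)
  have "g (Rlc_lin (J X) Y Z) (J W) p = g (Rlc_lin Z (J W) (J X)) Y p" using Rlc_lin_pair assms by simp
  also have "\<dots> = g (Rlc_lin (J Z) W X) (J Y) p" using assms by (simp add: FJ Rlc_lin_J g_J_left)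
  finally show ?thesis using 1[OF assms] 1[of Z W X Y] Rlc_lin_pair[OF assms] assms by simp
qed

section \<open>Second derivatives of the torsion\<close>

text \<open>
  The second covariant derivative of \<open>eta\<close>.
\<close>
definition DA where "DA X Y Z U = D X (A Y Z U) - A (D X Y) Z U - A Y (D X Z) U - A Y Z (D X U)"

lemma V_DA [simp]: "X \<in> V \<Longrightarrow> Y \<in> V \<Longrightarrow> Z \<in> V \<Longrightarrow> U \<in> V \<Longrightarrow> DA X Y Z U \<in> V" by (simp add: DA_def)

lemma leibniz_A: "X \<in> V \<Longrightarrow> Y \<in> V \<Longrightarrow> Z \<in> V \<Longrightarrow> U \<in> V \<Longrightarrow>
    D X (A Y Z U) = DA X Y Z U + A (D X Y) Z U + A Y (D X Z) U + A Y Z (D X U)"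
  by (simp add: DA_def)

lemma DA_minus1: "X \<in> V \<Longrightarrow> Y \<in> V \<Longrightarrow> Z \<in> V \<Longrightarrow> U \<in> V \<Longrightarrow> DA (- X) Y Z U = - DA X Y Z U"
  and DA_minus2: "X \<in> V \<Longrightarrow> Y \<in> V \<Longrightarrow> Z \<in> V \<Longrightarrow> U \<in> V \<Longrightarrow> DA X (- Y) Z U = - DA X Y Z U"
  and DA_minus3: "X \<in> V \<Longrightarrow> Y \<in> V \<Longrightarrow> Z \<in> V \<Longrightarrow> U \<in> V \<Longrightarrow> DA X Y (- Z) U = - DA X Y Z U"
  by (simp_all add: DA_def algebra_simps)

lemma DA_J [simp]:
  assumes "X \<in> V" "Y \<in> V" "Z \<in> V" "U \<in> V"
  shows "DA X (J Y) Z U = - J (DA X Y Z U)" "DA X Y (J Z) U = - J (DA X Y Z U)" "DA X Y Z (J U) = - J (DA X Y Z U)"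
  using assms by (simp_all add: DA_def)

lemma DA_sym: assumes "X \<in> V" "Y \<in> V" "Z \<in> V" "U \<in> V" shows "DA X Y Z U = DA X Z Y U"
  using assms A_sym[of Y Z U] A_sym[of "D X Y" Z U] A_sym[of Y "D X Z" U] A_sym[of Y Z "D X U"]
  by (simp add: DA_def algebra_simps)

lemma DA_skew: assumes V: "X \<in> V" "Y \<in> V" "Z \<in> V" "U \<in> V" "W \<in> V"
  shows "g (DA X Y Z U) W p = - g (DA X Y Z W) U p"
proof -
  have s: "g (A a b c) d q = - g (A a b d) c q" if "a \<in> V" "b \<in> V" "c \<in> V" "d \<in> V" for a b c d q
    using A_skew that by blast
  have "g (A Y Z U) W q + g (A Y Z W) U q = 0" for q using s[OF V(2-5), of q] by simp
  from D_sum2[OF V(1) V_A[OF V(2-4)] V(5) V_A[OF V(2,3,5)] V(4) this, of p]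
  have "g (D X (A Y Z U)) W p + g (A Y Z U) (D X W) p + (g (D X (A Y Z W)) U p + g (A Y Z W) (D X U) p) = 0" .
  then show ?thesis
    using s[of Y Z U "D X W" p] s[of Y Z W "D X U" p] s[of "D X Y" Z U W p] s[of Y "D X Z" U W p] V by (simp add: DA_def)
qed

lemma DA_cyc: assumes V: "X \<in> V" "Y \<in> V" "Z \<in> V" "U \<in> V" "W \<in> V"
  shows "g (DA X Y Z U) W p + g (DA X Y U W) Z p + g (DA X Y W Z) U p = 0"
proof -
  have c: "g (A a b c) d q + g (A a c d) b q + g (A a d b) c q = 0" if "a \<in> V" "b \<in> V" "c \<in> V" "d \<in> V" for a b c d q
    using A_cyc that by blast
  from D_sum3[OF V(1) _ _ _ _ _ _ c[OF V(2-5)], of p] V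
  have "g (D X (A Y Z U)) W p + g (A Y Z U) (D X W) p + (g (D X (A Y U W)) Z p + g (A Y U W) (D X Z) p)
    + (g (D X (A Y W Z)) U p + g (A Y W Z) (D X U) p) = 0" by simp
  then show ?thesis
    using c[of "D X Y" Z U W p] c[of Y "D X Z" U W p] c[of Y Z "D X U" W p] c[of Y Z U "D X W" p] V
    by (simp add: DA_def)
qed

lemma ricci: assumes "X \<in> V" "Y \<in> V" "Z \<in> V" "U \<in> V"
  shows "Rbar X Y (eta Z U) - eta (Rbar X Y Z) U - eta Z (Rbar X Y U) = DA X Y Z U - DA Y X Z U + A (T X Y) Z U"
  using assms by (simp add: Rbar_def leibniz_eta leibniz_A br_T algebra_simps)

text \<open>
  \<open>DA\<close> is antilinear in its last three arguments; these are twice its antilinear and linear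
  parts in the direction of differentiation.
\<close>
definition DA_anti where "DA_anti X Y Z U = DA X Y Z U - DA (J X) (J Y) Z U"
definition DA_lin where "DA_lin X Y Z U = DA X Y Z U + DA (J X) (J Y) Z U"

lemma V_DA_anti [simp]: "X \<in> V \<Longrightarrow> Y \<in> V \<Longrightarrow> Z \<in> V \<Longrightarrow> U \<in> V \<Longrightarrow> DA_anti X Y Z U \<in> V" by (simp add: DA_anti_def)
lemma V_DA_lin [simp]: "X \<in> V \<Longrightarrow> Y \<in> V \<Longrightarrow> Z \<in> V \<Longrightarrow> U \<in> V \<Longrightarrow> DA_lin X Y Z U \<in> V" by (simp add: DA_lin_def)

lemma DA_split: "DA X Y Z U + DA X Y Z U = DA_anti X Y Z U + DA_lin X Y Z U" by (simp add: DA_anti_def DA_lin_def)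

lemma DA_anti_J: assumes "X \<in> V" "Y \<in> V" "Z \<in> V" "U \<in> V"
  shows "DA_anti (J X) Y Z U = - J (DA_anti X Y Z U)" "DA_anti X (J Y) Z U = - J (DA_anti X Y Z U)"
  using assms by (simp_all add: DA_anti_def DA_minus1 DA_minus2)

lemma A_T_DA_anti: assumes V: "X \<in> V" "Y \<in> V" "Z \<in> V" "U \<in> V"
  shows "A (T X Y) Z U + A (T X Y) Z U = DA_anti Y X Z U - DA_anti X Y Z U"
proof -
  have "DA X Y Z U - DA Y X Z U + A (T X Y) Z U
      = DA (J X) (J Y) Z U - DA (J Y) (J X) Z U + A (T (J X) (J Y)) Z U"
    unfolding ricci[OF V, symmetric] ricci[OF V_J[OF V(1)] V_J[OF V(2)] V(3,4), symmetric]
    using V by (simp add: Rbar_JJ)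
  moreover have "A (T (J X) (J Y)) Z U = - A (T X Y) Z U" using V by simp
  ultimately have eq: "DA X Y Z U - DA Y X Z U + A (T X Y) Z U
      = DA (J X) (J Y) Z U - DA (J Y) (J X) Z U - A (T X Y) Z U" by simp
  have "A (T X Y) Z U + A (T X Y) Z U
      = (DA X Y Z U - DA Y X Z U + A (T X Y) Z U) - (DA X Y Z U - DA Y X Z U) + A (T X Y) Z U" by simp
  also have "\<dots> = DA_anti Y X Z U - DA_anti X Y Z U" unfolding eq DA_anti_def by (simp add: algebra_simps)
  finally show ?thesis .
qed

text \<open>
  By the Ricci identity \<open>2 A (T X Y)\<close> is the skew part of \<open>DA_anti\<close>. As the two
  sides transform with opposite signs under \<open>J\<close> in \<open>X\<close>, they are zero.
\<close>
lemma A_T [simp]: assumes V: "X \<in> V" "Y \<in> V" "Z \<in> V" "U \<in> V" shows "A (T X Y) Z U = 0"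
proof -
  define a where "a = A (T X Y) Z U"
  have aV: "a \<in> V" using V by (simp add: a_def)
  have "A (T (J X) Y) Z U + A (T (J X) Y) Z U = DA_anti Y (J X) Z U - DA_anti (J X) Y Z U"
    using A_T_DA_anti[OF V_J[OF V(1)] V(2-4)] .
  also have "\<dots> = - J (DA_anti Y X Z U - DA_anti X Y Z U)" using V by (simp add: DA_anti_J)
  also have "\<dots> = - J (a + a)" unfolding A_T_DA_anti[OF V, symmetric] a_def ..
  \<comment> \<open>The left hand side uses \<open>T (J X) = - J (T X)\<close> and antilinearity of \<open>A\<close>, so it is \<open>+ J\<close>.\<close>
  finally have "J a + J a = - J a - J a" using V aV by (simp add: a_def)
  then have "J a + J a = - (J a + J a)" by simp
  then have "(J a + J a) + (J a + J a) = 0" by (metis add.right_inverse)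
  then have "J a = 0" using aV double_0 V_add V_J by blast
  then have "J (J a) = 0" by simp
  then show ?thesis using aV by (simp add: a_def)
qed

lemma DA_anti_sym: assumes V: "X \<in> V" "Y \<in> V" "Z \<in> V" "U \<in> V" shows "DA_anti X Y Z U = DA_anti Y X Z U"
  using A_T_DA_anti[OF V] V by simp

lemma DA_lin_sym: assumes V: "X \<in> V" "Y \<in> V" "Z \<in> V" "U \<in> V" shows "DA_lin X Y Z U = DA_lin X Z Y U"
  using V DA_sym[OF V] DA_sym[OF V_J[OF V(1)] V(2-4)] by (simp add: DA_lin_def)

text \<open>
  The action of \<open>K Y X\<close> as a derivation on the trilinear form \<open>g (eta Z a) b\<close>.
\<close>
definition act where
  "act Y X Z a b p = g (eta (K Y X Z) a) b p + g (eta Z (K Y X a)) b p + g (eta Z a) (K Y X b) p"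

text \<open>
  The Ricci identity for \<open>eta\<close>, complexified; the antilinear part of \<open>DA\<close> cancels by symmetry.
\<close>
lemma act_DA_lin: assumes V: "X \<in> V" "Y \<in> V" "Z \<in> V" "a \<in> V" "b \<in> V" shows "act Y X Z a b p = g (DA_lin X Y Z a) b p"
proof -
  have r: "g (eta (Rbar Y X Z) a) b p + g (eta Z (Rbar Y X a)) b p + g (eta Z a) (Rbar Y X b) p
      = g (DA X Y Z a) b p - g (DA Y X Z a) b p" if "X \<in> V" "Y \<in> V" "Z \<in> V" for X Y Z
  proof -
    have "Rbar Y X (eta Z a) - eta (Rbar Y X Z) a - eta Z (Rbar Y X a) = DA Y X Z a - DA X Y Z a"
      using ricci[OF that(2,1,3) V(4)] that V by simp
    then have "g (Rbar Y X (eta Z a) - eta (Rbar Y X Z) a - eta Z (Rbar Y X a)) b p = g (DA Y X Z a - DA X Y Z a) b p"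
      by simp
    then show ?thesis using that V Rbar_skew[of Y X "eta Z a" b p] by simp
  qed
  have "act Y X Z a b p = (g (DA X Y Z a) b p - g (DA Y X Z a) b p) - (g (DA X (J Y) (J Z) a) b p - g (DA (J Y) X (J Z) a) b p)"
    unfolding r[OF V(1-3), symmetric] r[OF V(1) V_J[OF V(2)] V_J[OF V(3)], symmetric]
    using V g_J_left[of "eta Z a" "Rbar (J Y) X b" p] by (simp add: act_def K_def)
  moreover have "DA Y X Z a + J (DA (J Y) X Z a) = DA X Y Z a + J (DA (J X) Y Z a)"
    using DA_anti_sym[OF V(2,1,3,4)] V by (simp add: DA_anti_def)
  then have "g (DA Y X Z a + J (DA (J Y) X Z a)) b p = g (DA X Y Z a + J (DA (J X) Y Z a)) b p" by simp
  ultimately show ?thesis using V by (simp add: DA_lin_def)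
qed

lemma act_sym: assumes V: "X \<in> V" "Y \<in> V" "Z \<in> V" "a \<in> V" "b \<in> V" shows "act Y X Z a b p = act Z X Y a b p"
  using act_DA_lin[OF V] act_DA_lin[OF V(1,3,2,4,5)] DA_lin_sym[OF V(1-4)] by simp

lemma DA_T: assumes V: "X \<in> V" "c \<in> V" "d \<in> V" "Z \<in> V" "U \<in> V" shows "DA X (T c d) Z U = - A (tau X c d) Z U"
  using V by (simp add: DA_def leibniz_T)

lemma DA_lin_T: assumes V: "X \<in> V" "c \<in> V" "d \<in> V" "Z \<in> V" "U \<in> V"
  shows "DA_lin X (T c d) Z U = - (A (tau X c d) Z U + A (tau X c d) Z U)"
  using V by (simp add: DA_lin_def DA_T)

lemma act_T: assumes V: "X \<in> V" "c \<in> V" "d \<in> V" "Y \<in> V" "a \<in> V" "b \<in> V"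
  shows "act (T c d) X Y a b p = 2 * g (tau X c d) (tau Y a b) p"
proof -
  have "act (T c d) X Y a b p = - 2 * g (A (tau X c d) Y a) b p"
    using act_DA_lin[of X "T c d" Y a b p] V by (simp add: DA_lin_T)
  also have "A (tau X c d) Y a = A Y (tau X c d) a" using V by (intro A_sym) auto
  also have "- 2 * g (A Y (tau X c d) a) b p = 2 * g (tau Y a b) (tau X c d) p" using V by (simp add: tau_inner)
  finally show ?thesis using V g_sym[of "tau Y a b" "tau X c d" p] by simp
qed

text \<open>
  Dual to the vanishing of \<open>A\<close> on torsion vectors.
\<close>
lemma eta_tau [simp]: assumes V: "X \<in> V" "c \<in> V" "d \<in> V" "Y \<in> V" shows "eta (tau X c d) Y = 0"
proof (rule eq_I)
  fix Z p assume Z: "Z \<in> V"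
  have "g (eta (tau X c d) Y) Z p = - g (T Y Z) (tau X c d) p" using T_inner[of Y Z "tau X c d" p] V Z by simp
  also have "\<dots> = - g (tau X c d) (T Y Z) p" using V Z g_sym[of "T Y Z" "tau X c d" p] by simp
  also have "\<dots> = 0" using V Z A_sym[of X "T Y Z" c] by (simp add: tau_inner)
  finally show "g (eta (tau X c d) Y) Z p = g 0 Z p" using Z by simp
qed (use V in simp_all)

text \<open>
  All operators involved are tensorial at \<open>p\<close>: each of their identities allows one argument
  to be moved into the other slot of \<open>g\<close>, so the value under \<open>G\<close> depends only on the values of the
  arguments under \<open>G\<close>. They therefore descend to \<open>'e\<close>, where the pointwise theorem applies.
\<close>
lemma curvature_null_vanishes:
  fixes G :: "'v \<Rightarrow> 'e::euclidean_space"
  assumes G: "\<And>X Y. X \<in> V \<Longrightarrow> Y \<in> V \<Longrightarrow> g X Y p = G X \<bullet> G Y" and surj: "G ` V = UNIV"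
    and X: "X \<in> V" "\<And>U. U \<in> V \<Longrightarrow> eta X U = 0" and Y: "Y \<in> V" "\<And>U. U \<in> V \<Longrightarrow> eta Y U = 0"
    and Z: "Z \<in> V" "\<And>U. U \<in> V \<Longrightarrow> eta Z U = 0" and ab: "a \<in> V" "b \<in> V"
  shows "g (K X Z Y) (T a b) p = 0"
proof -
  \<comment> \<open>\<open>F\<close> extends a vector at the point to a field.\<close>
  define F where "F = inv_into V G"
  have F: "F x \<in> V" "G (F x) = x" for x
    using inv_into_into[of x G V] f_inv_into_f[of x G V] surj by (auto simp: F_def)
  have Geq: "G X = G Y" if "X \<in> V" "Y \<in> V" "\<And>U. U \<in> V \<Longrightarrow> g X U p = g Y U p" for X Y
  proof -
    have "G X \<bullet> u = G Y \<bullet> u" for u using G[of X "F u"] G[of Y "F u"] that F[of u] by simp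
    then show ?thesis using vector_eq_rdot[of "G X" "G Y"] by blast
  qed
  have Gadd: "G (X + Y) = G X + G Y" if "X \<in> V" "Y \<in> V" for X Y
  proof -
    have "G (X + Y) \<bullet> u = (G X + G Y) \<bullet> u" for u
      using G[of X "F u"] G[of Y "F u"] G[of "X + Y" "F u"] that F[of u] by (simp add: inner_add_left)
    then show ?thesis using vector_eq_rdot[of "G (X + Y)" "G X + G Y"] by blast
  qed
  have Glin: "G (- X) = - G X" "G 0 = 0" if "X \<in> V" for X
    using additive_on[of G] Gadd that by blast+
  have Gdiff: "G (X - Y) = G X - G Y" if "X \<in> V" "Y \<in> V" for X Y
    using additive_on[of G] Gadd that by blast
  have gG: "g X U p = g Y U p" if "X \<in> V" "Y \<in> V" "U \<in> V" "G X = G Y" for X Y U using G that by simp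
  have gG2: "g U X p = g U Y p" if "X \<in> V" "Y \<in> V" "U \<in> V" "G X = G Y" for X Y U using G that by simp
  have eta2: "G (eta X Y) = G (eta X Y')" if "X \<in> V" "Y \<in> V" "Y' \<in> V" "G Y = G Y'" for X Y Y'
  proof (rule Geq)
    fix U assume U: "U \<in> V"
    have "g (eta X U) Y p = g (eta X U) Y' p" by (rule gG2) (use that U in auto)
    then show "g (eta X Y) U p = g (eta X Y') U p"
      using eta_skew[of X Y U p] eta_skew[of X Y' U p] that U by simp
  qed (use that in auto)
  have eta1: "G (eta X Y) = G (eta X' Y)" if "X \<in> V" "X' \<in> V" "Y \<in> V" "G X = G X'" for X X' Y
  proof (rule Geq)
    fix U assume U: "U \<in> V"
    have "g (T Y U) X p = g (T Y U) X' p" by (rule gG2) (use that U in auto)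
    then show "g (eta X Y) U p = g (eta X' Y) U p"
      using T_inner[of Y U X p] T_inner[of Y U X' p] that U by simp
  qed (use that in auto)
  have Geta: "G (eta X Y) = G (eta (F (G X)) (F (G Y)))" if "X \<in> V" "Y \<in> V" for X Y
    using eta1[of X "F (G X)" Y] eta2[of "F (G X)" Y "F (G Y)"] that F by simp
  have K3: "G (K X Y Z) = G (K X Y Z')" if "X \<in> V" "Y \<in> V" "Z \<in> V" "Z' \<in> V" "G Z = G Z'" for X Y Z Z'
  proof (rule Geq)
    fix U assume U: "U \<in> V"
    then show "g (K X Y Z) U p = g (K X Y Z') U p"
      using gG[of Z Z' "K Y X U"] that by (simp add: K_adj)
  qed (use that in auto)
  have K1: "G (K X Y Z) = G (K X' Y Z)" if "X \<in> V" "X' \<in> V" "Y \<in> V" "Z \<in> V" "G X = G X'" for X X' Y Z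
  proof (rule Geq)
    fix U assume U: "U \<in> V"
    have e: "G (eta X Z) = G (eta X' Z)" "G (eta Z X) = G (eta Z X')" by (rule eta1 eta2; use that in auto)+
    have "g (K Z U X) Y p = g (K Z U X') Y p" by (rule gG) (use that U K3[of Z U X X'] in auto)
    moreover have "g (eta X Z) (eta Y U) p = g (eta X' Z) (eta Y U) p"
      "g (eta Z X) (eta U Y) p = g (eta Z X') (eta U Y) p" by (rule gG; use e that U in auto)+
    ultimately show "g (K X Y Z) U p = g (K X' Y Z) U p"
      using K_pair[of X Y Z U p] K_pair[of X' Y Z U p] that U by simp
  qed (use that in auto)
  have K2: "G (K X Y Z) = G (K X Y' Z)" if "X \<in> V" "Y \<in> V" "Y' \<in> V" "Z \<in> V" "G Y = G Y'" for X Y Y' Z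
  proof (rule Geq)
    fix U assume U: "U \<in> V"
    have e: "G (K Y X U) = G (K Y' X U)" by (rule K1) (use that U in auto)
    have "g Z (K Y X U) p = g Z (K Y' X U) p" by (rule gG2) (use e that U in auto)
    then show "g (K X Y Z) U p = g (K X Y' Z) U p" using that U by (simp add: K_adj)
  qed (use that in auto)
  have GK: "G (K X Y Z) = G (K (F (G X)) (F (G Y)) (F (G Z)))" if "X \<in> V" "Y \<in> V" "Z \<in> V" for X Y Z
    using K1[of X "F (G X)" Y Z] K2[of "F (G X)" Y "F (G Y)" Z] K3[of "F (G X)" "F (G Y)" Z "F (G Z)"] that F by simp
  define e where "e x y = G (eta (F x) (F y))" for x y
  define K' where "K' x y z = G (K (F x) (F y) (F z))" for x y z
  define t where "t x y z = G (tau (F x) (F y) (F z))" for x y z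
  have Ge: "G (eta X Y) = e (G X) (G Y)" if "X \<in> V" "Y \<in> V" for X Y using Geta that by (simp add: e_def)
  have GT: "G (T X Y) = e (G X) (G Y) - e (G Y) (G X)" if "X \<in> V" "Y \<in> V" for X Y
    using that by (simp add: T_def Gdiff Ge)
  have GK': "G (K X Y Z) = K' (G X) (G Y) (G Z)" if "X \<in> V" "Y \<in> V" "Z \<in> V" for X Y Z
    using GK that by (simp add: K'_def)
  interpret P: pointwise e K' t
  proof
    fix x y z w a b c d :: 'e
    show "e (x + y) z = e x z + e y z"
      using Ge[of "F x + F y" "F z"] Ge[of "F x" "F z"] Ge[of "F y" "F z"] F Gadd by simp
    show "e x y \<bullet> z = - (e x z \<bullet> y)"
      using eta_skew[of "F x" "F y" "F z" p] F by (simp add: G Ge)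
    show "e x y \<bullet> z + e y z \<bullet> x + e z x \<bullet> y = 0"
      using eta_cyc[of "F x" "F y" "F z" p] F by (simp add: G Ge)
    show "K' x y z \<bullet> w = z \<bullet> K' y x w"
      using K_adj[of "F x" "F y" "F z" "F w" p] F by (simp add: G GK')
    show "K' x y z - K' z y x = 2 *\<^sub>R (e (e z x - e x z) y - e y (e z x - e x z))"
    proof -
      have "K (F x) (F y) (F z) - K (F z) (F y) (F x) = T (T (F z) (F x)) (F y) + T (T (F z) (F x)) (F y)"
        using F by (intro K_bianchi)
      then have "G (K (F x) (F y) (F z) - K (F z) (F y) (F x)) = G (T (T (F z) (F x)) (F y) + T (T (F z) (F x)) (F y))"
        by (simp only:)
      then show ?thesis using F by (simp add: Gdiff Gadd GK' GT scaleR_2)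
    qed
    show "K' x y z \<bullet> w + 2 * (e x z \<bullet> e y w) = K' z w x \<bullet> y + 2 * (e z x \<bullet> e w y)"
      using K_pair[of "F x" "F y" "F z" "F w" p] F by (simp add: G GK' Ge)
    show "e (K' y x z) a \<bullet> b + e z (K' y x a) \<bullet> b + e z a \<bullet> K' y x b
               = e (K' z x y) a \<bullet> b + e y (K' z x a) \<bullet> b + e y a \<bullet> K' z x b"
      using act_sym[of "F x" "F y" "F z" "F a" "F b" p] F by (simp add: act_def G GK' Ge)
    show "e (K' (e c d - e d c) x y) a \<bullet> b + e y (K' (e c d - e d c) x a) \<bullet> b
               + e y a \<bullet> K' (e c d - e d c) x b = 2 * (t x c d \<bullet> t y a b)"
      using act_T[of "F x" "F c" "F d" "F y" "F a" "F b" p] F by (simp add: act_def G GK' Ge GT t_def)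
    show "t x a b \<bullet> y = t y a b \<bullet> x"
      using tau_sym[of "F x" "F y" "F a" "F b" p] F by (simp add: G t_def)
    have "G (tau (F x) (F a) (F b) + tau (F a) (F b) (F x) + tau (F b) (F x) (F a)) = G 0"
      using tau_cyc[of "F x" "F a" "F b"] F by simp
    then show "t x a b + t a b x + t b x a = 0" using F Glin(2)[OF V_zero] by (simp add: Gadd t_def)
    show "e (t x a b) y = 0"
      using Ge[of "tau (F x) (F a) (F b)" "F y"] F Glin(2)[OF V_zero] by (simp add: t_def)
  qed
  have H: "G W \<in> P.H" if "W \<in> V" "\<And>U. U \<in> V \<Longrightarrow> eta W U = 0" for W
  proof -
    have "e (G W) y = 0" for y using Ge[OF that(1), of "F y"] that(2)[of "F y"] F Glin(2)[OF V_zero] by simp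
    then show ?thesis by (simp add: P.H_def)
  qed
  have "G (T a b) \<in> P.V" using P.T_V[of "G a" "G b"] ab by (simp add: GT P.T_def)
  from P.K_HHH_V[OF H[OF X] H[OF Y] H[OF Z] this]
  show ?thesis using X Y Z ab by (simp add: G GK')
qed

section \<open>The nullity and the second Bianchi identity\<close>

definition Null where "Null = {X \<in> V. \<forall>U\<in>V. eta X U = 0}"

lemma Null_V [simp]: "X \<in> Null \<Longrightarrow> X \<in> V" by (simp add: Null_def)
lemma Null_eta [simp]: "X \<in> Null \<Longrightarrow> U \<in> V \<Longrightarrow> eta X U = 0" by (simp add: Null_def del: Null_V)
lemma Null_I: "X \<in> V \<Longrightarrow> (\<And>U. U \<in> V \<Longrightarrow> eta X U = 0) \<Longrightarrow> X \<in> Null" unfolding Null_def by blast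
lemma Null_closed [simp]: "X \<in> Null \<Longrightarrow> Y \<in> Null \<Longrightarrow> X + Y \<in> Null" "X \<in> Null \<Longrightarrow> - X \<in> Null"
  "X \<in> Null \<Longrightarrow> Y \<in> Null \<Longrightarrow> X - Y \<in> Null" "X \<in> Null \<Longrightarrow> J X \<in> Null"
  by (rule Null_I; simp)+
lemma tau_Null [simp]: "X \<in> V \<Longrightarrow> a \<in> V \<Longrightarrow> b \<in> V \<Longrightarrow> tau X a b \<in> Null" by (rule Null_I) simp_all

lemma A_Null: "X \<in> V \<Longrightarrow> W \<in> Null \<Longrightarrow> Z \<in> V \<Longrightarrow> A X W Z = - eta (D X W) Z" by (simp add: A_def)
lemma eta_D_Null: "X \<in> V \<Longrightarrow> W \<in> Null \<Longrightarrow> Z \<in> V \<Longrightarrow> eta (D X W) Z = - A X W Z" by (simp add: A_def)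

lemma T_Null [simp]: assumes "W \<in> Null" "a \<in> V" "b \<in> V" shows "g (T a b) W p = 0" "g W (T a b) p = 0"
  using T_inner[of a b W p] g_sym[of W "T a b" p] assms by simp_all

lemma tau_T [simp]: "a \<in> V \<Longrightarrow> b \<in> V \<Longrightarrow> c \<in> V \<Longrightarrow> d \<in> V \<Longrightarrow> tau (T a b) c d = 0" by (simp add: tau_def)

lemma D_T_Null [simp]: "a \<in> V \<Longrightarrow> b \<in> V \<Longrightarrow> W \<in> Null \<Longrightarrow> D (T a b) W \<in> Null"
  by (rule Null_I) (simp_all add: eta_D_Null)

lemma eta_Null_Null: assumes "X \<in> Null" "Y \<in> Null" "Z \<in> V" shows "g (eta Z X) Y p = 0"
  using eta_cyc[of Z X Y p] assms by simp

lemma Rbar_K: assumes "X \<in> V" "Y \<in> V" "Z \<in> V" shows "Rbar X Y Z + Rbar X Y Z = K X Y Z - K Y X Z"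
proof -
  have "Rbar (J Y) X Z = Rbar (J X) Y Z" using Rbar_anti[of "J Y" X Z] Rbar_J12[of X Y Z] assms by simp
  then show ?thesis using Rbar_anti[of Y X Z] assms by (simp add: K_def)
qed

lemma K_HH_swap: assumes V: "v \<in> V" "w \<in> V" and H: "Y \<in> Null" "Z \<in> Null" shows "g (K v w Y) Z p = g (K v Z Y) w p"
proof -
  have "g (K v w Y) Z p = g (K Y Z v) w p - 2 * g (eta v Y) (eta w Z) p"
    using K_pair[of v w Y Z p] V H by simp
  moreover have "K Y Z v = K v Z Y + (T (T v Y) Z + T (T v Y) Z)"
    using K_bianchi[of Y Z v] V H by (simp add: algebra_simps)
  moreover have "T v Y = eta v Y" using V H by (simp add: T_def)
  moreover have "g (T (eta v Y) Z) w p = g (eta v Y) (eta w Z) p"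
    using T_inner[of "eta v Y" Z w p] eta_skew[of w "eta v Y" Z p] g_sym[of "eta w Z" "eta v Y" p] V H by simp
  ultimately show ?thesis using V H by simp
qed

text \<open>
  The covariant derivative of the curvature of \<open>D\<close>.
\<close>
definition DR where "DR X Y Z W = D X (Rbar Y Z W) - Rbar (D X Y) Z W - Rbar Y (D X Z) W - Rbar Y Z (D X W)"

lemma V_DR [simp]: "X \<in> V \<Longrightarrow> Y \<in> V \<Longrightarrow> Z \<in> V \<Longrightarrow> W \<in> V \<Longrightarrow> DR X Y Z W \<in> V" by (simp add: DR_def)

lemma second_bianchi: assumes V: "X \<in> V" "Y \<in> V" "Z \<in> V" "W \<in> V"
  shows "DR X Y Z W + DR Y Z X W + DR Z X Y W = - (Rbar (T X Y) Z W + Rbar (T Y Z) X W + Rbar (T Z X) Y W)"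
proof -
  have r: "Rbar (br X Y) Z W = Rbar (D X Y) Z W - Rbar (D Y X) Z W - Rbar (T X Y) Z W" if "X \<in> V" "Y \<in> V" "Z \<in> V" for X Y Z
    using that V by (simp add: br_T)
  have j: "D (br (br X Y) Z) W + D (br (br Y Z) X) W + D (br (br Z X) Y) W = 0"
  proof -
    have "br (br X Y) Z + br (br Y Z) X + br (br Z X) Y = - (br X (br Y Z) + br Y (br Z X) + br Z (br X Y))"
      using br_anti[of "br X Y" Z] br_anti[of "br Y Z" X] br_anti[of "br Z X" Y] V by simp
    then have "D (br (br X Y) Z + br (br Y Z) X + br (br Z X) Y) W = 0" using br_jacobi V by simp
    then show ?thesis using V by simp
  qed
  have s: "D X (Rbar Y Z W) - Rbar Y Z (D X W) + (D Y (Rbar Z X W) - Rbar Z X (D Y W)) + (D Z (Rbar X Y W) - Rbar X Y (D Z W))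
     = Rbar (br X Y) Z W + Rbar (br Y Z) X W + Rbar (br Z X) Y W + (D (br (br X Y) Z) W + D (br (br Y Z) X) W + D (br (br Z X) Y) W)"
    using V by (simp add: Rbar_def algebra_simps)
  have an: "Rbar (D Y X) Z W = - Rbar Z (D Y X) W" "Rbar (D Z Y) X W = - Rbar X (D Z Y) W" "Rbar (D X Z) Y W = - Rbar Y (D X Z) W"
    using V by (auto intro!: Rbar_anti)
  show ?thesis using s unfolding j r[OF V(1-3)] r[OF V(2,3,1)] r[OF V(3,1,2)] an DR_def
    by (simp add: algebra_simps)
qed

lemma DA_anti_minus: "X \<in> V \<Longrightarrow> Y \<in> V \<Longrightarrow> Z \<in> V \<Longrightarrow> U \<in> V \<Longrightarrow> DA_anti X (- Y) Z U = - DA_anti X Y Z U"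
  "X \<in> V \<Longrightarrow> Y \<in> V \<Longrightarrow> Z \<in> V \<Longrightarrow> U \<in> V \<Longrightarrow> DA_anti X Y (- Z) U = - DA_anti X Y Z U"
  by (simp_all add: DA_anti_def DA_minus1 DA_minus2 DA_minus3)
lemma DA_anti_add3: "X \<in> V \<Longrightarrow> Y \<in> V \<Longrightarrow> Z \<in> V \<Longrightarrow> Z' \<in> V \<Longrightarrow> U \<in> V \<Longrightarrow> DA_anti X Y (Z + Z') U = DA_anti X Y Z U + DA_anti X Y Z' U"
  by (simp add: DA_anti_def DA_def algebra_simps)

text \<open>
  The second covariant derivative of the torsion.
\<close>
definition Dtau where "Dtau X Y a b = DA X Y a b - DA X Y b a"
lemma V_Dtau [simp]: "X \<in> V \<Longrightarrow> Y \<in> V \<Longrightarrow> a \<in> V \<Longrightarrow> b \<in> V \<Longrightarrow> Dtau X Y a b \<in> V" by (simp add: Dtau_def)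

lemma leibniz_tau: assumes "X \<in> V" "Y \<in> V" "a \<in> V" "b \<in> V"
  shows "D X (tau Y a b) = Dtau X Y a b + tau (D X Y) a b + tau Y (D X a) b + tau Y a (D X b)"
  using assms by (simp add: Dtau_def tau_def leibniz_A algebra_simps)

lemma Dtau_inner: assumes V: "X \<in> V" "Z \<in> V" "a \<in> V" "b \<in> V" "Y \<in> V" shows "g (Dtau X Z a b) Y p = - g (DA X Y Z a) b p"
  using DA_cyc[OF V, of p] DA_skew[OF V(1,2,4,3,5), of p] DA_sym[OF V(1,5,2,3)] DA_skew[OF V(1,2,5,3,4), of p] V by (simp add: Dtau_def)

end

text \<open>
  The identity \<open>K_null\<close> is the conclusion of the pointwise argument; it is isolated as an assumption because its
  derivation needs frames, whereas all that follows is again formal.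
\<close>
locale hermitian_ak2_null = hermitian_ak2 +
  assumes K_null: "X \<in> Null \<Longrightarrow> Y \<in> Null \<Longrightarrow> Z \<in> Null \<Longrightarrow> a \<in> V \<Longrightarrow> b \<in> V \<Longrightarrow> g (K X Z Y) (T a b) p = 0"
begin

lemma K_T_Null: assumes H: "X \<in> Null" "Y \<in> Null" "Z \<in> Null" and ab: "a \<in> V" "b \<in> V"
  shows "g (K (T a b) X Y) Z p = 0" "g (K X (T a b) Y) Z p = 0"
proof -
  have 1: "g (K (T a b) Y Z) X p = 0" if "X \<in> Null" "Y \<in> Null" "Z \<in> Null" for X Y Z
    using K_null[OF that ab, of p] K_pair[of X Z Y "T a b" p] K_adj[of Y "T a b" X Z p]
      g_sym[of X "K (T a b) Y Z" p] that ab by simp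
  show "g (K (T a b) X Y) Z p = 0" using 1 H by simp
  show "g (K X (T a b) Y) Z p = 0" using 1[OF H(2,1,3)] H ab g_sym[of Y "K (T a b) X Z" p] by (simp add: K_adj)
qed

lemma Rbar_T_Null: assumes H: "X \<in> Null" "Y \<in> Null" "Z \<in> Null" and ab: "a \<in> V" "b \<in> V"
  shows "g (Rbar (T a b) X Y) Z p = 0" "g (Rbar X (T a b) Y) Z p = 0"
proof -
  have "g (Rbar (T a b) X Y + Rbar (T a b) X Y) Z p = g (K (T a b) X Y - K X (T a b) Y) Z p"
    using Rbar_K[of "T a b" X Y] H ab by simp
  then show "g (Rbar (T a b) X Y) Z p = 0" using K_T_Null[OF H ab] H ab by simp
  then show "g (Rbar X (T a b) Y) Z p = 0" using Rbar_anti[of X "T a b" Y] H ab by simp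
qed

text \<open>
  In the second Bianchi identity the two terms that differentiate along a torsion vector vanish,
  because \<open>D (T a b)\<close> preserves the nullity and \<open>K_null\<close> applies. The remaining term is invariant under
  \<open>a, c \<mapsto> J a, J c\<close>, while the curvature terms on the right hand side change sign.
\<close>
lemma DR_Null: assumes H: "X \<in> Null" "Y \<in> Null" "Z \<in> Null" and V: "a \<in> V" "b \<in> V" "c \<in> V" "d \<in> V"
  shows "g (DR X (T a b) (T c d) Y) Z p = 0"
proof -
  have 1: "g (DR (T a b) (T c d) X Y) Z p = 0" "g (DR (T a b) X (T c d) Y) Z p = 0"
    if V: "a \<in> V" "b \<in> V" "c \<in> V" "d \<in> V" for a b c d
  proof -
    have e: "D (T a b) (T c d) = T (D (T a b) c) d + T c (D (T a b) d)" using V by (simp add: leibniz_T)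
    have "g (D (T a b) (Rbar (T c d) X Y)) Z p + g (Rbar (T c d) X Y) (D (T a b) Z) p = 0"
      by (rule D_sum1) (use V H Rbar_T_Null in auto)
    then show "g (DR (T a b) (T c d) X Y) Z p = 0" using V H by (simp add: DR_def e Rbar_T_Null)
    have "g (D (T a b) (Rbar X (T c d) Y)) Z p + g (Rbar X (T c d) Y) (D (T a b) Z) p = 0"
      by (rule D_sum1) (use V H Rbar_T_Null in auto)
    then show "g (DR (T a b) X (T c d) Y) Z p = 0" using V H by (simp add: DR_def e Rbar_T_Null)
  qed
  have 2: "g (DR X (T a b) (T c d) Y) Z p
     = - g (Rbar (T X (T a b)) (T c d) Y + Rbar (T (T a b) (T c d)) X Y + Rbar (T (T c d) X) (T a b) Y) Z p"
    if V: "a \<in> V" "b \<in> V" "c \<in> V" "d \<in> V" for a b c d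
  proof -
    have "g (DR X (T a b) (T c d) Y + DR (T a b) (T c d) X Y + DR (T c d) X (T a b) Y) Z p
      = g (- (Rbar (T X (T a b)) (T c d) Y + Rbar (T (T a b) (T c d)) X Y + Rbar (T (T c d) X) (T a b) Y)) Z p"
      using second_bianchi[of X "T a b" "T c d" Y] V H by simp
    then show ?thesis using 1(1)[OF V] 1(2)[OF V(3,4,1,2)] V H by simp
  qed
  have "DR X (T (J a) b) (T (J c) d) Y = DR X (T a b) (T c d) Y"
    using V H by (simp add: DR_def Rbar_JJ)
  moreover have "Rbar (T X (T (J a) b)) (T (J c) d) Y + Rbar (T (T (J a) b) (T (J c) d)) X Y + Rbar (T (T (J c) d) X) (T (J a) b) Y
    = - (Rbar (T X (T a b)) (T c d) Y + Rbar (T (T a b) (T c d)) X Y + Rbar (T (T c d) X) (T a b) Y)"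
    using V H by (simp add: Rbar_JJ)
  ultimately have "g (DR X (T a b) (T c d) Y) Z p
     = - g (- (Rbar (T X (T a b)) (T c d) Y + Rbar (T (T a b) (T c d)) X Y + Rbar (T (T c d) X) (T a b) Y)) Z p"
    using 2[of "J a" b "J c" d] V by (simp del: T_J)
  then show ?thesis using 2[OF V] V H by simp
qed

text \<open>
  Both sides are in the nullity and have the same inner products with it: the curvature with two torsion vectors is an
  inner product of values of \<open>tau\<close> by \<open>act_T\<close>.
\<close>
lemma K_TT_Null: assumes Z: "Z \<in> Null" and V: "a \<in> V" "b \<in> V" "c \<in> V" "d \<in> V"
  shows "K (T c d) (T a b) Z = - (tau (tau Z a b) c d + tau (tau Z a b) c d)"
proof -
  define e where "e = K (T c d) (T a b) Z + (tau (tau Z a b) c d + tau (tau Z a b) c d)"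
  have "K (T c d) (T a b) Z \<in> Null"
  proof (rule Null_I)
    fix U assume U: "U \<in> V"
    show "eta (K (T c d) (T a b) Z) U = 0"
    proof (rule eq_I)
      fix W p assume W: "W \<in> V"
      show "g (eta (K (T c d) (T a b) Z) U) W p = g 0 W p"
        using act_T[of "T a b" c d Z U W p] V Z U W by (simp add: act_def)
    qed (use V Z U in auto)
  qed (use V Z in auto)
  then have eH: "e \<in> Null" using V Z by (simp add: e_def)
  have "g e Y p = 0" if Y: "Y \<in> Null" for Y p
  proof -
    have "g (K (T c d) (T a b) Z) Y p = g Z (K (T a b) (T c d) Y) p" using V Z Y by (simp add: K_adj)
    also have "\<dots> = g (K (T a b) (T c d) Y) Z p" using V Z Y by (intro g_sym) auto
    also have "\<dots> = g (K (T a b) Z Y) (T c d) p" using V Z Y by (intro K_HH_swap) auto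
    also have "\<dots> = - act (T a b) Z Y c d p"
      using V Z Y T_inner[of c d "K (T a b) Z Y" p] g_sym[of "T c d" "K (T a b) Z Y" p] by (simp add: act_def)
    also have "\<dots> = - (2 * g (tau Y c d) (tau Z a b) p)"
      using V Z Y act_T[of Z a b Y c d p] g_sym[of "tau Y c d" "tau Z a b" p] by simp
    also have "g (tau Y c d) (tau Z a b) p = g (tau (tau Z a b) c d) Y p" using V Z Y by (intro tau_sym) auto
    finally show ?thesis using V Z Y by (simp add: e_def)
  qed
  then have "e = 0" using eH g_def[of e] by simp
  then show ?thesis unfolding e_def by (rule eq_neg_iff_add_eq_0[THEN iffD2])
qed

lemma DA_lin_Null: assumes "X \<in> Null" "U \<in> Null" "W \<in> Null" "a \<in> V" shows "DA_lin X U W a = 0"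
proof (rule eq_I)
  fix b p assume b: "b \<in> V"
  show "g (DA_lin X U W a) b p = g 0 b p"
    using act_DA_lin[of X U W a b p] K_null[of U W X a b p] T_inner[of a b "K U X W" p] g_sym[of "T a b" "K U X W" p] assms b
    by (simp add: act_def)
qed (use assms in auto)

text \<open>
  Differentiate \<open>K_TT_Null\<close> along \<open>X\<close> and pair with \<open>Y\<close>. The derivatives of the curvature vanish by
  \<open>DR_Null\<close>, and the terms with derivatives of the arguments cancel.
\<close>
lemma DA_tau_swap: assumes H: "X \<in> Null" "Y \<in> Null" "Z \<in> Null" and V: "a \<in> V" "b \<in> V" "c \<in> V" "d \<in> V"
  shows "g (DA X Y (tau Z a b) c) d p + g (DA X (tau Y c d) Z a) b p = 0"
proof -
  let ?v = "T a b" and ?w = "T c d"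
  have DKeq: "D X (K ?w ?v Z) = DR X ?w ?v Z - J (DR X (J ?w) ?v Z) + K (D X ?w) ?v Z + K ?w (D X ?v) Z + K ?w ?v (D X Z)"
    using H V by (simp add: K_def DR_def algebra_simps)
  have Jw: "J ?w = T (- J c) d" using V by simp
  have 1: "g (DR X ?w ?v Z) Y p = 0" using DR_Null H V by auto
  have 2: "g (DR X (J ?w) ?v Z) (J Y) p = 0" unfolding Jw using DR_Null[of X Z "J Y" "- J c" d a b] H V by auto
  have 3: "K (D X ?w) ?v Z = K (tau X c d) ?v Z - (tau (tau Z a b) (D X c) d + tau (tau Z a b) (D X c) d)
     - (tau (tau Z a b) c (D X d) + tau (tau Z a b) c (D X d))"
    using H V by (simp add: leibniz_T K_TT_Null algebra_simps)
  have 4: "K ?w (D X ?v) Z = K ?w (tau X a b) Z - (tau (tau Z (D X a) b) c d + tau (tau Z (D X a) b) c d)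
     - (tau (tau Z a (D X b)) c d + tau (tau Z a (D X b)) c d)"
    using H V by (simp add: leibniz_T K_TT_Null algebra_simps)
  have 5: "g (K (tau X c d) ?v Z) Y p = 0" "g (K ?w (tau X a b) Z) Y p = 0" using K_T_Null H V by auto
  have 6: "g (K ?w ?v (D X Z)) Y p = - 2 * g (tau (tau (D X Z) a b) c d) Y p"
  proof -
    have "g (K ?w ?v (D X Z)) Y p = g (D X Z) (K ?v ?w Y) p" using H V by (simp add: K_adj)
    also have "\<dots> = - 2 * g (D X Z) (tau (tau Y c d) a b) p" using H V by (simp add: K_TT_Null)
    also have "g (D X Z) (tau (tau Y c d) a b) p = g (tau (tau Y c d) a b) (D X Z) p" using H V by (intro g_sym) auto
    also have "\<dots> = g (tau (D X Z) a b) (tau Y c d) p" using H V by (intro tau_sym) auto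
    also have "\<dots> = g (tau Y c d) (tau (D X Z) a b) p" using H V by (intro g_sym) auto
    also have "\<dots> = g (tau (tau (D X Z) a b) c d) Y p" using H V by (intro tau_sym) auto
    finally show ?thesis .
  qed
  have 7: "D X (tau (tau Z a b) c d) = Dtau X (tau Z a b) c d
     + (tau (Dtau X Z a b) c d + tau (tau (D X Z) a b) c d + tau (tau Z (D X a) b) c d + tau (tau Z a (D X b)) c d)
     + tau (tau Z a b) (D X c) d + tau (tau Z a b) c (D X d)"
    using H V by (simp add: leibniz_tau)
  have 8: "D X (K ?w ?v Z) = - (D X (tau (tau Z a b) c d) + D X (tau (tau Z a b) c d))"
    using K_TT_Null[OF H(3) V] H V by simp
  have "g (DR X ?w ?v Z - J (DR X (J ?w) ?v Z) + K (D X ?w) ?v Z + K ?w (D X ?v) Z + K ?w ?v (D X Z)) Y p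
    = g (- (D X (tau (tau Z a b) c d) + D X (tau (tau Z a b) c d))) Y p"
    unfolding DKeq[symmetric] 8 ..
  then have "g (DR X ?w ?v Z) Y p + g (DR X (J ?w) ?v Z) (J Y) p + g (K (tau X c d) ?v Z) Y p
      + g (K ?w (tau X a b) Z) Y p + g (K ?w ?v (D X Z)) Y p
      - 2 * g (tau (tau Z a b) (D X c) d) Y p - 2 * g (tau (tau Z a b) c (D X d)) Y p
      - 2 * g (tau (tau Z (D X a) b) c d) Y p - 2 * g (tau (tau Z a (D X b)) c d) Y p
    = - 2 * (g (Dtau X (tau Z a b) c d) Y p + g (tau (Dtau X Z a b) c d) Y p + g (tau (tau (D X Z) a b) c d) Y p
      + g (tau (tau Z (D X a) b) c d) Y p + g (tau (tau Z a (D X b)) c d) Y p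
      + g (tau (tau Z a b) (D X c) d) Y p + g (tau (tau Z a b) c (D X d)) Y p)"
    unfolding 3 4 7 using H V by (simp del: T_J add: g_J_left)
  then have "g (Dtau X (tau Z a b) c d) Y p + g (tau (Dtau X Z a b) c d) Y p = 0"
    unfolding 1 2 5 6 by simp
  moreover have "g (tau (Dtau X Z a b) c d) Y p = g (tau Y c d) (Dtau X Z a b) p" using H V by (intro tau_sym) auto
  moreover have "\<dots> = g (Dtau X Z a b) (tau Y c d) p" using H V by (intro g_sym) auto
  ultimately show ?thesis using H V by (simp add: Dtau_inner)
qed

text \<open>
  On the nullity only \<open>DA_anti\<close> contributes to the previous relation. Replacing \<open>X\<close>, \<open>Y\<close> by
  \<open>J X\<close>, \<open>J Y\<close> changes the sign of the first of its two terms only.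
\<close>
lemma DA_anti_tau: assumes H: "X \<in> Null" "Y \<in> Null" "Z \<in> Null" and V: "a \<in> V" "b \<in> V" "c \<in> V"
  shows "DA_anti X Y (tau Z a b) c = 0"
proof (rule eq_I)
  fix d p assume d: "d \<in> V"
  have s: "g (DA_anti X Y (tau Z a b) c) d p + g (DA_anti X (tau Y c d) Z a) b p = 0" if H: "X \<in> Null" "Y \<in> Null" for X Y
  proof -
    have r: "2 * g (DA X U W e) f p = g (DA_anti X U W e) f p"
      if "U \<in> Null" "W \<in> Null" "e \<in> V" "f \<in> V" for U W e f
    proof -
      have "g (DA X U W e + DA X U W e) f p = g (DA_anti X U W e + DA_lin X U W e) f p" by (simp only: DA_split)
      then show ?thesis using that H by (simp add: DA_lin_Null)
    qed
    show ?thesis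
      using DA_tau_swap[OF H assms(3) V d, of p] r[of Y "tau Z a b" c d] r[of "tau Y c d" Z a b] H assms(3) V d by simp
  qed
  have "g (DA_anti (J X) (J Y) (tau Z a b) c) d p + g (DA_anti (J X) (tau (J Y) c d) Z a) b p = 0" using s H by simp
  then have "- g (DA_anti X Y (tau Z a b) c) d p + g (DA_anti X (tau Y c d) Z a) b p = 0"
    using H V d DA_anti_J[of X Y "tau Z a b" c] DA_anti_J[of X "tau Y c d" Z a] by (simp add: DA_anti_J DA_anti_minus)
  then show "g (DA_anti X Y (tau Z a b) c) d p = g 0 d p" using s[OF H(1,2)] d by simp
qed (use H V in auto)

text \<open>
  The form \<open>U \<mapsto> g (DA_anti Y U (tau Z c d) a) b\<close> is represented by a field \<open>om\<close>, which
  turns out to lie in the nullity; there the form is already known to vanish, so \<open>g om om = 0\<close>.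
\<close>
lemma DA_anti_tau_all: assumes H: "Y \<in> Null" "Z \<in> Null" and V: "c \<in> V" "d \<in> V" "U \<in> V" "a \<in> V"
  shows "DA_anti Y U (tau Z c d) a = 0"
proof (rule eq_I)
  fix b p assume b: "b \<in> V"
  let ?W = "tau Z c d"
  define om where "om = Dtau Y ?W a b - Dtau (J Y) (J ?W) a b"
  have e: "eta (Dtau Y W a b) u = - A Y (tau W a b) u" if "Y \<in> Null" "W \<in> Null" "u \<in> V" for Y W u
  proof -
    have "Dtau Y W a b = D Y (tau W a b) - tau (D Y W) a b - tau W (D Y a) b - tau W a (D Y b)"
      using that V b by (simp add: leibniz_tau)
    then show ?thesis using that V b by (simp add: eta_D_Null)
  qed
  have om: "om \<in> V" using H V b by (simp add: om_def)
  have omH: "om \<in> Null"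
  proof (rule Null_I[OF om])
    fix u assume u: "u \<in> V"
    have "eta (Dtau (J Y) (J ?W) a b) u = - A (J Y) (tau (J ?W) a b) u" using e[of "J Y" "J ?W" u] H V u by simp
    also have "\<dots> = - A Y (tau ?W a b) u" using H V b u by simp
    finally show "eta om u = 0" using e[of Y ?W u] H V b u by (simp add: om_def)
  qed
  have g: "g om u q = - g (DA_anti Y u ?W a) b q" if u: "u \<in> V" for u q
  proof -
    have "DA (J Y) u (J ?W) a = DA (J Y) (J u) ?W a" using H V u by simp
    then show ?thesis using H V b u by (simp add: om_def Dtau_inner DA_anti_def)
  qed
  have "g om om q = 0" for q using g[OF om, of q] DA_anti_tau[OF H(1) omH H(2) V(1,2,4)] b by simp
  then have "om = 0" using om g_def by blast
  then show "g (DA_anti Y U ?W a) b p = g 0 b p" using g[OF V(3), of p] V b by simp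
qed (use H V in auto)

text \<open>
  Contains all \<open>tau Z a b\<close> with \<open>Z\<close> in the nullity; the final argument starts on this set and
  climbs up to \<open>V\<close>.
\<close>
definition Core where "Core = {W \<in> Null. \<forall>Y\<in>Null. \<forall>U\<in>V. \<forall>a\<in>V. DA_anti Y U W a = 0}"

lemma tau_Core: "Z \<in> Null \<Longrightarrow> a \<in> V \<Longrightarrow> b \<in> V \<Longrightarrow> tau Z a b \<in> Core"
  by (simp add: Core_def DA_anti_tau_all)
lemma Core_Null: "W \<in> Core \<Longrightarrow> W \<in> Null" by (simp add: Core_def)
lemma Core_m: "W \<in> Core \<Longrightarrow> Y \<in> Null \<Longrightarrow> U \<in> V \<Longrightarrow> a \<in> V \<Longrightarrow> DA_anti Y U W a = 0" by (simp add: Core_def)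
lemma Core_closed: "X \<in> Core \<Longrightarrow> Y \<in> Core \<Longrightarrow> X + Y \<in> Core" "X \<in> Core \<Longrightarrow> - X \<in> Core"
  by (auto simp: Core_def DA_anti_add3 DA_anti_minus)

section \<open>Vanishing of the derivative of the torsion\<close>

lemma DA_Core_zero: assumes "X \<in> Core" "Y \<in> Null" "a \<in> V" shows "DA Y X X a = 0"
proof -
  have X: "X \<in> Null" using assms Core_Null by simp
  have "DA Y X X a + DA Y X X a = 0" unfolding DA_split using Core_m[OF assms(1,2)] DA_lin_Null[OF assms(2) X X] X assms(3) by simp
  then show ?thesis by (rule double_0[rotated]) (use X assms in simp)
qed

lemma DA_Core_n: assumes "X \<in> Core" "Y \<in> Null" "U \<in> V" "a \<in> V" shows "DA Y U X a + DA Y U X a = DA_lin Y U X a"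
  unfolding DA_split using Core_m[OF assms] by simp

text \<open>
  The Ricci identity for \<open>A\<close> at \<open>(X, J X)\<close>. Since \<open>DA Y X X = 0\<close> for \<open>Y\<close> in the nullity,
  the derivatives of \<open>A X X\<close> involve only \<open>DA\<close> in directions \<open>D Y X\<close>, and there \<open>DA\<close> is its linear
  part.
\<close>
lemma ricci_A: assumes X: "X \<in> Core" and a: "a \<in> V"
  shows "Rbar X (J X) (A X X a) - (A (Rbar X (J X) X) X a + A (Rbar X (J X) X) X a) - A X X (Rbar X (J X) a)
    = DA_lin X (D (J X) X) X a - DA_lin (J X) (D X X) X a"
proof -
  have XH: "X \<in> Null" "X \<in> V" using X Core_Null by auto
  have 1: "D Y (A X X b) = A (D Y X) X b + A (D Y X) X b + A X X (D Y b)" if "Y \<in> Null" "b \<in> V" for Y b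
    using leibniz_A[of Y X X b] DA_Core_zero[OF X that] A_sym[of X "D Y X" b] XH that by simp
  let ?Y = "J X"
  have Y: "?Y \<in> Null" using XH by simp
  have br: "br X ?Y \<in> Null"
  proof (rule Null_I)
    fix U assume "U \<in> V"
    then show "eta (br X ?Y) U = 0" using XH Y A_sym[of X ?Y U] by (simp add: br_T T_def eta_D_Null del: D_J)
  qed (use XH in simp)
  have T0: "T X ?Y = 0" using XH Y by (simp add: T_def)
  have D2: "D Y (A (D Z X) X a) = DA Y (D Z X) X a + A (D Y (D Z X)) X a + A (D Z X) (D Y X) a + A (D Z X) X (D Y a)"
    if "Y \<in> V" "Z \<in> V" for Y Z using that XH a by (simp add: leibniz_A)
  have s: "A (D ?Y X) (D X X) a = A (D X X) (D ?Y X) a" using XH a by (intro A_sym) auto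
  have "Rbar X ?Y (A X X a) - (A (Rbar X ?Y X) X a + A (Rbar X ?Y X) X a) - A X X (Rbar X ?Y a)
     = (DA X (D ?Y X) X a + DA X (D ?Y X) X a) - (DA ?Y (D X X) X a + DA ?Y (D X X) X a)"
    unfolding Rbar_def using 1[OF XH(1) a] 1[OF Y a] 1[OF br a] 1[OF XH(1), of "D ?Y a"] 1[OF Y, of "D X a"] XH a
    by (simp add: D2 s algebra_simps del: D_J A_J1 A_J2 A_J3)
  then show ?thesis using DA_Core_n[OF X XH(1) _ a, of "D ?Y X"] DA_Core_n[OF X Y _ a, of "D X X"] XH by simp
qed

text \<open>
  Let \<open>be = D X X\<close> and \<open>S a = eta a X\<close>, a symmetric operator. Then \<open>A X X = - eta be\<close>, and by
  \<open>K_null\<close> the right hand side of the Ricci identity for \<open>A\<close> becomes a multiple of \<open>eta (K be X X)\<close>.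
  Writing the action of \<open>K X X\<close> on \<open>eta\<close> in two ways, the curvature terms
  cancel on vectors \<open>w\<close> with \<open>A w X X = 0\<close> and leave \<open>S\<^sup>3 be\<close>. The vector \<open>S\<^sup>3 be\<close>
  itself is of this kind, so \<open>S\<^sup>3 be = 0\<close> and \<open>S be = 0\<close> by symmetry of \<open>S\<close>.
\<close>
lemma A_Core_cubic: assumes X: "X \<in> Core" shows "A X X X = 0"
proof -
  have XH: "X \<in> Null" "X \<in> V" using X Core_Null by auto
  define be where "be = D X X"
  have be: "be \<in> V" using XH by (simp add: be_def)
  have AX: "A X X Z = - eta be Z" if "Z \<in> V" for Z using A_Null[OF XH(2,1) that] by (simp add: be_def)
  let ?R = "K X X"
  have RbarR: "Rbar X (J X) a = - J (?R a)" if "a \<in> V" for a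
  proof -
    have "Rbar X X a + Rbar X X a = 0" using Rbar_anti[of X X a] XH that by (metis add.right_inverse)
    then have "Rbar X X a = 0" by (rule double_0[rotated]) (use XH that in simp)
    then show ?thesis using Rbar_anti[of "J X" X a] XH that by (simp add: K_def)
  qed
  have ric: "g (A X X a) (?R b) p + 2 * g (A (?R X) X a) b p + g (A X X (?R a)) b p = 2 * g (eta (K be X X) a) b p"
    if a: "a \<in> V" and b: "b \<in> V" for a b p
  proof -
    \<comment> \<open>The Ricci identity is applied to \<open>- J a\<close> to absorb the \<open>J\<close> in \<open>Rbar X (J X) = - J (K X X)\<close>.\<close>
    define a' where "a' = - J a"
    have a': "a' \<in> V" "J a' = a" using a by (simp_all add: a'_def)
    have R2: "g (DA_lin X (D (J X) X) X a') b p = g (eta (J (K be X X)) a') b p"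
    proof -
      define h where "h = D (J X) X - J be"
      have hV: "h \<in> V" using XH be by (simp add: h_def)
      have h: "h \<in> Null"
        by (rule Null_I[OF hV]) (use XH be AX in \<open>simp add: h_def eta_D_Null\<close>)
      have "g (DA_lin X (D (J X) X) X a') b p = g (eta (K (D (J X) X) X X) a') b p"
        using act_DA_lin[of X "D (J X) X" X a' b p] XH a' b by (simp add: act_def)
      moreover have "D (J X) X = h + J be" by (simp add: h_def)
      moreover have "g (eta (K h X X) a') b p = 0"
        using K_null[OF h XH(1) XH(1) a'(1) b, of p] T_inner[of a' b "K h X X" p] g_sym[of "T a' b" "K h X X" p] XH hV a' b by simp
      ultimately show ?thesis using XH be a' b hV by (simp del: eta_J1)
    qed
    have R3: "g (DA_lin (J X) be X a') b p = - g (eta (J (K be X X)) a') b p"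
      using act_DA_lin[of "J X" be X a' b p] XH be a' b by (simp add: act_def)
    have "g (Rbar X (J X) (A X X a') - (A (Rbar X (J X) X) X a' + A (Rbar X (J X) X) X a') - A X X (Rbar X (J X) a')) b p
      = g (DA_lin X (D (J X) X) X a' - DA_lin (J X) be X a') b p"
      using ricci_A[OF X a'(1)] by (simp add: be_def)
    then have "- g (A X X a') (Rbar X (J X) b) p - 2 * g (A (Rbar X (J X) X) X a') b p - g (A X X (Rbar X (J X) a')) b p
       = 2 * g (eta (J (K be X X)) a') b p"
      using XH be a' b Rbar_skew[of X "J X" "A X X a'" b p] R2 R3 by (simp del: eta_J1)
    moreover have "g (A X X a') (J (?R b)) p = g (A X X a) (?R b) p"
      using XH a' b a g_J_left[of "A X X a'" "?R b" p] A_J3[of X X a'] by simp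
    moreover have "A (Rbar X (J X) X) X a' = - A (?R X) X a" using XH a' A_J3[of "?R X" X a'] by (simp add: RbarR)
    moreover have "A X X (Rbar X (J X) a') = - A X X (?R a)" using XH a' K_J(3)[of X X a'] by (simp add: RbarR)
    moreover have "eta (J (K be X X)) a' = eta (K be X X) a" using XH be a' eta_J2[of "K be X X" a'] by simp
    ultimately show ?thesis using XH a' b a by (simp add: RbarR)
  qed
  define L where "L u w p = g (eta (K u X X) X) w p" for u w p
  have ract: "g (eta (?R u) X) w p + g (eta u (?R X)) w p + g (eta u X) (?R w) p = L u w p" if "u \<in> V" "w \<in> V" for u w p
    using act_sym[of X X u X w p] that XH by (simp add: act_def L_def)
  define S where "S a = eta a X" for a
  have SV [simp]: "S a \<in> V" if "a \<in> V" for a using that XH by (simp add: S_def)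
  have S_sym: "g (S a) b p = g (S b) a p" if "a \<in> V" "b \<in> V" for a b p
    using eta_cyc[of a X b p] eta_skew[of b X a p] that XH by (simp add: S_def)
  have S_H: "g (S a) h p = 0" if "a \<in> V" "h \<in> Null" for a h p
    using eta_Null_Null[OF XH(1) that(2,1)] by (simp add: S_def)
  have RS: "g (eta (?R u) X) w p = L u w p + 2 * g (S (S (S u))) w p" if u: "u \<in> V" and w: "w \<in> V" for u w p
  proof -
    have "T u X = S u" using u XH by (simp add: T_def S_def)
    moreover have "T (S u) X = S (S u)" using u XH by (simp add: T_def S_def)
    ultimately have "?R u = K u X X + (S (S u) + S (S u))"
      using K_bianchi[of X X u] u XH by (simp add: algebra_simps)
    then show ?thesis using u w XH by (simp add: L_def S_def)
  qed
  have L_sym: "L u w p = L w u p" if u: "u \<in> V" and w: "w \<in> V" for u w p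
  proof -
    have "g (eta u (?R X)) w p = g (eta w (?R X)) u p"
    proof -
      have "g (eta (?R X) w) u p = 0"
        using K_null[OF XH(1) XH(1) XH(1) w u, of p] T_inner[of w u "?R X" p] g_sym[of "T w u" "?R X" p] XH u w by simp
      then show ?thesis using eta_cyc[of u "?R X" w p] eta_skew[of w "?R X" u p] XH u w by simp
    qed
    moreover have "g (eta (?R u) X) w p = g (eta w X) (?R u) p" "g (eta (?R w) X) u p = g (eta u X) (?R w) p"
      using S_sym[of "?R u" w p] S_sym[of "?R w" u p] u w XH by (simp_all add: S_def)
    ultimately show ?thesis using ract[OF u w, of p] ract[OF w u, of p] by simp
  qed
  have S3: "g (S (S (S be))) w p = 0" if w: "w \<in> V" and w0: "\<And>Y p. Y \<in> V \<Longrightarrow> g (A w X X) Y p = 0" for w p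
  proof -
    have RX: "?R X \<in> V" using XH by simp
    have "g (A X (?R X) X) w p = g (A X X (?R X)) w p"
    proof -
      have "g (A X w (?R X)) X p = - g (A w X X) (?R X) p"
        using A_sym[of X w "?R X"] A_skew[of w X "?R X" X p] XH w by simp
      then have "g (A X w (?R X)) X p = 0" using w0[OF RX] by simp
      then show ?thesis using A_cyc[of X "?R X" X w p] A_skew[of X X w "?R X" p] XH w by simp
    qed
    moreover have "A (?R X) X X = A X (?R X) X" using XH by (intro A_sym) auto
    ultimately have 1: "g (A X X X) (?R w) p + 3 * g (A X X (?R X)) w p = 2 * L be w p"
      using ric[OF XH(2) w, of p] by (simp add: L_def)
    have 2: "L be w p + 2 * g (S (S (S be))) w p - g (A X X (?R X)) w p - g (A X X X) (?R w) p = L be w p"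
      using ract[OF be w, of p] RS[OF be w, of p] AX[OF RX] AX[OF XH(2)] XH be w by simp
    have "g (A X X X) (?R w) p = - g (S be) (?R w) p" using AX[OF XH(2)] XH be w by (simp add: S_def)
    also have "g (S be) (?R w) p = g (eta (?R w) X) be p" using S_sym[of be "?R w" p] be w XH by (simp add: S_def)
    also have "\<dots> = L be w p + 2 * g (S (S (S w))) be p" using RS[OF w be] L_sym[OF w be] by simp
    also have "g (S (S (S w))) be p = g (S (S (S be))) w p"
    proof -
      have "g (S (S (S w))) be p = g (S be) (S (S w)) p" using S_sym[of "S (S w)" be] w be by simp
      also have "\<dots> = g (S (S w)) (S be) p" using w be by (intro g_sym) auto
      also have "\<dots> = g (S (S be)) (S w) p" using S_sym[of "S w" "S be"] w be by simp
      also have "\<dots> = g (S w) (S (S be)) p" using w be by (intro g_sym) auto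
      also have "\<dots> = g (S (S (S be))) w p" using S_sym[of w "S (S be)"] w be by simp
      finally show ?thesis .
    qed
    finally show ?thesis using 1 2 by linarith
  qed
  have 3: "S (S (S be)) = 0"
  proof -
    define w where "w = S (S (S be))"
    have w: "w \<in> V" using be by (simp add: w_def)
    have "g (A w X X) Y p = 0" if "Y \<in> V" for Y p
    proof -
      have "g (A w X X) Y p = - g (tau X X Y) w p" using A_sym[of w X X] tau_inner[of X X Y w p] XH w that by simp
      also have "\<dots> = - g w (tau X X Y) p" using g_sym[of w "tau X X Y" p] XH w that by simp
      also have "\<dots> = 0" using S_H[of "S (S be)" "tau X X Y" p] XH be that by (simp add: w_def)
      finally show ?thesis .
    qed
    then have "g w w p = 0" for p using S3[OF w, of p] by (simp add: w_def)
    then show ?thesis using g_def[OF w] by (simp add: w_def)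
  qed
  have S0: "S u = 0" if "S (S u) = 0" "u \<in> V" for u
  proof -
    have "g (S u) (S u) p = 0" for p using S_sym[of u "S u" p] that by simp
    then show ?thesis using g_def[of "S u"] that by simp
  qed
  have "S be = 0" using S0[of be] S0[of "S be"] 3 be by simp
  then show ?thesis using AX[OF XH(2)] by (simp add: S_def)
qed

lemma A_Null_sym: assumes H: "X \<in> Null" "Y \<in> Null" "Z \<in> Null" shows "A X Y Z = A X Z Y"
proof (rule eq_I)
  fix w p assume w: "w \<in> V"
  have "A X w Y = A w X Y" using H w by (intro A_sym) auto
  moreover have "g (A w X Y) Z p = 0" using A_Null[of w X Y] eta_Null_Null[OF H(2,3), of "D w X" p] H w by simp
  ultimately show "g (A X Y Z) w p = g (A X Z Y) w p" using A_cyc[of X Y Z w p] A_skew[of X Z w Y p] H w by simp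
qed (use H in auto)

text \<open>
  Polarisation of the cubic form.
\<close>
lemma A_Core: assumes X: "X \<in> Core" "Y \<in> Core" "Z \<in> Core" shows "A X Y Z = 0"
proof -
  have s: "A Y X X = A X X Y" "A X Y X = A X X Y" "A Y X Y = A X Y Y" "A Y Y X = A X Y Y" "A Y X Z = A X Y Z" "A X Z Y = A X Y Z"
    if "X \<in> Core" "Y \<in> Core" "Z \<in> Core" for X Y Z
    using that[THEN Core_Null] A_sym[of Y X X] A_sym[of Y X Y] A_sym[of Y X Z]
      A_Null_sym[of X Y X] A_Null_sym[of Y Y X] A_Null_sym[of X Z Y] by auto
  have 1: "A X Y Y = 0" if X: "X \<in> Core" "Y \<in> Core" for X Y
  proof (rule eq_I)
    fix w p assume w: "w \<in> V"
    have V: "X \<in> V" "Y \<in> V" using X Core_Null by auto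
    have "A (X + Y) (X + Y) (X + Y) = 0" "A (X + (- Y)) (X + (- Y)) (X + (- Y)) = 0"
      using A_Core_cubic Core_closed X by blast+
    then have "g (A (X + Y) (X + Y) (X + Y)) w p = 0" "g (A (X + (- Y)) (X + (- Y)) (X + (- Y))) w p = 0"
      using w by simp_all
    then show "g (A X Y Y) w p = g 0 w p"
      using V w A_Core_cubic[OF X(1)] A_Core_cubic[OF X(2)] s(1-4)[OF X X(1)] by simp
  qed (use X Core_Null in auto)
  have V: "X \<in> V" "Y \<in> V" "Z \<in> V" using X Core_Null by auto
  have "A X (Y + Z) (Y + Z) = 0" using 1 Core_closed X by blast
  then have "A X Y Z + A X Y Z = 0" using V 1[OF X(1,2)] 1[OF X(1,3)] s(6)[OF X] by simp
  then show ?thesis by (rule double_0[rotated]) (use V in simp)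
qed

text \<open>
  By \<open>tau_inner\<close>, the norm of \<open>tau X a b\<close> is a value of \<open>A X (tau X a b)\<close>, so it vanishes with it (\<open>tauI\<close>), and vanishing of
  \<open>tau X a\<close> makes \<open>A X Y a\<close> vanish for all \<open>Y\<close> (\<open>AI\<close>). Alternating the two, each of the
  steps frees one more argument of \<open>A\<close>, first from \<open>Core\<close> to the nullity, then from the nullity to
  \<open>V\<close>.
\<close>
theorem A_zero: assumes "X \<in> V" "Y \<in> V" "Z \<in> V" shows "A X Y Z = 0"
proof -
  have tauI: "tau X a b = 0" if "X \<in> V" "a \<in> V" "b \<in> V" "\<And>p. g (A X (tau X a b) a) b p = 0" for X a b
    using tau_inner[of X a b "tau X a b"] that g_def[of "tau X a b"] by simp
  have AI: "A X Y a = 0" if "X \<in> V" "Y \<in> V" "a \<in> V" "\<And>b. b \<in> V \<Longrightarrow> tau X a b = 0" for X Y a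
  proof (rule eq_I)
    fix b p assume b: "b \<in> V"
    show "g (A X Y a) b p = g 0 b p" using tau_inner[of X a b Y p] that b by simp
  qed (use that in auto)
  note H = Core_Null
  have 1: "A W X X' = 0" if W: "W \<in> V" and X: "X \<in> Core" "X' \<in> Core" for W X X'
  proof -
    have "tau X X' u = 0" if u: "u \<in> V" for u
      by (rule tauI) (use X H u A_Core[OF X(1) tau_Core X(2)] in auto)
    then have "A X W X' = 0" using AI[of X W X'] X H W by auto
    then show ?thesis using A_sym[of X W X'] X H W by auto
  qed
  have 2: "A W U X = 0" if W: "W \<in> Null" "U \<in> V" and X: "X \<in> Core" for W U X
  proof -
    have "tau W X u = 0" if u: "u \<in> V" for u
      by (rule tauI) (use X H u W 1[of W "tau W X u" X] tau_Core[of W X u] in auto)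
    then show ?thesis using AI[of W U X] X H W by auto
  qed
  have 3: "A W U W' = 0" if W: "W \<in> Null" "W' \<in> Null" "U \<in> V" for W W' U
  proof -
    have "A W X W' = 0" if X: "X \<in> Core" for X
      using 2[OF W(1) _ X, of W'] A_Null_sym[OF W(1,2) H[OF X]] W by simp
    then have "tau W W' u = 0" if u: "u \<in> V" for u
      by (intro tauI) (use H u W tau_Core[of W W' u] in auto)
    then show ?thesis using AI[of W U W'] W by auto
  qed
  have 4: "A U U' W = 0" if W: "W \<in> Null" "U \<in> V" "U' \<in> V" for U U' W
  proof -
    have "A U W' W = 0" if W': "W' \<in> Null" for W'
      using 3[OF W' W(1,2)] A_sym[of U W' W] W W' by simp
    then have "tau U W u = 0" if u: "u \<in> V" for u
      by (intro tauI) (use u W in auto)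
    then show ?thesis using AI[of U U' W] W by auto
  qed
  have 5: "A U W a = 0" if W: "W \<in> Null" "U \<in> V" "a \<in> V" for U W a
  proof (rule eq_I)
    fix b p assume b: "b \<in> V"
    show "g (A U W a) b p = g 0 b p"
      using A_cyc[of U W a b p] A_skew[of U a b W p] 4[OF W(1,2,3)] 4[OF W(1,2) b] W b by simp
  qed (use W in auto)
  have "tau X a b = 0" if "X \<in> V" "a \<in> V" "b \<in> V" for X a b
    by (rule tauI) (use that 5 in auto)
  then show ?thesis using AI assms by auto
qed

theorem tau_zero: "X \<in> V \<Longrightarrow> Y \<in> V \<Longrightarrow> Z \<in> V \<Longrightarrow> tau X Y Z = 0"
  by (simp add: tau_def A_zero)

end

section \<open>Functions of class C^k\<close>

lemma C_on_cong:
  assumes "open S" "\<And>x. x \<in> S \<Longrightarrow> f x = g x" "C_on k S f" shows "C_on k S g"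
  using assms(2,3)
proof (induction k arbitrary: f g)
  case 0
  then show ?case using continuous_on_cong[of S S f g] by simp
next
  case (Suc k)
  have d: "(g has_derivative frechet_derivative f (at x)) (at x)" if "x \<in> S" for x
    using has_derivative_transform_within_open[OF _ assms(1) that, of f "frechet_derivative f (at x)" UNIV g]
      frechet_derivative_works Suc.prems that by auto
  then have e: "frechet_derivative g (at x) = frechet_derivative f (at x)" if "x \<in> S" for x
    using frechet_derivative_at[OF d[OF that]] by simp
  have "C_on k S (\<lambda>x. frechet_derivative g (at x) v)" for v
    by (rule Suc.IH[of "\<lambda>x. frechet_derivative f (at x) v"]) (use Suc.prems e in auto)
  moreover have "g differentiable at x" if "x \<in> S" for x using d[OF that] by (rule differentiableI)
  ultimately show ?case by simp
qed

lemma C_on_subset: "C_on k S f \<Longrightarrow> T \<subseteq> S \<Longrightarrow> C_on k T f"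
  by (induction k arbitrary: f) (auto intro: continuous_on_subset)

lemma C_on_local:
  assumes "\<And>x. x \<in> S \<Longrightarrow> \<exists>T. open T \<and> x \<in> T \<and> C_on k T f" shows "C_on k S f"
  using assms
proof (induction k arbitrary: f)
  case 0
  have "continuous (at x within S) f" if "x \<in> S" for x
    using 0[OF that] continuous_on_interior[of _ f x] continuous_at_imp_continuous_at_within
    by (metis C_on.simps(1) interior_open)
  then show ?case by (simp add: continuous_on_eq_continuous_within)
next
  case (Suc k)
  have "C_on k S (\<lambda>x. frechet_derivative f (at x) v)" for v
    by (rule Suc.IH) (use Suc.prems in fastforce)
  moreover have "f differentiable at x" if "x \<in> S" for x using Suc.prems[OF that] by auto
  ultimately show ?case by simp
qed

lemma C_on_Suc_imp: "C_on (Suc k) S f \<Longrightarrow> C_on k S f"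
proof (induction k arbitrary: f)
  case 0
  then have "continuous (at x within S) f" if "x \<in> S" for x
    using differentiable_imp_continuous_within[of f x UNIV] continuous_at_imp_continuous_at_within that by auto
  then show ?case by (simp add: continuous_on_eq_continuous_within)
qed auto

lemma C_on_SucI:
  assumes "open S" "\<And>x. x \<in> S \<Longrightarrow> (f has_derivative f' x) (at x)" "\<And>v. C_on k S (\<lambda>x. f' x v)"
  shows "C_on (Suc k) S f"
proof -
  have e: "f' x = frechet_derivative f (at x)" if "x \<in> S" for x
    using frechet_derivative_at[OF assms(2)[OF that]] .
  have "C_on k S (\<lambda>x. frechet_derivative f (at x) v)" for v
    by (rule C_on_cong[OF assms(1) _ assms(3)[of v]]) (simp add: e)
  then show ?thesis using assms(2) by (auto intro: differentiableI)
qed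

lemma C_on_deriv: "C_on (Suc k) S f \<Longrightarrow> x \<in> S \<Longrightarrow> (f has_derivative frechet_derivative f (at x)) (at x)"
  by (auto simp: frechet_derivative_works)

lemma C_on_const: "open S \<Longrightarrow> C_on k S (\<lambda>x. c)"
proof (induction k arbitrary: c)
  case (Suc k)
  show ?case by (rule C_on_SucI[OF Suc.prems, where f' = "\<lambda>x v. 0"]) (use Suc in auto)
qed simp

lemma C_on_bounded_linear:
  assumes "open S" "bounded_linear L" "C_on k S f" shows "C_on k S (\<lambda>x. L (f x))"
  using assms(3)
proof (induction k arbitrary: f)
  case 0
  then show ?case using bounded_linear.continuous_on[OF assms(2)] by simp
next
  case (Suc k)
  show ?case
    by (rule C_on_SucI[OF assms(1), where f' = "\<lambda>x v. L (frechet_derivative f (at x) v)"])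
      (use Suc bounded_linear.has_derivative[OF assms(2) C_on_deriv[OF Suc.prems]] in auto)
qed

lemma C_on_linear: assumes "open S" "bounded_linear L" shows "C_on k S L"
proof (cases k)
  case 0
  then show ?thesis using bounded_linear.continuous_on[OF assms(2) continuous_on_id] by simp
next
  case (Suc k)
  show ?thesis unfolding Suc
    by (rule C_on_SucI[OF assms(1), where f' = "\<lambda>x. L"])
      (use assms bounded_linear_imp_has_derivative C_on_const in auto)
qed

lemma C_on_add:
  assumes "open S" "C_on k S f" "C_on k S g" shows "C_on k S (\<lambda>x. f x + g x)"
  using assms(2,3)
proof (induction k arbitrary: f g)
  case 0
  then show ?case by (auto intro: continuous_intros)
next
  case (Suc k)
  show ?case
    by (rule C_on_SucI[OF assms(1), where f' = "\<lambda>x v. frechet_derivative f (at x) v + frechet_derivative g (at x) v"])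
      (use Suc has_derivative_add[OF C_on_deriv[OF Suc.prems(1)] C_on_deriv[OF Suc.prems(2)]] in auto)
qed

lemma C_on_sum:
  assumes "open S" "finite I" "\<And>i. i \<in> I \<Longrightarrow> C_on k S (f i)" shows "C_on k S (\<lambda>x. \<Sum>i\<in>I. f i x)"
  using assms(2,3)
  by (induction I rule: finite_induct) (auto intro: C_on_const C_on_add assms(1))

lemma C_on_mult:
  fixes f g :: "'v::real_normed_vector \<Rightarrow> real"
  assumes "open S" "C_on k S f" "C_on k S g" shows "C_on k S (\<lambda>x. f x * g x)"
  using assms(2,3)
proof (induction k arbitrary: f g)
  case 0
  then show ?case by (auto intro: continuous_intros)
next
  case (Suc k)
  let ?f = "frechet_derivative f" and ?g = "frechet_derivative g"
  show ?case
  proof (rule C_on_SucI[OF assms(1), where f' = "\<lambda>x v. f x * ?g (at x) v + ?f (at x) v * g x"])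
    fix x assume x: "x \<in> S"
    show "((\<lambda>x. f x * g x) has_derivative (\<lambda>v. f x * ?g (at x) v + ?f (at x) v * g x)) (at x)"
      by (rule has_derivative_mult[OF C_on_deriv[OF Suc.prems(1) x] C_on_deriv[OF Suc.prems(2) x]])
  next
    fix v
    have "C_on k S f" "C_on k S g" using C_on_Suc_imp Suc.prems by blast+
    then show "C_on k S (\<lambda>x. f x * ?g (at x) v + ?f (at x) v * g x)"
      using Suc by (intro C_on_add[OF assms(1)] Suc.IH) auto
  qed
qed

lemma C_on_compose:
  fixes f :: "'b::euclidean_space \<Rightarrow> real" and h :: "'a::real_normed_vector \<Rightarrow> 'b"
  assumes S: "open S" and h: "\<And>k. C_on k S h" "h ` S \<subseteq> T" and f: "C_on k T f"
  shows "C_on k S (\<lambda>x. f (h x))"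
  using f
proof (induction k arbitrary: f)
  case 0
  have "continuous_on S h" using h(1)[of 0] by simp
  then show ?case using continuous_on_compose2[of T f S h] 0 h(2) by simp
next
  case (Suc k)
  let ?f = "\<lambda>y. frechet_derivative f (at y)" and ?h = "\<lambda>x. frechet_derivative h (at x)"
  have df: "(f has_derivative ?f (h x)) (at (h x))" if "x \<in> S" for x
    using C_on_deriv[OF Suc.prems] h(2) that by blast
  have dh: "(h has_derivative ?h x) (at x)" if "x \<in> S" for x
    using C_on_deriv[OF h(1)[of "Suc 0"] that] .
  show ?case
  proof (rule C_on_SucI[OF S, where f' = "\<lambda>x v. \<Sum>b\<in>Basis. (?h x v \<bullet> b) * ?f (h x) b"])
    fix x assume x: "x \<in> S"
    have lin: "linear (?f (h x))" using df[OF x] has_derivative_linear by blast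
    have "?f (h x) (?h x v) = (\<Sum>b\<in>Basis. (?h x v \<bullet> b) * ?f (h x) b)" for v
    proof -
      have "?f (h x) (?h x v) = ?f (h x) (\<Sum>b\<in>Basis. (?h x v \<bullet> b) *\<^sub>R b)" by (simp add: euclidean_representation)
      then show ?thesis by (simp add: linear_sum[OF lin] linear_scale[OF lin])
    qed
    then show "((\<lambda>x. f (h x)) has_derivative (\<lambda>v. \<Sum>b\<in>Basis. (?h x v \<bullet> b) * ?f (h x) b)) (at x)"
      using has_derivative_compose[OF dh[OF x] df[OF x]] by simp
  next
    fix v
    have "C_on k S (\<lambda>x. ?h x v \<bullet> b)" for b
      using C_on_bounded_linear[OF S bounded_linear_inner_left[of b], of k "\<lambda>x. ?h x v"] h(1)[of "Suc k"] by auto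
    moreover have "C_on k S (\<lambda>x. ?f (h x) b)" for b
      using Suc.IH[of "\<lambda>y. ?f y b"] Suc.prems by simp
    ultimately show "C_on k S (\<lambda>x. \<Sum>b\<in>Basis. (?h x v \<bullet> b) * ?f (h x) b)"
      by (intro C_on_sum[OF S] C_on_mult[OF S]) auto
  qed
qed

section \<open>Bump functions\<close>

text \<open>
  The functions \<open>t\<^sup>-\<^sup>n exp (- 1 / t)\<close>, continued by zero to \<open>t \<le> 0\<close>. The powers are included to have a
  family closed under differentiation.
\<close>
definition flat :: "nat \<Rightarrow> real \<Rightarrow> real" where
  "flat n t = (if t > 0 then inverse t ^ n * exp (- inverse t) else 0)"

lemma flat_tendsto_0: "(flat n \<longlongrightarrow> 0) (at 0)"
proof -
  have "((\<lambda>t::real. inverse t ^ n / exp (inverse t)) \<longlongrightarrow> 0) (at_right 0)"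
    using filterlim_compose[OF tendsto_power_div_exp_0 filterlim_inverse_at_top_right] .
  then have "(flat n \<longlongrightarrow> 0) (at_right 0)"
    by (rule Lim_transform_eventually)
      (auto simp: flat_def eventually_at_filter exp_minus divide_inverse)
  moreover have "(flat n \<longlongrightarrow> 0) (at_left 0)"
    by (rule Lim_transform_eventually[OF tendsto_const]) (auto simp: flat_def eventually_at_filter)
  ultimately show ?thesis by (simp add: filterlim_split_at)
qed

lemma flat_deriv: "(flat n has_real_derivative (flat (n + 2) t - real n * flat (n + 1) t)) (at t)"
proof (cases t "0::real" rule: linorder_cases)
  case less
  have "(flat n has_real_derivative 0) (at t)"
    by (rule DERIV_cong_ev[THEN iffD1, of t t "\<lambda>_. 0" _ 0 0])
      (use less eventually_nhds_in_open[of "{..<0}" t] in \<open>auto simp: flat_def elim!: eventually_mono\<close>)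
  then show ?thesis using less by (simp add: flat_def)
next
  case equal
  have "((\<lambda>h. (flat n (0 + h) - flat n 0) / h) \<longlongrightarrow> 0) (at 0)"
  proof (rule Lim_transform_eventually[OF flat_tendsto_0[of "Suc n"]])
    show "\<forall>\<^sub>F h in at 0. flat (Suc n) h = (flat n (0 + h) - flat n 0) / h"
      by (auto simp: flat_def eventually_at_filter divide_inverse)
  qed
  then have "(flat n has_real_derivative 0) (at 0)" unfolding DERIV_def .
  then show ?thesis using equal by (simp add: flat_def)
next
  case greater
  have "((\<lambda>t. inverse t ^ n * exp (- inverse t)) has_real_derivative (flat (n + 2) t - real n * flat (n + 1) t)) (at t)"
    using greater
    by (auto intro!: derivative_eq_intros simp: flat_def field_simps power2_eq_square)
       (cases n; simp add: field_simps)
  then show ?thesis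
    by (rule DERIV_cong_ev[THEN iffD1, rotated -1])
      (use greater eventually_nhds_in_open[of "{0<..}" t] in \<open>auto simp: flat_def elim!: eventually_mono\<close>)
qed

lemma C_on_flat: "C_on k UNIV (flat n)"
proof (induction k arbitrary: n)
  case 0
  have "isCont (flat n) t" for t using flat_deriv DERIV_isCont by blast
  then show ?case by (simp add: continuous_on_eq_continuous_at)
next
  case (Suc k)
  show ?case
  proof (rule C_on_SucI[OF open_UNIV, where f' = "\<lambda>t v. (flat (n + 2) t - real n * flat (n + 1) t) * v"])
    show "(flat n has_derivative (*) (flat (n + 2) t - real n * flat (n + 1) t)) (at t)" for t
      using flat_deriv[of n t] by (simp add: has_field_derivative_def)
    show "C_on k UNIV (\<lambda>t. (flat (n + 2) t - real n * flat (n + 1) t) * v)" for v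
      using C_on_add[OF open_UNIV C_on_mult[OF open_UNIV Suc.IH[of "n+2"] C_on_const[OF open_UNIV, of k v]]
        C_on_mult[OF open_UNIV Suc.IH[of "n+1"] C_on_const[OF open_UNIV, of k "- real n * v"]]]
      by (simp add: algebra_simps)
  qed
qed

text \<open>
  Written with coordinates rather than the norm, so that the argument of \<open>flat\<close> is a polynomial.
\<close>
definition bump :: "'e::euclidean_space \<Rightarrow> real \<Rightarrow> 'e \<Rightarrow> real" where
  "bump x0 r x = flat 0 (r\<^sup>2 - (\<Sum>b\<in>Basis. ((x - x0) \<bullet> b) * ((x - x0) \<bullet> b)))"

lemma bump_eq: "bump x0 r x = flat 0 (r\<^sup>2 - (norm (x - x0))\<^sup>2)"
  by (simp add: bump_def power2_norm_eq_inner euclidean_inner[of "x - x0" "x - x0"])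

lemma bump_pos: assumes "r > 0" shows "bump x0 r x \<noteq> 0 \<longleftrightarrow> x \<in> ball x0 r"
proof -
  have "(norm (x - x0))\<^sup>2 < r\<^sup>2 \<longleftrightarrow> norm (x - x0) < r"
    using power2_less_imp_less[of "norm (x - x0)" r] power_strict_mono[of "norm (x - x0)" r 2] assms by auto
  then show ?thesis by (auto simp: bump_eq flat_def dist_norm norm_minus_commute)
qed

lemma C_on_bump: "C_on k UNIV (bump x0 r)"
proof -
  have c: "C_on k UNIV (\<lambda>x. (x - x0) \<bullet> b)" for b :: 'a and k
    using C_on_add[OF open_UNIV C_on_linear[OF open_UNIV bounded_linear_inner_left[of b]] C_on_const[OF open_UNIV, of _ "- (x0 \<bullet> b)"]]
    by (simp add: inner_diff_left)
  have "C_on k UNIV (\<lambda>x. r\<^sup>2 + (-1) * (\<Sum>b\<in>Basis. ((x - x0) \<bullet> b) * ((x - x0) \<bullet> b)))" for k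
    by (intro C_on_add C_on_mult C_on_const C_on_sum c) auto
  from C_on_compose[OF open_UNIV this, of UNIV k "flat 0"] show ?thesis
    using C_on_flat by (simp add: bump_def[abs_def])
qed

section \<open>Hadamard's lemma\<close>

text \<open>
  Differentiation under the integral sign produces another integral of this form with \<open>j + 1\<close> for
  \<open>j\<close>; the weight \<open>t ^ j\<close> makes the induction go through.
\<close>
lemma C_on_integral:
  fixes h :: "'e::euclidean_space \<Rightarrow> real"
  assumes B: "open B" "convex B" "q \<in> B" and h: "\<And>k. C_on k B h"
  shows "C_on k B (\<lambda>x. integral {0..1} (\<lambda>t. t ^ j * h (q + t *\<^sub>R (x - q))))"
proof -
  have inB: "q + t *\<^sub>R (x - q) \<in> B" if "x \<in> B" "t \<in> {0..1}" for x t
  proof -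
    have "(1 - t) *\<^sub>R q + t *\<^sub>R x \<in> B" using B that by (auto intro: convexD)
    then show ?thesis by (simp add: algebra_simps)
  qed
  have cont: "continuous_on (B \<times> {0..1}) (\<lambda>(x, t). t ^ j * h (q + t *\<^sub>R (x - q)))" if "continuous_on B h" for h :: "'e \<Rightarrow> real" and j
    unfolding split_beta
    by (intro continuous_intros continuous_on_compose2[OF that]) (auto simp: inB)
  show ?thesis
    using h
  proof (induction k arbitrary: h j)
    case 0
    have "continuous_on B h" using 0[of 0] by simp
    then show ?case
      using integral_continuous_on_param[of B "0::real" 1 "\<lambda>x t. t ^ j * h (q + t *\<^sub>R (x - q))"] cont[of h j]
      by (simp add: cbox_interval)
  next
    case (Suc k)
    let ?h = "\<lambda>y. frechet_derivative h (at y)"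
    have hd: "C_on k B (\<lambda>y. ?h y v)" for k v using Suc.prems[of "Suc k"] by simp
    have dh: "(h has_derivative ?h y) (at y)" if "y \<in> B" for y using C_on_deriv[OF Suc.prems[of "Suc 0"] that] .
    define c where "c b x t = t ^ Suc j * ?h (q + t *\<^sub>R (x - q)) b" for b x and t :: real
    define L where "L b = Blinfun (\<lambda>v. v \<bullet> b)" for b :: 'e
    define fx where "fx x t = (\<Sum>b\<in>Basis. c b x t *\<^sub>R L b)" for x t
    have L: "blinfun_apply (L b) v = v \<bullet> b" for b v
      by (simp add: L_def bounded_linear_Blinfun_apply bounded_linear_inner_left)
    have ccont: "continuous_on (B \<times> {0..1}) (\<lambda>(x, t). c b x t)" for b
      unfolding c_def by (rule cont) (use hd[of 0 b] in simp)
    have ccont1: "continuous_on {0..1} (c b x)" if "x \<in> B" for b x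
    proof -
      have "continuous_on {0..1} (\<lambda>t. case (x, t) of (x, t) \<Rightarrow> c b x t)"
        by (rule continuous_on_compose2[OF ccont[of b]]) (use that in \<open>auto intro!: continuous_intros\<close>)
      then show ?thesis by simp
    qed
    have fcont1: "continuous_on {0..1} (\<lambda>t. t ^ j * h (q + t *\<^sub>R (x - q)))" if "x \<in> B" for x
    proof -
      have "continuous_on B h" using Suc.prems[of 0] by simp
      then have "continuous_on {0..1} (\<lambda>t. case (x, t) of (x, t) \<Rightarrow> t ^ j * h (q + t *\<^sub>R (x - q)))"
        by (rule continuous_on_compose2[OF cont]) (use that in \<open>auto intro!: continuous_intros\<close>)
      then show ?thesis by simp
    qed
    have der: "((\<lambda>x. t ^ j * h (q + t *\<^sub>R (x - q))) has_derivative blinfun_apply (fx x t)) (at x within B)"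
      if "x \<in> B" "t \<in> cbox 0 1" for x and t :: real
    proof -
      have y: "q + t *\<^sub>R (x - q) \<in> B" using inB that by (simp add: cbox_interval)
      have lin: "linear (?h (q + t *\<^sub>R (x - q)))" using dh[OF y] has_derivative_linear by blast
      have "((\<lambda>x. q + t *\<^sub>R (x - q)) has_derivative (\<lambda>v. t *\<^sub>R v)) (at x)"
        by (auto intro!: derivative_eq_intros)
      from has_derivative_mult_right[OF has_derivative_compose[OF this dh[OF y]], of "t ^ j"]
      have "((\<lambda>x. t ^ j * h (q + t *\<^sub>R (x - q))) has_derivative (\<lambda>v. t ^ j * ?h (q + t *\<^sub>R (x - q)) (t *\<^sub>R v))) (at x)" .
      moreover have "t ^ j * ?h (q + t *\<^sub>R (x - q)) (t *\<^sub>R v) = blinfun_apply (fx x t) v" for v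
      proof -
        have "?h (q + t *\<^sub>R (x - q)) v = ?h (q + t *\<^sub>R (x - q)) (\<Sum>b\<in>Basis. (v \<bullet> b) *\<^sub>R b)"
          by (simp add: euclidean_representation)
        also have "\<dots> = (\<Sum>b\<in>Basis. (v \<bullet> b) * ?h (q + t *\<^sub>R (x - q)) b)"
          by (simp add: linear_sum[OF lin] linear_scale[OF lin])
        finally show ?thesis
          by (simp add: fx_def c_def blinfun.sum_left blinfun.scaleR_left L linear_scale[OF lin] sum_distrib_left mult_ac)
      qed
      ultimately show ?thesis by (simp add: has_derivative_at_withinI)
    qed
    have fxcont: "continuous_on (B \<times> cbox 0 1) (\<lambda>(x, t). fx x t)"
      unfolding fx_def split_beta
      by (intro continuous_intros) (use ccont in \<open>simp add: cbox_interval split_beta\<close>)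
    have int: "integral (cbox 0 1) (fx x) = (\<Sum>b\<in>Basis. integral {0..1} (c b x) *\<^sub>R L b)" if "x \<in> B" for x
    proof -
      have "((\<lambda>t. c b x t *\<^sub>R L b) has_integral (integral {0..1} (c b x) *\<^sub>R L b)) {0..1}" for b
        by (rule has_integral_scaleR_left[OF integrable_integral[OF integrable_continuous_interval[OF ccont1[OF that]]]])
      then have "((\<lambda>t. \<Sum>b\<in>Basis. c b x t *\<^sub>R L b) has_integral (\<Sum>b\<in>Basis. integral {0..1} (c b x) *\<^sub>R L b)) {0..1}"
        by (intro has_integral_sum) auto
      then show ?thesis unfolding fx_def cbox_interval by (rule integral_unique)
    qed
    show ?case
    proof (rule C_on_SucI[OF B(1), where f' = "\<lambda>x v. \<Sum>b\<in>Basis. (v \<bullet> b) * integral {0..1} (c b x)"])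
      fix x assume x: "x \<in> B"
      have "((\<lambda>x. integral (cbox 0 1) (\<lambda>t. t ^ j * h (q + t *\<^sub>R (x - q)))) has_derivative
          blinfun_apply (integral (cbox 0 1) (fx x))) (at x within B)"
        by (rule leibniz_rule[OF der _ fxcont x B(2)])
          (auto simp: cbox_interval intro!: integrable_continuous_interval fcont1)
      moreover have "blinfun_apply (integral (cbox 0 1) (fx x)) = (\<lambda>v. \<Sum>b\<in>Basis. (v \<bullet> b) * integral {0..1} (c b x))"
        by (rule ext) (simp add: int[OF x, unfolded cbox_interval] blinfun.sum_left blinfun.scaleR_left L mult.commute)
      ultimately show "((\<lambda>x. integral {0..1} (\<lambda>t. t ^ j * h (q + t *\<^sub>R (x - q)))) has_derivative
          (\<lambda>v. \<Sum>b\<in>Basis. (v \<bullet> b) * integral {0..1} (c b x))) (at x)"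
        by (simp add: at_within_open[OF x B(1)])
    next
      fix v
      have "C_on k B (\<lambda>x. integral {0..1} (c b x))" for b
        unfolding c_def using Suc.IH[of "\<lambda>y. ?h y b" "Suc j"] hd by blast
      then show "C_on k B (\<lambda>x. \<Sum>b\<in>Basis. (v \<bullet> b) * integral {0..1} (c b x))"
        by (intro C_on_sum[OF B(1)] C_on_mult[OF B(1)] C_on_const[OF B(1)]) auto
    qed
  qed
qed

text \<open>
  \<open>G b\<close> is the average of the partial derivative along the segment from \<open>q\<close> to \<open>x\<close>.
\<close>
lemma hadamard:
  fixes f :: "'e::euclidean_space \<Rightarrow> real"
  assumes B: "open B" "convex B" "q \<in> B" and f: "\<And>k. C_on k B f"
  obtains G where "\<And>b k. C_on k B (G b)" "\<And>b. G b q = frechet_derivative f (at q) b"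
    "\<And>x. x \<in> B \<Longrightarrow> f x = f q + (\<Sum>b\<in>Basis. ((x - q) \<bullet> b) * G b x)"
proof
  let ?f = "\<lambda>y. frechet_derivative f (at y)"
  let ?G = "\<lambda>b x. integral {0..1} (\<lambda>t. t ^ 0 * ?f (q + t *\<^sub>R (x - q)) b)"
  have fd: "C_on k B (\<lambda>y. ?f y v)" for k v using f[of "Suc k"] by simp
  show "C_on k B (?G b)" for b k by (rule C_on_integral[OF B]) (rule fd)
  show "?G b q = ?f q b" for b by simp
  fix x assume x: "x \<in> B"
  have inB: "q + t *\<^sub>R (x - q) \<in> B" if "t \<in> {0..1}" for t
  proof -
    have "(1 - t) *\<^sub>R q + t *\<^sub>R x \<in> B" using B x that by (auto intro: convexD)
    then show ?thesis by (simp add: algebra_simps)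
  qed
  have dv: "((\<lambda>t. f (q + t *\<^sub>R (x - q))) has_vector_derivative (\<Sum>b\<in>Basis. ((x - q) \<bullet> b) * ?f (q + t *\<^sub>R (x - q)) b)) (at t within {0..1})"
    if "t \<in> {0..1}" for t
  proof -
    let ?y = "q + t *\<^sub>R (x - q)"
    have df: "(f has_derivative ?f ?y) (at ?y)" using C_on_deriv[OF f[of "Suc 0"] inB[OF that]] .
    have lin: "linear (?f ?y)" using df has_derivative_linear by blast
    have "((\<lambda>t. q + t *\<^sub>R (x - q)) has_derivative (\<lambda>s. s *\<^sub>R (x - q))) (at t within {0..1})"
      by (auto intro!: derivative_eq_intros)
    from has_derivative_compose[OF this df]
    have "((\<lambda>t. f (q + t *\<^sub>R (x - q))) has_derivative (\<lambda>s. ?f ?y (s *\<^sub>R (x - q)))) (at t within {0..1})" .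
    moreover have "?f ?y (x - q) = (\<Sum>b\<in>Basis. ((x - q) \<bullet> b) * ?f ?y b)"
    proof -
      have "?f ?y (x - q) = ?f ?y (\<Sum>b\<in>Basis. ((x - q) \<bullet> b) *\<^sub>R b)" by (simp add: euclidean_representation)
      then show ?thesis by (simp add: linear_sum[OF lin] linear_scale[OF lin])
    qed
    ultimately show ?thesis by (simp add: has_vector_derivative_def linear_scale[OF lin])
  qed
  have c1: "continuous_on {0..1} (\<lambda>t. ?f (q + t *\<^sub>R (x - q)) b)" for b
  proof -
    have "continuous_on B (\<lambda>y. ?f y b)" using fd[of 0 b] by simp
    then show ?thesis by (rule continuous_on_compose2) (auto intro!: continuous_intros inB)
  qed
  have "((\<lambda>t. \<Sum>b\<in>Basis. ((x - q) \<bullet> b) * ?f (q + t *\<^sub>R (x - q)) b) has_integral (f (q + 1 *\<^sub>R (x - q)) - f (q + 0 *\<^sub>R (x - q)))) {0..1}"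
    by (rule fundamental_theorem_of_calculus) (use dv in auto)
  then have "f x - f q = integral {0..1} (\<lambda>t. \<Sum>b\<in>Basis. ((x - q) \<bullet> b) * ?f (q + t *\<^sub>R (x - q)) b)"
    by (simp add: integral_unique)
  also have "\<dots> = (\<Sum>b\<in>Basis. integral {0..1} (\<lambda>t. ((x - q) \<bullet> b) * ?f (q + t *\<^sub>R (x - q)) b))"
    by (rule Henstock_Kurzweil_Integration.integral_sum) (auto intro!: integrable_continuous_interval continuous_intros c1)
  finally show "f x = f q + (\<Sum>b\<in>Basis. ((x - q) \<bullet> b) * ?G b x)" by simp
qed

section \<open>Smooth functions and vector fields\<close>

lemma sum_fun_apply: "(\<Sum>i\<in>I. F i) x = (\<Sum>i\<in>I. F i x)"
  by (induction I rule: infinite_finite_induct) auto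

locale manifold =
  fixes M :: "'a topology" and A :: "('a, 'm::finite) chart set"
  assumes manifold: "smooth_manifold M A"
begin

abbreviation "CC \<equiv> smooth_functions M A"
abbreviation "VV \<equiv> vector_fields M A"

lemma chart:
  assumes "(U, \<phi>) \<in> A"
  shows "openin M U" "open (\<phi> ` U)" "homeomorphic_map (subtopology M U) (top_of_set (\<phi> ` U)) \<phi>"
    "inj_on \<phi> U" "topspace (subtopology M U) = U"
proof -
  have "\<forall>(U, \<phi>)\<in>A. openin M U \<and> open (\<phi> ` U) \<and>
        homeomorphic_map (subtopology M U) (top_of_set (\<phi> ` U)) \<phi>"
    using manifold unfolding smooth_manifold_def by (elim conjE)
  from bspec[OF this assms] show 1: "openin M U" "open (\<phi> ` U)" "homeomorphic_map (subtopology M U) (top_of_set (\<phi> ` U)) \<phi>"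
    by simp_all
  show 2: "topspace (subtopology M U) = U" using openin_subset[OF 1(1)] by auto
  show "inj_on \<phi> U" using homeomorphic_imp_injective_map[OF 1(3)] 2 by simp
qed

lemma transition:
  "(U, \<phi>) \<in> A \<Longrightarrow> (W, \<psi>) \<in> A \<Longrightarrow> C_on k (\<phi> ` (U \<inter> W)) (\<psi> \<circ> inv_into U \<phi>)"
proof -
  assume UW: "(U, \<phi>) \<in> A" "(W, \<psi>) \<in> A"
  have "\<forall>(U, \<phi>)\<in>A. \<forall>(V, \<psi>)\<in>A. smooth_on (\<phi> ` (U \<inter> V)) (\<psi> \<circ> inv_into U \<phi>)"
    using manifold unfolding smooth_manifold_def by (elim conjE)
  from bspec[OF bspec[OF this UW(1), simplified] UW(2)] show ?thesis by (simp add: smooth_on_def)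
qed

lemma hausdorff: "Hausdorff_space M"
  using manifold by (simp add: smooth_manifold_def)

lemma chart_at: assumes "p \<in> topspace M" obtains U \<phi> where "(U, \<phi>) \<in> A" "p \<in> U"
proof -
  have "(\<Union>(U, \<phi>)\<in>A. U) = topspace M" using manifold unfolding smooth_manifold_def by (elim conjE)
  with assms have "p \<in> (\<Union>(U, \<phi>)\<in>A. U)" by simp
  then show ?thesis using that by blast
qed

lemma chart_open:
  assumes "(U, \<phi>) \<in> A" "openin M S" shows "open (\<phi> ` (U \<inter> S))"
proof -
  have "openin (subtopology M U) (U \<inter> S)" using assms(2) by (simp add: openin_subtopology_Int2)
  then have "openin (top_of_set (\<phi> ` U)) (\<phi> ` (U \<inter> S))"
    using homeomorphic_map_openness[OF chart(3)[OF assms(1)], of "U \<inter> S"] chart(5)[OF assms(1)] by auto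
  then show ?thesis using openin_open_trans chart(2)[OF assms(1)] by blast
qed

lemma chart_open_vimage:
  assumes "(U, \<phi>) \<in> A" "open O'" "O' \<subseteq> \<phi> ` U" shows "openin M {p\<in>U. \<phi> p \<in> O'}"
proof -
  let ?W = "{p\<in>U. \<phi> p \<in> O'}"
  have "\<phi> ` ?W = O'" using assms(3) by auto
  moreover have "openin (top_of_set (\<phi> ` U)) O'" using assms by (simp add: open_subset)
  ultimately have "openin (subtopology M U) ?W"
    using homeomorphic_map_openness[OF chart(3)[OF assms(1)], of ?W] chart(5)[OF assms(1)] by auto
  then show ?thesis using openin_trans_full chart(1)[OF assms(1)] by blast
qed

lemma chart_closed_vimage:
  assumes "(U, \<phi>) \<in> A" "compact K" "K \<subseteq> \<phi> ` U" shows "closedin M {p\<in>U. \<phi> p \<in> K}"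
proof -
  let ?W = "{p\<in>U. \<phi> p \<in> K}"
  have "\<phi> ` ?W = K" using assms(3) by auto
  moreover have "compactin (top_of_set (\<phi> ` U)) K" using assms by (simp add: compactin_subtopology)
  ultimately have "compactin (subtopology M U) ?W"
    using homeomorphic_map_compactness[OF chart(3)[OF assms(1)], of ?W] chart(5)[OF assms(1)] by auto
  then have "compactin M ?W" using compactin_subtopology by blast
  then show ?thesis using compactin_imp_closedin hausdorff by blast
qed

lemma CC_I:
  assumes "\<And>p. p \<notin> topspace M \<Longrightarrow> f p = 0"
    and "\<And>U \<phi> k. (U, \<phi>) \<in> A \<Longrightarrow> C_on k (\<phi> ` U) (\<lambda>x. f (inv_into U \<phi> x))"
  shows "f \<in> CC"
  using assms unfolding smooth_functions_def smooth_on_def comp_def by blast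

lemma CC_D:
  assumes "f \<in> CC"
  shows "p \<notin> topspace M \<Longrightarrow> f p = 0" "(U, \<phi>) \<in> A \<Longrightarrow> C_on k (\<phi> ` U) (\<lambda>x. f (inv_into U \<phi> x))"
  using assms unfolding smooth_functions_def smooth_on_def comp_def by blast+

lemma CC_0 [simp]: "0 \<in> CC"
  by (rule CC_I) (auto intro: C_on_const chart)

lemma CC_add [simp]: "f \<in> CC \<Longrightarrow> h \<in> CC \<Longrightarrow> f + h \<in> CC"
  by (rule CC_I) (auto simp: CC_D intro!: C_on_add chart)

lemma CC_mult [simp]: "f \<in> CC \<Longrightarrow> h \<in> CC \<Longrightarrow> f * h \<in> CC"
  by (rule CC_I) (auto simp: CC_D intro!: C_on_mult chart)

lemma CC_cmult [simp]: "f \<in> CC \<Longrightarrow> (\<lambda>p. c) * f \<in> CC"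
  by (rule CC_I) (auto simp: CC_D intro!: C_on_mult C_on_const chart)

lemma CC_minus [simp]: "f \<in> CC \<Longrightarrow> - f \<in> CC"
  using CC_cmult[of f "-1"] by (simp add: fun_eq_iff fun_Compl_def times_fun_def)

lemma CC_diff [simp]: "f \<in> CC \<Longrightarrow> h \<in> CC \<Longrightarrow> f - h \<in> CC"
  using CC_add[of f "- h"] by simp

lemma CC_sum: "(\<And>i. i \<in> I \<Longrightarrow> f i \<in> CC) \<Longrightarrow> sum f I \<in> CC"
  by (induction I rule: infinite_finite_induct) auto

lemma VV_I:
  assumes "\<And>f. f \<in> CC \<Longrightarrow> X f \<in> CC" "\<And>f. f \<notin> CC \<Longrightarrow> X f = 0"
    "\<And>f h. f \<in> CC \<Longrightarrow> h \<in> CC \<Longrightarrow> X (f + h) = X f + X h"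
    "\<And>c f. f \<in> CC \<Longrightarrow> X ((\<lambda>p. c) * f) = (\<lambda>p. c) * X f"
    "\<And>f h. f \<in> CC \<Longrightarrow> h \<in> CC \<Longrightarrow> X (f * h) = f * X h + X f * h"
  shows "X \<in> VV"
  unfolding vector_fields_def Let_def using assms by blast

lemma VV_D:
  assumes "X \<in> VV"
  shows VV_CC [simp]: "f \<in> CC \<Longrightarrow> X f \<in> CC" and VV_out: "f \<notin> CC \<Longrightarrow> X f = 0"
    and VV_fadd: "f \<in> CC \<Longrightarrow> h \<in> CC \<Longrightarrow> X (f + h) = X f + X h"
    and VV_cmult: "f \<in> CC \<Longrightarrow> X ((\<lambda>p. c) * f) = (\<lambda>p. c) * X f"
    and VV_mult: "f \<in> CC \<Longrightarrow> h \<in> CC \<Longrightarrow> X (f * h) = f * X h + X f * h"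
proof -
  have "(\<forall>f\<in>CC. X f \<in> CC) \<and> (\<forall>f. f \<notin> CC \<longrightarrow> X f = 0) \<and>
         (\<forall>f\<in>CC. \<forall>h\<in>CC. X (f + h) = X f + X h) \<and>
         (\<forall>c. \<forall>f\<in>CC. X ((\<lambda>p. c) * f) = (\<lambda>p. c) * X f) \<and>
         (\<forall>f\<in>CC. \<forall>h\<in>CC. X (f * h) = f * X h + X f * h)"
    using assms unfolding vector_fields_def Let_def by blast
  then show "f \<in> CC \<Longrightarrow> X f \<in> CC" "f \<notin> CC \<Longrightarrow> X f = 0" "f \<in> CC \<Longrightarrow> h \<in> CC \<Longrightarrow> X (f + h) = X f + X h"
    "f \<in> CC \<Longrightarrow> X ((\<lambda>p. c) * f) = (\<lambda>p. c) * X f" "f \<in> CC \<Longrightarrow> h \<in> CC \<Longrightarrow> X (f * h) = f * X h + X f * h"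
    by blast+
qed

lemma VV_f0: "X \<in> VV \<Longrightarrow> X 0 = 0"
  using VV_fadd[of X 0 0] by simp

lemma VV_fdiff: assumes "X \<in> VV" "f \<in> CC" "h \<in> CC" shows "X (f - h) = X f - X h"
  using VV_fadd[OF assms(1), of "f - h" h] assms by simp

lemma VV_fsum: "X \<in> VV \<Longrightarrow> (\<And>i. i \<in> I \<Longrightarrow> f i \<in> CC) \<Longrightarrow> X (sum f I) = (\<Sum>i\<in>I. X (f i))"
  by (induction I rule: infinite_finite_induct) (auto simp: VV_f0 VV_fadd CC_sum)

lemma VV_0 [simp]: "0 \<in> VV"
  by (rule VV_I) auto

lemma VV_pointwise_I:
  assumes "\<And>f. f \<in> CC \<Longrightarrow> X f \<in> CC" "\<And>f p. f \<notin> CC \<Longrightarrow> X f p = 0"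
    "\<And>f h p. f \<in> CC \<Longrightarrow> h \<in> CC \<Longrightarrow> X (f + h) p = X f p + X h p"
    "\<And>c f p. f \<in> CC \<Longrightarrow> X ((\<lambda>p. c) * f) p = c * X f p"
    "\<And>f h p. f \<in> CC \<Longrightarrow> h \<in> CC \<Longrightarrow> X (f * h) p = f p * X h p + X f p * h p"
  shows "X \<in> VV"
  by (rule VV_I) (use assms in \<open>auto simp: fun_eq_iff\<close>)

lemma VV_add [simp]: assumes "X \<in> VV" "Y \<in> VV" shows "X + Y \<in> VV"
  by (rule VV_pointwise_I) (use assms in \<open>auto simp: VV_out VV_fadd VV_cmult VV_mult distrib_left distrib_right\<close>)

lemma VV_minus [simp]: assumes "X \<in> VV" shows "- X \<in> VV"
  by (rule VV_pointwise_I) (use assms in \<open>auto simp: VV_out VV_fadd VV_cmult VV_mult\<close>)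

lemma VV_vscale [simp]: assumes "f \<in> CC" "X \<in> VV" shows "vscale f X \<in> VV"
  by (rule VV_pointwise_I) (use assms in \<open>auto simp: vscale_def VV_out VV_fadd VV_cmult VV_mult distrib_left mult.left_commute mult.assoc\<close>)

lemma VV_cscale [simp]: assumes "X \<in> VV" shows "vscale (\<lambda>p. c) X \<in> VV"
  by (rule VV_pointwise_I) (use assms in \<open>auto simp: vscale_def VV_out VV_fadd VV_cmult VV_mult distrib_left mult.left_commute mult.assoc\<close>)

lemma VV_sum: "(\<And>i. i \<in> I \<Longrightarrow> F i \<in> VV) \<Longrightarrow> sum F I \<in> VV"
  by (induction I rule: infinite_finite_induct) auto

lemma VV_bracket [simp]: assumes X: "X \<in> VV" and Y: "Y \<in> VV" shows "lie_bracket X Y \<in> VV"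
proof (rule VV_pointwise_I)
  fix f h p c
  show "lie_bracket X Y f p = 0" if "f \<notin> CC"
    using VV_out[OF X that] VV_out[OF Y that] VV_f0[OF X] VV_f0[OF Y] by (simp add: lie_bracket_def)
  assume f: "f \<in> CC"
  show "lie_bracket X Y f \<in> CC" using f X Y by (simp add: lie_bracket_def)
  have "X (Y ((\<lambda>p. c) * f)) = (\<lambda>p. c) * X (Y f)" "Y (X ((\<lambda>p. c) * f)) = (\<lambda>p. c) * Y (X f)"
    unfolding VV_cmult[OF X f] VV_cmult[OF Y f] by (rule VV_cmult; use X Y f in simp)+
  then show "lie_bracket X Y ((\<lambda>p. c) * f) p = c * lie_bracket X Y f p"
    by (simp add: lie_bracket_def right_diff_distrib)
  assume h: "h \<in> CC"
  have "X (Y (f + h)) = X (Y f) + X (Y h)" "Y (X (f + h)) = Y (X f) + Y (X h)"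
    unfolding VV_fadd[OF X f h] VV_fadd[OF Y f h] by (rule VV_fadd; use X Y f h in simp)+
  then show "lie_bracket X Y (f + h) p = lie_bracket X Y f p + lie_bracket X Y h p"
    by (simp add: lie_bracket_def)
  have "P (Q (f * h)) = f * P (Q h) + P f * Q h + (Q f * P h + P (Q f) * h)" if "P \<in> VV" "Q \<in> VV" for P Q
    unfolding VV_mult[OF that(2) f h]
    using VV_fadd[OF that(1), of "f * Q h" "Q f * h"] VV_mult[OF that(1) f, of "Q h"] VV_mult[OF that(1) _ h, of "Q f"] that f h
    by (simp only: CC_mult VV_CC)
  from this[OF X Y] this[OF Y X]
  show "lie_bracket X Y (f * h) p = f p * lie_bracket X Y h p + lie_bracket X Y f p * h p"
    by (simp add: lie_bracket_def algebra_simps)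
qed

end

section \<open>Local expansion of vector fields\<close>

text \<open>
  A chart together with a ball in its image. The bump function has half the radius, so that its
  support has compact closure inside the ball.
\<close>
locale bump_chart = manifold +
  fixes U :: "'a set" and \<phi> :: "'a \<Rightarrow> real ^ 'b" and x0 :: "real ^ 'b" and R :: real
  assumes ch: "(U, \<phi>) \<in> A" and R: "0 < R" and ball: "ball x0 R \<subseteq> \<phi> ` U"
begin

definition extend :: "(real ^ 'b \<Rightarrow> real) \<Rightarrow> 'a \<Rightarrow> real" where
  "extend u p = (if p \<in> U then bump x0 (R / 2) (\<phi> p) * u (\<phi> p) else 0)"

lemma bump_zero: "x \<notin> ball x0 R \<Longrightarrow> bump x0 (R / 2) x = 0"
  using bump_pos[of "R / 2" x0 x] R by auto

lemma inv_chart: "x \<in> \<phi> ` U \<Longrightarrow> inv_into U \<phi> x \<in> U" "x \<in> \<phi> ` U \<Longrightarrow> \<phi> (inv_into U \<phi> x) = x"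
  "p \<in> U \<Longrightarrow> inv_into U \<phi> (\<phi> p) = p"
  using inv_into_f_f[OF chart(4)[OF ch]] by (auto simp: inv_into_into f_inv_into_f)

lemma U_sub: "p \<in> U \<Longrightarrow> p \<in> topspace M"
  using openin_subset[OF chart(1)[OF ch]] by auto

text \<open>
  In any chart the function is a product of smooth functions where \<open>\<phi>\<close> takes values in the ball, and zero
  off the preimage of the closed half ball. That preimage is compact, hence closed as \<open>M\<close> is Hausdorff, so
  these two open sets cover \<open>M\<close>.
\<close>
lemma extend_CC:
  assumes u: "\<And>k. C_on k (ball x0 R) u" shows "extend u \<in> CC"
proof (rule CC_I)
  show "extend u p = 0" if "p \<notin> topspace M" for p using that U_sub by (auto simp: extend_def)
  fix W \<psi> k assume W: "(W, \<psi>) \<in> A"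
  define U' where "U' = {p\<in>U. \<phi> p \<in> ball x0 R}"
  define K where "K = {p\<in>U. \<phi> p \<in> cball x0 (R / 2)}"
  have sub: "cball x0 (R / 2) \<subseteq> ball x0 R" using R by auto
  have U': "openin M U'" unfolding U'_def by (rule chart_open_vimage[OF ch open_ball ball])
  have K: "closedin M K" unfolding K_def by (rule chart_closed_vimage[OF ch compact_cball]) (use sub ball in blast)
  have inv: "inv_into W \<psi> (\<psi> p) = p" if "p \<in> W" for p
    using inv_into_f_f[OF chart(4)[OF W]] that by simp
  have 1: "C_on k (\<psi> ` (W \<inter> U')) (\<lambda>y. extend u (inv_into W \<psi> y))"
  proof (rule C_on_cong[OF chart_open[OF W U']])
    have t: "C_on k (\<psi> ` (W \<inter> U')) (\<lambda>y. \<phi> (inv_into W \<psi> y))" for k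
      using C_on_subset[OF transition[OF W ch, of k], of "\<psi> ` (W \<inter> U')"] by (auto simp: U'_def comp_def)
    have im: "(\<lambda>y. \<phi> (inv_into W \<psi> y)) ` (\<psi> ` (W \<inter> U')) \<subseteq> ball x0 R" using inv by (auto simp: U'_def)
    show "C_on k (\<psi> ` (W \<inter> U')) (\<lambda>y. bump x0 (R / 2) (\<phi> (inv_into W \<psi> y)) * u (\<phi> (inv_into W \<psi> y)))"
      by (intro C_on_mult[OF chart_open[OF W U']] C_on_compose[OF chart_open[OF W U'] t im]
          C_on_subset[OF C_on_bump subset_UNIV] u)
  qed (use inv in \<open>auto simp: extend_def U'_def\<close>)
  have o2: "openin M (topspace M - K)" using K by (simp add: closedin_def)
  have 2: "C_on k (\<psi> ` (W \<inter> (topspace M - K))) (\<lambda>y. extend u (inv_into W \<psi> y))"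
  proof (rule C_on_cong[OF chart_open[OF W o2] _ C_on_const[OF chart_open[OF W o2]]])
    fix y assume "y \<in> \<psi> ` (W \<inter> (topspace M - K))"
    then obtain p where p: "p \<in> W" "p \<notin> K" "y = \<psi> p" by blast
    have "bump x0 (R / 2) (\<phi> p) = 0" if "p \<in> U"
      using bump_pos[of "R / 2" x0 "\<phi> p"] R p(2) that by (auto simp: K_def)
    then show "0 = extend u (inv_into W \<psi> y)" using inv p by (auto simp: extend_def)
  qed
  show "C_on k (\<psi> ` W) (\<lambda>x. extend u (inv_into W \<psi> x))"
  proof (rule C_on_local)
    fix y assume "y \<in> \<psi> ` W"
    then obtain p where p: "p \<in> W" "y = \<psi> p" by blast
    have "p \<in> topspace M" using openin_subset[OF chart(1)[OF W]] p by auto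
    moreover have "K \<subseteq> U'" using sub by (auto simp: K_def U'_def)
    ultimately have "p \<in> U' \<or> p \<in> topspace M - K" by blast
    then show "\<exists>T. open T \<and> y \<in> T \<and> C_on k T (\<lambda>x. extend u (inv_into W \<psi> x))"
      using 1 2 chart_open[OF W U'] chart_open[OF W o2] p by blast
  qed
qed

definition rep where "rep f x = f (inv_into U \<phi> x)"

lemma C_on_rep: "f \<in> CC \<Longrightarrow> C_on k (\<phi> ` U) (rep f)"
  unfolding rep_def by (rule CC_D(2)[OF _ ch])

lemma C_on_ball: "C_on k (\<phi> ` U) u \<Longrightarrow> C_on k (ball x0 R) u"
  using C_on_subset ball by blast

lemma rep_deriv: "f \<in> CC \<Longrightarrow> x \<in> \<phi> ` U \<Longrightarrow> (rep f has_derivative frechet_derivative (rep f) (at x)) (at x)"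
  using C_on_deriv[OF C_on_rep] by blast

text \<open>
  The partial derivative in the direction \<open>b\<close>, multiplied by the bump function.
\<close>
definition coord_field :: "real ^ 'b \<Rightarrow> 'a vfield" where
  "coord_field b f = (if f \<in> CC then extend (\<lambda>x. frechet_derivative (rep f) (at x) b) else 0)"

lemma coord_field_eval: "f \<in> CC \<Longrightarrow> coord_field b f p =
    (if p \<in> U then bump x0 (R / 2) (\<phi> p) * frechet_derivative (rep f) (at (\<phi> p)) b else 0)"
  by (simp add: coord_field_def extend_def)

lemma VV_coord_field: "coord_field b \<in> VV"
proof (rule VV_pointwise_I)
  show "coord_field b f \<in> CC" if "f \<in> CC" for f
  proof -
    have "C_on k (ball x0 R) (\<lambda>x. frechet_derivative (rep f) (at x) b)" for k
      using C_on_ball[OF C_on_rep[OF that, of "Suc k"]] by simp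
    then show ?thesis using that by (simp add: coord_field_def extend_CC)
  qed
  show "coord_field b f p = 0" if "f \<notin> CC" for f p using that by (simp add: coord_field_def)
  fix f h p c assume f: "f \<in> CC"
  have d: "(rep f has_derivative frechet_derivative (rep f) (at (\<phi> p))) (at (\<phi> p))" if "p \<in> U"
    by (rule rep_deriv[OF f]) (use that in auto)
  have "frechet_derivative (rep ((\<lambda>p. c) * f)) (at (\<phi> p)) b = c * frechet_derivative (rep f) (at (\<phi> p)) b" if "p \<in> U"
    using frechet_derivative_at[OF has_derivative_mult_right[OF d[OF that], of c], symmetric] by (simp add: rep_def[abs_def])
  then show "coord_field b ((\<lambda>p. c) * f) p = c * coord_field b f p" using f by (simp add: coord_field_eval)
  assume h: "h \<in> CC"
  have e: "(rep h has_derivative frechet_derivative (rep h) (at (\<phi> p))) (at (\<phi> p))" if "p \<in> U"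
    by (rule rep_deriv[OF h]) (use that in auto)
  have "frechet_derivative (rep (f + h)) (at (\<phi> p)) b = frechet_derivative (rep f) (at (\<phi> p)) b + frechet_derivative (rep h) (at (\<phi> p)) b" if "p \<in> U"
    using frechet_derivative_at[OF has_derivative_add[OF d[OF that] e[OF that]], symmetric] by (simp add: rep_def[abs_def])
  then show "coord_field b (f + h) p = coord_field b f p + coord_field b h p"
    using f h by (simp add: coord_field_eval distrib_left)
  have "frechet_derivative (rep (f * h)) (at (\<phi> p)) b = f p * frechet_derivative (rep h) (at (\<phi> p)) b + frechet_derivative (rep f) (at (\<phi> p)) b * h p" if "p \<in> U"
    using frechet_derivative_at[OF has_derivative_mult[OF d[OF that] e[OF that]], symmetric] that inv_chart(3) by (simp add: rep_def[abs_def])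
  then show "coord_field b (f * h) p = f p * coord_field b h p + coord_field b f p * h p"
    using f h by (simp add: coord_field_eval algebra_simps)
qed

definition rho where "rho = extend (\<lambda>x. 1)"
text \<open>
  The coordinate functions are only locally defined; their products with the bump function are global.
\<close>
definition xi where "xi b = extend (\<lambda>x. x \<bullet> b)"
text \<open>
  Formally \<open>\<rho>\<^sup>2 X (\<xi> / \<rho>)\<close>, that is \<open>\<rho>\<^sup>2\<close> times the coordinate component of
  \<open>X\<close>, but defined everywhere.
\<close>
definition coeff where "coeff X b = rho * X (xi b) - xi b * X rho"

lemma CC_rho [simp]: "rho \<in> CC" and CC_xi [simp]: "xi b \<in> CC"
  unfolding rho_def xi_def
  by (rule extend_CC; simp add: C_on_const C_on_linear bounded_linear_inner_left)+

lemma CC_coeff [simp]: "X \<in> VV \<Longrightarrow> coeff X b \<in> CC"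
  by (simp add: coeff_def)

lemma rho_eval: "rho p = (if p \<in> U then bump x0 (R / 2) (\<phi> p) else 0)"
  by (simp add: rho_def extend_def)

text \<open>
  A derivation at \<open>p\<close> kills the constant term of the Hadamard expansion of \<open>f\<close> around \<open>p\<close> and sees only the
  first order terms. Multiplying the expansion by \<open>\<rho>\<^sup>2\<close>, one factor for the coordinates and one for the
  Hadamard functions, turns it into an identity between global smooth functions.
\<close>
lemma field_expansion_at:
  assumes X: "X \<in> VV" and f: "f \<in> CC" and p: "rho p \<noteq> 0"
  shows "(rho p)\<^sup>2 * X f p = (\<Sum>b\<in>Basis. coeff X b p * frechet_derivative (rep f) (at (\<phi> p)) b)"
proof -
  define q where "q = \<phi> p"
  have pU: "p \<in> U" using p by (auto simp: rho_eval split: if_splits)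
  have q: "q \<in> ball x0 R" using p pU bump_zero[of q] by (auto simp: rho_eval q_def)
  obtain G where G: "\<And>b k. C_on k (ball x0 R) (G b)" "\<And>b. G b q = frechet_derivative (rep f) (at q) b"
    "\<And>x. x \<in> ball x0 R \<Longrightarrow> rep f x = rep f q + (\<Sum>b\<in>Basis. ((x - q) \<bullet> b) * G b x)"
    using hadamard[OF open_ball convex_ball q C_on_ball[OF C_on_rep[OF f]]] by blast
  define \<Gamma> where "\<Gamma> b = extend (G b)" for b
  have \<Gamma>[simp]: "\<Gamma> b \<in> CC" for b using extend_CC G(1) by (simp add: \<Gamma>_def)
  \<comment> \<open>The coordinates centred at \<open>p\<close>, times the bump function.\<close>
  define z where "z b = xi b - (\<lambda>_. q \<bullet> b) * rho" for b
  have z[simp]: "z b \<in> CC" "z b p = 0" for b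
  proof -
    show "z b \<in> CC" by (simp add: z_def)
    show "z b p = 0" using pU by (simp add: z_def xi_def rho_eval extend_def q_def)
  qed
  have eq: "rho * (rho * f) = (\<lambda>_. f p) * (rho * rho) + (\<Sum>b\<in>Basis. z b * \<Gamma> b)"
  proof
    fix p'
    show "(rho * (rho * f)) p' = ((\<lambda>_. f p) * (rho * rho) + (\<Sum>b\<in>Basis. z b * \<Gamma> b)) p'"
    proof (cases "p' \<in> U \<and> \<phi> p' \<in> ball x0 R")
      case True
      define S where "S = (\<Sum>b\<in>Basis. ((\<phi> p' - q) \<bullet> b) * G b (\<phi> p'))"
      have "f p' = f p + S"
        using True G(3)[of "\<phi> p'"] inv_chart(3) pU by (simp add: rep_def q_def S_def)
      moreover have "(z b * \<Gamma> b) p' = rho p' * rho p' * (((\<phi> p' - q) \<bullet> b) * G b (\<phi> p'))" for b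
        using True by (simp add: z_def \<Gamma>_def xi_def rho_eval extend_def inner_diff_left algebra_simps)
      then have "(\<Sum>b\<in>Basis. z b * \<Gamma> b) p' = rho p' * rho p' * S"
        by (simp only: sum_fun_apply S_def sum_distrib_left)
      ultimately show ?thesis by (simp add: algebra_simps)
    next
      case False
      then have "rho p' = 0" "\<Gamma> b p' = 0" for b using bump_zero by (auto simp: rho_eval \<Gamma>_def extend_def)
      then show ?thesis by (simp add: sum_fun_apply)
    qed
  qed
  have "X (rho * (rho * f)) p = (\<lambda>_. f p) p * X (rho * rho) p + (\<Sum>b\<in>Basis. X (z b * \<Gamma> b) p)"
    unfolding eq using X by (simp add: VV_fadd VV_cmult VV_fsum CC_sum sum_fun_apply)
  moreover have "X (z b * \<Gamma> b) p = X (z b) p * \<Gamma> b p" for b using X by (simp add: VV_mult)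
  moreover have "X (z b) p = X (xi b) p - (q \<bullet> b) * X rho p" for b
    using X by (simp add: z_def VV_fdiff VV_cmult)
  moreover have "\<Gamma> b p = rho p * frechet_derivative (rep f) (at q) b" for b
    using pU G(2) by (simp add: \<Gamma>_def extend_def rho_eval q_def)
  moreover have "X (rho * (rho * f)) p = rho p * rho p * X f p + f p * X (rho * rho) p"
    using X f by (simp add: VV_mult algebra_simps)
  ultimately have "rho p * (rho p * X f p) = rho p * (\<Sum>b\<in>Basis. (X (xi b) p - (q \<bullet> b) * X rho p) * frechet_derivative (rep f) (at q) b)"
    by (simp add: sum_distrib_left mult_ac)
  then have "rho p * (rho p * X f p) = (\<Sum>b\<in>Basis. (rho p * X (xi b) p - (rho p * (q \<bullet> b)) * X rho p) * frechet_derivative (rep f) (at q) b)"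
    by (simp add: sum_distrib_left algebra_simps)
  moreover have "rho p * (q \<bullet> b) = xi b p" for b using pU by (simp add: rho_eval xi_def extend_def q_def)
  ultimately show ?thesis by (simp add: coeff_def q_def power2_eq_square)
qed

lemma field_expansion:
  assumes X: "X \<in> VV"
  shows "vscale (rho * (rho * rho)) X = (\<Sum>b\<in>Basis. vscale (coeff X b) (coord_field b))"
proof (intro ext)
  fix f p
  show "vscale (rho * (rho * rho)) X f p = (\<Sum>b\<in>Basis. vscale (coeff X b) (coord_field b)) f p"
  proof (cases "f \<in> CC \<and> rho p \<noteq> 0")
    case True
    then have "p \<in> U" by (auto simp: rho_eval split: if_splits)
    then have "coord_field b f p = rho p * frechet_derivative (rep f) (at (\<phi> p)) b" for b
      using True by (simp add: coord_field_eval rho_eval)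
    then have "(\<Sum>b\<in>Basis. vscale (coeff X b) (coord_field b)) f p
        = rho p * (\<Sum>b\<in>Basis. coeff X b p * frechet_derivative (rep f) (at (\<phi> p)) b)"
      by (simp add: vscale_def sum_fun_apply sum_distrib_left mult.left_commute)
    also have "\<dots> = rho p * ((rho p)\<^sup>2 * X f p)" using field_expansion_at[OF X, of f p] True by simp
    finally show ?thesis by (simp add: vscale_def power2_eq_square)
  next
    case False
    then have "X f = 0 \<or> rho p = 0" "coord_field b f p = 0" for b
      using X by (auto simp: VV_out coord_field_def rho_eval extend_def)
    then show ?thesis by (auto simp: vscale_def sum_fun_apply)
  qed
qed

text \<open>
  So \<open>coeff\<close> is dual to the coordinate fields, which makes the latter independent at \<open>p\<close>.
\<close>
lemma coeff_coord_field:
  assumes p: "rho p \<noteq> 0" and b: "b \<in> Basis" "b' \<in> Basis"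
  shows "coeff (coord_field b) b' p = (if b = b' then rho p * rho p * rho p else 0)"
proof -
  define q where "q = \<phi> p"
  have pU: "p \<in> U" using p by (auto simp: rho_eval split: if_splits)
  have q: "q \<in> \<phi> ` U" using pU by (auto simp: q_def)
  let ?\<beta> = "bump x0 (R / 2)"
  define \<beta>' where "\<beta>' = frechet_derivative ?\<beta> (at q)"
  have d: "(?\<beta> has_derivative \<beta>') (at q)" unfolding \<beta>'_def
    by (rule C_on_deriv[OF C_on_bump[of "Suc 0"]]) simp
  have r: "rep rho x = ?\<beta> x" "rep (xi b') x = ?\<beta> x * (x \<bullet> b')" if "x \<in> \<phi> ` U" for x
    using inv_chart(1,2)[OF that] by (auto simp: rep_def rho_eval xi_def extend_def)
  have "(rep rho has_derivative \<beta>') (at q)"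
    by (rule has_derivative_transform_within_open[OF d chart(2)[OF ch] q]) (simp add: r)
  from frechet_derivative_at[OF this, symmetric] have 1: "coord_field b rho p = rho p * \<beta>' b"
    using pU by (simp add: coord_field_eval rho_eval q_def)
  have "((\<lambda>x. ?\<beta> x * (x \<bullet> b')) has_derivative (\<lambda>v. ?\<beta> q * (v \<bullet> b') + \<beta>' v * (q \<bullet> b'))) (at q)"
    by (auto intro!: derivative_eq_intros d)
  then have "(rep (xi b') has_derivative (\<lambda>v. ?\<beta> q * (v \<bullet> b') + \<beta>' v * (q \<bullet> b'))) (at q)"
    by (rule has_derivative_transform_within_open[OF _ chart(2)[OF ch] q]) (simp add: r)
  from frechet_derivative_at[OF this, symmetric] have 2: "coord_field b (xi b') p = rho p * (rho p * (b \<bullet> b') + \<beta>' b * (q \<bullet> b'))"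
    using pU by (simp add: coord_field_eval rho_eval q_def)
  have "xi b' p = rho p * (q \<bullet> b')" using pU by (simp add: rho_eval xi_def extend_def q_def)
  then show ?thesis using b by (simp add: coeff_def 1 2 inner_Basis algebra_simps)
qed

end

section \<open>Orthonormal frames\<close>

text \<open>
  Every inner product is the standard one up to a linear isomorphism: \<open>L\<close> is the inverse of the map that
  sends the standard basis to an orthonormal basis of \<open>B\<close>.
\<close>
lemma gram_schmidt:
  fixes B :: "'e::euclidean_space \<Rightarrow> 'e \<Rightarrow> real"
  assumes add: "\<And>x y z. B (x + y) z = B x z + B y z" and scale: "\<And>c x z. B (c *\<^sub>R x) z = c * B x z"
    and sym: "\<And>x y. B x y = B y x" and pos: "\<And>x. x \<noteq> 0 \<Longrightarrow> B x x > 0"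
  shows "\<exists>L :: 'e \<Rightarrow> 'e. (\<forall>x y. B x y = L x \<bullet> L y) \<and> surj L"
proof -
  have lin1: "linear (\<lambda>x. B x z)" for z by (rule linearI) (simp_all add: add scale)
  have lin2: "linear (\<lambda>x. B z x)" for z using lin1[of z] by (simp add: sym[of z])
  have orth: "\<exists>e. (\<forall>i\<in>S. \<forall>j\<in>S. B (e i) (e j) = (if i = j then 1 else 0)) \<and> (\<forall>i\<in>S. e i \<in> span S)"
    if "finite S" "S \<subseteq> Basis" for S :: "'e set"
    using that
  proof (induction S)
    case (insert b S)
    then obtain e where e': "\<forall>i\<in>S. \<forall>j\<in>S. B (e i) (e j) = (if i = j then 1 else 0)" "\<forall>i\<in>S. e i \<in> span S"
      by auto
    have e: "\<And>i j. i \<in> S \<Longrightarrow> j \<in> S \<Longrightarrow> B (e i) (e j) = (if i = j then 1 else 0)" "\<And>i. i \<in> S \<Longrightarrow> e i \<in> span S"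
      using e' by blast+
    define w where "w = (\<Sum>i\<in>S. B b (e i) *\<^sub>R e i)"
    define v where "v = b - w"
    have w: "w \<in> span S" unfolding w_def by (intro span_sum span_scale e)
    have "independent (insert b S)" using independent_mono[OF independent_Basis] insert.prems by blast
    then have "b \<notin> span S" using insert.hyps by (simp add: independent_insert)
    then have "v \<noteq> 0" using w by (auto simp: v_def)
    then have v: "B v v > 0" by (rule pos)
    have "B w (e j) = B b (e j)" if "j \<in> S" for j
    proof -
      have "B w (e j) = (\<Sum>i\<in>S. B b (e i) * B (e i) (e j))"
        by (simp add: w_def linear_sum[OF lin1] scale)
      also have "\<dots> = (\<Sum>i\<in>S. if i = j then B b (e i) else 0)" by (rule sum.cong) (use e that in auto)
      finally show ?thesis using that insert.hyps by simp
    qed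
    then have v0: "B v (e j) = 0" "B (e j) v = 0" if "j \<in> S" for j
      using linear_diff[OF lin1, of b w "e j"] that by (simp_all add: v_def sym[of "e j"])
    define e' where "e' i = (if i = b then (1 / sqrt (B v v)) *\<^sub>R v else e i)" for i
    have "B (e' i) (e' j) = (if i = j then 1 else 0)" if "i \<in> insert b S" "j \<in> insert b S" for i j
      using that v v0 e(1) insert.hyps by (auto simp: e'_def scale linear_scale[OF lin2] real_sqrt_mult_self)
    moreover have sub: "span S \<subseteq> span (insert b S)" by (rule span_mono) blast
    have "v \<in> span (insert b S)"
      unfolding v_def by (rule span_diff[OF span_base]) (use w sub in auto)
    then have "e' i \<in> span (insert b S)" if "i \<in> insert b S" for i
      using that e(2)[of i] sub by (auto simp: e'_def intro!: span_scale)
    ultimately show ?case by blast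
  qed simp
  obtain e where e: "\<And>i j :: 'e. i \<in> Basis \<Longrightarrow> j \<in> Basis \<Longrightarrow> B (e i) (e j) = (if i = j then 1 else 0)"
    using orth[OF finite_Basis subset_refl] by blast
  define f where "f x = (\<Sum>b\<in>Basis. (x \<bullet> b) *\<^sub>R e b)" for x
  have f: "linear f" by (rule linearI) (simp_all add: f_def inner_add_left scaleR_add_left sum.distrib scaleR_sum_right)
  have f1: "B (f x) z = (\<Sum>b\<in>Basis. (x \<bullet> b) * B (e b) z)" for x z
    by (simp add: f_def linear_sum[OF lin1] scale)
  have f2: "B z (f x) = (\<Sum>b\<in>Basis. (x \<bullet> b) * B z (e b))" for x z
    using f1[of x z] by (simp add: sym[of z])
  have Bf: "B (f x) (f y) = x \<bullet> y" for x y
  proof -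
    have "B (f x) (f y) = (\<Sum>b\<in>Basis. (x \<bullet> b) * (\<Sum>c\<in>Basis. (y \<bullet> c) * B (e b) (e c)))"
      unfolding f1[of x "f y"] unfolding f2[of _ y] ..
    also have "\<dots> = (\<Sum>b\<in>Basis. (x \<bullet> b) * (\<Sum>c\<in>Basis. if c = b then y \<bullet> c else 0))"
      by (intro sum.cong arg_cong2[where f = "(*)"] refl) (auto simp: e)
    finally show ?thesis by (simp add: euclidean_inner[of x y])
  qed
  have "inj f" unfolding linear_injective_0[OF f]
  proof (intro allI impI)
    fix x assume "f x = 0"
    then have "x \<bullet> x = 0" using Bf[of x x] linear_0[OF lin1, of 0] by simp
    then show "x = 0" by simp
  qed
  then have surj: "surj f" using linear_injective_imp_surjective[OF f] by simp
  show ?thesis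
  proof (intro exI conjI allI)
    show "surj (inv f)" using \<open>inj f\<close> by (rule inj_imp_surj_inv)
    show "B x y = inv f x \<bullet> inv f y" for x y
      using Bf[of "inv f x" "inv f y"] by (simp add: surj_f_inv_f[OF surj])
  qed
qed

locale metric_manifold = manifold +
  fixes g :: "'a vfield \<Rightarrow> 'a vfield \<Rightarrow> 'a \<Rightarrow> real"
  assumes metric: "riemannian_metric M A g"
begin

lemma g_CC [simp]: "X \<in> VV \<Longrightarrow> Y \<in> VV \<Longrightarrow> g X Y \<in> CC"
  and g_sym: "X \<in> VV \<Longrightarrow> Y \<in> VV \<Longrightarrow> g X Y = g Y X"
  and g_add: "X \<in> VV \<Longrightarrow> Y \<in> VV \<Longrightarrow> Z \<in> VV \<Longrightarrow> g (X + Y) Z = g X Z + g Y Z"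
  and g_vscale: "f \<in> CC \<Longrightarrow> X \<in> VV \<Longrightarrow> Y \<in> VV \<Longrightarrow> g (vscale f X) Y = f * g X Y"
  and g_pos: "X \<in> VV \<Longrightarrow> p \<in> topspace M \<Longrightarrow> f \<in> CC \<Longrightarrow> X f p \<noteq> 0 \<Longrightarrow> g X X p > 0"
proof -
  have "(\<forall>X\<in>VV. \<forall>Y\<in>VV. g X Y \<in> CC \<and> g X Y = g Y X) \<and>
     (\<forall>X\<in>VV. \<forall>Y\<in>VV. \<forall>Z\<in>VV. g (X + Y) Z = g X Z + g Y Z) \<and>
     (\<forall>f\<in>CC. \<forall>X\<in>VV. \<forall>Y\<in>VV. g (vscale f X) Y = f * g X Y) \<and>
     (\<forall>X\<in>VV. \<forall>p\<in>topspace M. (\<exists>f\<in>CC. X f p \<noteq> 0) \<longrightarrow> g X X p > 0)"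
    using metric unfolding riemannian_metric_def Let_def .
  note a = this[THEN conjunct1] this[THEN conjunct2, THEN conjunct1]
    this[THEN conjunct2, THEN conjunct2, THEN conjunct1] this[THEN conjunct2, THEN conjunct2, THEN conjunct2]
  show "X \<in> VV \<Longrightarrow> Y \<in> VV \<Longrightarrow> g X Y \<in> CC" "X \<in> VV \<Longrightarrow> Y \<in> VV \<Longrightarrow> g X Y = g Y X" using a(1) by blast+
  show "X \<in> VV \<Longrightarrow> Y \<in> VV \<Longrightarrow> Z \<in> VV \<Longrightarrow> g (X + Y) Z = g X Z + g Y Z" using a(2) by blast
  show "f \<in> CC \<Longrightarrow> X \<in> VV \<Longrightarrow> Y \<in> VV \<Longrightarrow> g (vscale f X) Y = f * g X Y" using a(3) by blast
  show "X \<in> VV \<Longrightarrow> p \<in> topspace M \<Longrightarrow> f \<in> CC \<Longrightarrow> X f p \<noteq> 0 \<Longrightarrow> g X X p > 0" using a(4) by blast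
qed

lemma g_0: "Y \<in> VV \<Longrightarrow> g 0 Y = 0"
  using g_add[of 0 0 Y] by simp

lemma g_sum: "Y \<in> VV \<Longrightarrow> (\<And>i. i \<in> I \<Longrightarrow> F i \<in> VV) \<Longrightarrow> g (sum F I) Y = (\<Sum>i\<in>I. g (F i) Y)"
  by (induction I rule: infinite_finite_induct) (auto simp: g_0 g_add VV_sum)

text \<open>
  By \<open>field_expansion\<close> the values \<open>g X Y p\<close> depend only on the coordinate components \<open>a X\<close>, \<open>a Y\<close> of the fields
  at \<open>p\<close>, through a bilinear form \<open>B\<close>. All components occur, and \<open>B\<close> is positive since a field
  with nonzero component does not annihilate all functions at \<open>p\<close>.
\<close>
lemma frame_at:
  assumes "p \<in> topspace M"
  obtains G :: "'a vfield \<Rightarrow> real ^ 'b" where "\<And>X Y. X \<in> VV \<Longrightarrow> Y \<in> VV \<Longrightarrow> g X Y p = G X \<bullet> G Y" "G ` VV = UNIV"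
proof -
  obtain U \<phi> where U\<phi>: "(U, \<phi>) \<in> A" and pU: "p \<in> U" using chart_at[OF assms] .
  obtain R where R: "0 < R" "ball (\<phi> p) R \<subseteq> \<phi> ` U" using openE[OF chart(2)[OF U\<phi>] imageI[OF pU]] by metis
  interpret bump_chart M A U \<phi> "\<phi> p" R by unfold_locales (use U\<phi> R in auto)
  have rp: "rho p \<noteq> 0" using bump_pos[of "R / 2" "\<phi> p" "\<phi> p"] R pU by (simp add: rho_eval)
  define r where "r = rho p * (rho p * rho p)"
  have r: "r \<noteq> 0" using rp by (simp add: r_def)
  note E = VV_coord_field
  define a where "a X = (\<Sum>b\<in>Basis. (coeff X b p / r) *\<^sub>R b)" for X
  have a: "a X \<bullet> b = coeff X b p / r" if "b \<in> Basis" for X b using that by (simp add: a_def inner_sum_left_Basis)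
  have ga: "g X Y p = (\<Sum>b\<in>Basis. (a X \<bullet> b) * g (coord_field b) Y p)" if "X \<in> VV" "Y \<in> VV" for X Y
  proof -
    have "r * g X Y p = g (vscale (rho * (rho * rho)) X) Y p" using that by (simp add: g_vscale r_def)
    also have "\<dots> = (\<Sum>b\<in>Basis. g (vscale (coeff X b) (coord_field b)) Y) p"
      unfolding field_expansion[OF that(1)] using that E by (subst g_sum) auto
    also have "\<dots> = (\<Sum>b\<in>Basis. coeff X b p * g (coord_field b) Y p)"
      using that E by (simp add: sum_fun_apply g_vscale)
    finally have "g X Y p = (\<Sum>b\<in>Basis. coeff X b p * g (coord_field b) Y p) / r" using r by (simp add: field_simps)
    then show ?thesis by (simp add: sum_divide_distrib a)
  qed
  define B where "B x y = (\<Sum>b\<in>Basis. (x \<bullet> b) * (\<Sum>c\<in>Basis. (y \<bullet> c) * g (coord_field c) (coord_field b) p))" for x y :: "real ^ 'b"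
  have gB: "g X Y p = B (a X) (a Y)" if "X \<in> VV" "Y \<in> VV" for X Y
  proof -
    have "g (coord_field b) Y p = (\<Sum>c\<in>Basis. (a Y \<bullet> c) * g (coord_field c) (coord_field b) p)" for b
      using g_sym[OF E that(2)] ga[OF that(2) E] by simp
    then show ?thesis using ga[OF that] by (simp add: B_def)
  qed
  have surj: "\<exists>X\<in>VV. a X = y" for y
  proof
    let ?X = "\<Sum>b\<in>Basis. vscale (\<lambda>_. y \<bullet> b) (coord_field b)"
    show "?X \<in> VV" by (intro VV_sum VV_cscale E)
    have "?X f p = (\<Sum>b\<in>Basis. (y \<bullet> b) * coord_field b f p)" for f
      by (simp add: vscale_def sum_fun_apply)
    then have 1: "coeff ?X c p = (\<Sum>b\<in>Basis. (y \<bullet> b) * coeff (coord_field b) c p)" for c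
      by (simp add: coeff_def sum_distrib_left right_diff_distrib sum_subtractf mult.left_commute)
    have 2: "coeff ?X c p = (y \<bullet> c) * r" if c: "c \<in> Basis" for c
    proof -
      have "coeff ?X c p = (\<Sum>b\<in>Basis. if b = c then (y \<bullet> b) * r else 0)"
        unfolding 1 by (intro sum.cong refl) (use coeff_coord_field[OF rp _ c] in \<open>auto simp: r_def\<close>)
      then show ?thesis using c by simp
    qed
    show "a ?X = y"
    proof (rule euclidean_eqI)
      fix c :: "real ^ 'b" assume c: "c \<in> Basis"
      show "a ?X \<bullet> c = y \<bullet> c" unfolding a[OF c] 2[OF c] using r by simp
    qed
  qed
  have "\<exists>L :: real ^ 'b \<Rightarrow> real ^ 'b. (\<forall>x y. B x y = L x \<bullet> L y) \<and> surj L"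
  proof (rule gram_schmidt)
    show "B (x + y) z = B x z + B y z" for x y z by (simp add: B_def inner_add_left distrib_right sum.distrib)
    show "B (c *\<^sub>R x) z = c * B x z" for c x z by (simp add: B_def sum_distrib_left mult.assoc)
    show "B x y = B y x" for x y
    proof -
      obtain X Y where "X \<in> VV" "Y \<in> VV" "a X = x" "a Y = y" using surj by meson
      then show ?thesis using gB[of X Y] gB[of Y X] g_sym[of X Y] by simp
    qed
    show "B x x > 0" if "x \<noteq> 0" for x
    proof -
      obtain X where X: "X \<in> VV" "a X = x" using surj by blast
      have "\<exists>b. coeff X b p \<noteq> 0"
      proof (rule ccontr)
        assume "\<nexists>b. coeff X b p \<noteq> 0"
        then have "a X = 0" by (simp add: a_def)
        then show False using X that by simp
      qed
      then obtain b where "coeff X b p \<noteq> 0" ..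
      then have "X (xi b) p \<noteq> 0 \<or> X rho p \<noteq> 0" by (auto simp: coeff_def)
      then have "g X X p > 0" using g_pos[OF X(1) assms CC_xi] g_pos[OF X(1) assms CC_rho] by blast
      then show ?thesis using gB X by simp
    qed
  qed
  then obtain L :: "real ^ 'b \<Rightarrow> real ^ 'b" where L: "\<And>x y. B x y = L x \<bullet> L y" "surj L" by blast
  show ?thesis
  proof (rule that)
    show "g X Y p = (L \<circ> a) X \<bullet> (L \<circ> a) Y" if "X \<in> VV" "Y \<in> VV" for X Y using gB[OF that] L by simp
    show "(L \<circ> a) ` VV = UNIV"
    proof -
      have "y \<in> a ` VV" for y using surj[of y] by blast
      then have "a ` VV = UNIV" by blast
      then have "(L \<circ> a) ` VV = range L" unfolding image_comp[symmetric] by simp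
      then show ?thesis using L(2) by simp
    qed
  qed
qed

end

section \<open>Almost Kaehler manifolds\<close>

locale almost_kahler_ak2 =
  fixes M :: "'a topology" and A :: "('a, 'm::finite) chart set"
    and g :: "'a vfield \<Rightarrow> 'a vfield \<Rightarrow> ('a \<Rightarrow> real)" and J :: "'a vfield \<Rightarrow> 'a vfield"
    and nabla :: "'a vfield \<Rightarrow> 'a vfield \<Rightarrow> 'a vfield"
  assumes kahler: "almost_kahler M A g J" and levi: "levi_civita M A g nabla" and ak2: "AK2 M A g J nabla"
begin

sublocale metric_manifold M A g
  by unfold_locales (use kahler in \<open>simp_all add: almost_kahler_def Let_def\<close>)

lemma J_VV [simp]: "X \<in> VV \<Longrightarrow> J X \<in> VV"
  and J_add [simp]: "X \<in> VV \<Longrightarrow> Y \<in> VV \<Longrightarrow> J (X + Y) = J X + J Y"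
  and J_J [simp]: "X \<in> VV \<Longrightarrow> J (J X) = - X"
  and g_JJ: "X \<in> VV \<Longrightarrow> Y \<in> VV \<Longrightarrow> g (J X) (J Y) = g X Y"
  and closed: "X \<in> VV \<Longrightarrow> Y \<in> VV \<Longrightarrow> Z \<in> VV \<Longrightarrow> ext_deriv2 (kahler_form g J) X Y Z = 0"
  using kahler unfolding almost_kahler_def almost_complex_structure_def Let_def by blast+

lemma nabla_VV [simp]: "X \<in> VV \<Longrightarrow> Y \<in> VV \<Longrightarrow> nabla X Y \<in> VV"
  and nabla_add1 [simp]: "X \<in> VV \<Longrightarrow> Y \<in> VV \<Longrightarrow> Z \<in> VV \<Longrightarrow> nabla (X + Y) Z = nabla X Z + nabla Y Z"
  and nabla_add2 [simp]: "X \<in> VV \<Longrightarrow> Y \<in> VV \<Longrightarrow> Z \<in> VV \<Longrightarrow> nabla X (Y + Z) = nabla X Y + nabla X Z"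
  and torsion_free: "X \<in> VV \<Longrightarrow> Y \<in> VV \<Longrightarrow> nabla X Y - nabla Y X = lie_bracket X Y"
  and nabla_metric: "X \<in> VV \<Longrightarrow> Y \<in> VV \<Longrightarrow> Z \<in> VV \<Longrightarrow> X (g Y Z) = g (nabla X Y) Z + g Y (nabla X Z)"
  using levi unfolding levi_civita_def affine_connection_def Let_def by blast+

lemma VV_diff [simp]: "X \<in> VV \<Longrightarrow> Y \<in> VV \<Longrightarrow> X - Y \<in> VV"
  using VV_add[of X "- Y"] by simp

lemma additive_VV:
  fixes F :: "'a vfield \<Rightarrow> 'w::ab_group_add"
  assumes "\<And>x y. x \<in> VV \<Longrightarrow> y \<in> VV \<Longrightarrow> F (x + y) = F x + F y"
  shows "x \<in> VV \<Longrightarrow> F (- x) = - F x" "x \<in> VV \<Longrightarrow> y \<in> VV \<Longrightarrow> F (x - y) = F x - F y"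
proof -
  have 0: "F 0 = 0" using assms[of 0 0] by simp
  show m: "F (- x) = - F x" if "x \<in> VV" for x
    using assms[of x "- x"] that 0 by (simp add: add_eq_0_iff2)
  show "F (x - y) = F x - F y" if "x \<in> VV" "y \<in> VV"
    using assms[of x "- y"] m[of y] that by simp
qed

lemma J_minus [simp]: "X \<in> VV \<Longrightarrow> J (- X) = - J X"
  and J_diff [simp]: "X \<in> VV \<Longrightarrow> Y \<in> VV \<Longrightarrow> J (X - Y) = J X - J Y"
  by (rule additive_VV[of J]; simp)+

lemma nabla_minus2 [simp]: "Z \<in> VV \<Longrightarrow> X \<in> VV \<Longrightarrow> nabla Z (- X) = - nabla Z X"
  by (rule additive_VV(1)[of "nabla Z"]; simp)

lemma g_minus1: "Z \<in> VV \<Longrightarrow> X \<in> VV \<Longrightarrow> g (- X) Z = - g X Z"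
  by (rule additive_VV(1)[of "\<lambda>X. g X Z"]; simp add: g_add)
lemma g_diff1: "Z \<in> VV \<Longrightarrow> X \<in> VV \<Longrightarrow> Y \<in> VV \<Longrightarrow> g (X - Y) Z = g X Z - g Y Z"
  by (rule additive_VV(2)[of "\<lambda>X. g X Z"]; simp add: g_add)
lemma g_add2: "X \<in> VV \<Longrightarrow> Y \<in> VV \<Longrightarrow> Z \<in> VV \<Longrightarrow> g X (Y + Z) = g X Y + g X Z"
  using g_sym[of X "Y + Z"] g_sym[of X Y] g_sym[of X Z] g_add by simp
lemma g_minus2: "Z \<in> VV \<Longrightarrow> X \<in> VV \<Longrightarrow> g Z (- X) = - g Z X"
  by (rule additive_VV(1)[of "g Z"]; simp add: g_add2)

lemma g_J_skew: "X \<in> VV \<Longrightarrow> Y \<in> VV \<Longrightarrow> g (J X) Y = - g X (J Y)"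
  using g_JJ[of X "J Y"] g_minus2[of "J X" Y] by (simp add: g_minus2 minus_equation_iff)

lemma g_twice: "X \<in> VV \<Longrightarrow> Z \<in> VV \<Longrightarrow> g (X + X) Z p = 2 * g X Z p"
  by (subst g_add) simp_all

lemma g_definite: assumes X: "X \<in> VV" and 0: "\<And>p. g X X p = 0" shows "X = 0"
proof (intro ext)
  fix f p
  show "X f p = (0 :: 'a vfield) f p"
  proof (cases "f \<in> CC \<and> p \<in> topspace M")
    case True
    then show ?thesis using g_pos[OF X, of p f] 0[of p] by auto
  next
    case False
    then show ?thesis using VV_out[OF X, of f] CC_D(1)[OF VV_CC[OF X], of f p] by (cases "f \<in> CC") auto
  qed
qed

lemma g_separates: assumes "X \<in> VV" "Y \<in> VV" "\<And>U. U \<in> VV \<Longrightarrow> g X U = g Y U" shows "X = Y"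
proof -
  have "g (X - Y) (X - Y) = 0" using assms g_diff1[of "X - Y" X Y] by simp
  then have "X - Y = 0" by (intro g_definite) (use assms in auto)
  then show ?thesis by simp
qed

abbreviation (input) e where "e \<equiv> Defs.eta nabla J"
abbreviation (input) D where "D \<equiv> canonical_connection nabla J"

lemma eta_VV [simp]: "X \<in> VV \<Longrightarrow> Y \<in> VV \<Longrightarrow> e X Y \<in> VV"
  by (simp add: eta_def cov_deriv_endo_def)

text \<open>
  Identities for \<open>eta\<close> are proved after doubling: smooth functions vanish outside \<open>M\<close>, so the constant
  \<open>1 / 2\<close> is in general not one of them, and compatibility of \<open>J\<close>, \<open>nabla\<close> and \<open>g\<close> with scaling
  by it has to be read off from additivity.
\<close>
lemma eta_double: "X \<in> VV \<Longrightarrow> Y \<in> VV \<Longrightarrow> e X Y + e X Y = - nabla X Y - J (nabla X (J Y))"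
proof -
  assume X: "X \<in> VV" and Y: "Y \<in> VV"
  have "e X Y + e X Y = cov_deriv_endo nabla J X (J Y)"
    by (rule ext, rule ext) (simp add: eta_def vscale_def)
  then show ?thesis using X Y by (simp add: cov_deriv_endo_def)
qed

lemma double_cancel: assumes "X + X = Y + (Y :: 'a vfield)" shows "X = Y"
proof (intro ext)
  fix f p
  have "(X + X) f p = (Y + Y) f p" using assms by simp
  then show "X f p = Y f p" by simp
qed

lemma eta_add1: assumes V: "X \<in> VV" "Y \<in> VV" "Z \<in> VV" shows "e (X + Y) Z = e X Z + e Y Z"
proof (rule double_cancel)
  have "e (X + Y) Z + e (X + Y) Z = (e X Z + e X Z) + (e Y Z + e Y Z)"
    using V by (simp only: eta_double VV_add J_VV nabla_VV nabla_add1 J_add) (simp add: algebra_simps)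
  then show "e (X + Y) Z + e (X + Y) Z = (e X Z + e Y Z) + (e X Z + e Y Z)" by (simp add: algebra_simps)
qed

lemma eta_add2: assumes V: "X \<in> VV" "Y \<in> VV" "Z \<in> VV" shows "e X (Y + Z) = e X Y + e X Z"
proof (rule double_cancel)
  have "e X (Y + Z) + e X (Y + Z) = (e X Y + e X Y) + (e X Z + e X Z)"
    using V by (simp only: eta_double VV_add J_VV nabla_VV nabla_add2 J_add) (simp add: algebra_simps)
  then show "e X (Y + Z) + e X (Y + Z) = (e X Y + e X Z) + (e X Y + e X Z)" by (simp add: algebra_simps)
qed

lemma eta_J2: assumes V: "X \<in> VV" "Y \<in> VV" shows "e X (J Y) = - J (e X Y)"
proof (rule double_cancel)
  have "e X (J Y) + e X (J Y) = - nabla X (J Y) + J (nabla X Y)" using V by (simp add: eta_double)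
  also have "\<dots> = - J (- nabla X Y - J (nabla X (J Y)))" using V by simp
  also have "\<dots> = - J (e X Y + e X Y)" using V by (simp only: eta_double)
  also have "\<dots> = - J (e X Y) + - J (e X Y)" unfolding J_add[OF eta_VV[OF V] eta_VV[OF V]] by (rule minus_add_distrib)
  finally show "e X (J Y) + e X (J Y) = - J (e X Y) + - J (e X Y)" .
qed

lemma eta_skew: assumes V: "X \<in> VV" "Y \<in> VV" "Z \<in> VV" shows "g (e X Y) Z p = - g (e X Z) Y p"
proof -
  have d: "g (e X Y) Z p + g (e X Y) Z p = - g (nabla X Y) Z p + g (nabla X (J Y)) (J Z) p"
    if "Y \<in> VV" "Z \<in> VV" for Y Z
  proof -
    have "g (e X Y) Z p + g (e X Y) Z p = g (e X Y + e X Y) Z p"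
      unfolding g_twice[OF eta_VV[OF V(1) that(1)] that(2)] by simp
    also have "\<dots> = g (- nabla X Y - J (nabla X (J Y))) Z p" using that V by (simp only: eta_double)
    also have "\<dots> = - g (nabla X Y) Z p + g (nabla X (J Y)) (J Z) p"
      using that V by (simp add: g_diff1 g_minus1 g_J_skew)
    finally show ?thesis .
  qed
  have "g (nabla X (J Y)) (J Z) p + g (J Y) (nabla X (J Z)) p = X (g (J Y) (J Z)) p"
    using V nabla_metric[of X "J Y" "J Z"] by simp
  also have "\<dots> = g (nabla X Y) Z p + g Y (nabla X Z) p"
    using V nabla_metric[of X Y Z] by (simp add: g_JJ)
  finally show ?thesis using d[OF V(2,3)] d[OF V(3,2)] V
      g_sym[of "J Y" "nabla X (J Z)"] g_sym[of Y "nabla X Z"] by simp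
qed

lemma J_eta_double: "X \<in> VV \<Longrightarrow> Y \<in> VV \<Longrightarrow> J (e X Y) + J (e X Y) = nabla X (J Y) - J (nabla X Y)"
proof -
  assume V: "X \<in> VV" "Y \<in> VV"
  have "J (e X Y) + J (e X Y) = J (e X Y + e X Y)" by (rule J_add[symmetric]; use V in simp)
  also have "\<dots> = J (- nabla X Y - J (nabla X (J Y)))" using V by (simp only: eta_double)
  finally show ?thesis using V by simp
qed

lemma J_eta_skew: assumes V: "X \<in> VV" "Y \<in> VV" "Z \<in> VV"
  shows "g (J (e X Y)) Z p = - g (J (e X Z)) Y p"
  using eta_skew[of X Y "J Z" p] V by (simp add: g_J_skew[of "e X Y" Z] eta_J2 g_minus1)

text \<open>
  The exterior derivative of the Kaehler form is the cyclic sum of \<open>g ((nabla\<^sub>X J) Y) Z\<close>, and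
  \<open>(nabla\<^sub>X J) Y = 2 J (e X Y)\<close>.
\<close>
lemma J_eta_cyclic: assumes V: "X \<in> VV" "Y \<in> VV" "Z \<in> VV"
  shows "g (J (e X Y)) Z p + g (J (e Y Z)) X p + g (J (e Z X)) Y p = 0"
proof -
  have d: "2 * g (J (e X Y)) Z p = g (nabla X (J Y)) Z p - g (J (nabla X Y)) Z p"
    if "X \<in> VV" "Y \<in> VV" "Z \<in> VV" for X Y Z
  proof -
    have "2 * g (J (e X Y)) Z p = g (J (e X Y) + J (e X Y)) Z p" by (rule g_twice[symmetric]) (use that in simp_all)
    also have "\<dots> = g (nabla X (J Y) - J (nabla X Y)) Z p" using that by (simp only: J_eta_double)
    finally show ?thesis using that by (simp add: g_diff1)
  qed
  have s: "g (J Y) (nabla X Z) p = - g (J (nabla X Z)) Y p" if "X \<in> VV" "Y \<in> VV" "Z \<in> VV" for X Y Z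
    using that g_J_skew[of Y "nabla X Z"] g_sym[of Y "J (nabla X Z)"] by simp
  have b: "g (J (lie_bracket X Y)) Z p = g (J (nabla X Y)) Z p - g (J (nabla Y X)) Z p"
    if "X \<in> VV" "Y \<in> VV" "Z \<in> VV" for X Y Z
    using that by (simp add: torsion_free[symmetric] g_diff1)
  have m: "X (g (J Y) Z) p = g (nabla X (J Y)) Z p - g (J (nabla X Z)) Y p" if "X \<in> VV" "Y \<in> VV" "Z \<in> VV" for X Y Z
    using that by (simp add: nabla_metric s)
  have "ext_deriv2 (kahler_form g J) X Y Z p = 0" using closed[OF V] by simp
  moreover have "ext_deriv2 (kahler_form g J) X Y Z p = X (g (J Y) Z) p - Y (g (J X) Z) p + Z (g (J X) Y) p
     - g (J (lie_bracket X Y)) Z p + g (J (lie_bracket X Z)) Y p - g (J (lie_bracket Y Z)) X p"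
    by (simp add: ext_deriv2_def kahler_form_def[abs_def])
  ultimately have "2 * g (J (e X Y)) Z p - 2 * g (J (e Y X)) Z p + 2 * g (J (e Z X)) Y p = 0"
    using d[OF V] d[OF V(2,1,3)] d[OF V(3,1,2)] m[OF V] m[OF V(2,1,3)] m[OF V(3,1,2)]
      b[OF V] b[OF V(1,3,2)] b[OF V(2,3,1)] by linarith
  then show ?thesis using J_eta_skew[OF V(2,1,3), of p] by linarith
qed

lemma g_J_eta_J: assumes V: "X \<in> VV" "Y \<in> VV" "Z \<in> VV"
  shows "g (J (e X (J Y))) Z p = g (e X Y) Z p" "g (J (e X Y)) (J Z) p = g (e X Y) Z p"
  using V by (simp_all add: eta_J2 g_JJ)

text \<open>
  Let \<open>x\<close>, \<open>y\<close>, \<open>z\<close> be the three summands of \<open>J_eta_cyclic\<close> and \<open>a = g (e (J X) Y) Z\<close> with its cyclic permutations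
  \<open>b\<close>, \<open>c\<close>. The cyclic identity at \<open>(J X, J Y, Z)\<close> and its permutations is \<open>a + b = z\<close>, \<open>b + c = x\<close>,
  \<open>c + a = y\<close>; with \<open>x + y + z = 0\<close> this gives \<open>a = - x\<close>.
\<close>
lemma eta_J1: assumes V: "X \<in> VV" "Y \<in> VV" shows "e (J X) Y = - J (e X Y)"
proof (rule g_separates)
  fix Z assume Z: "Z \<in> VV"
  have sum: "g (e (J X) Y) Z p + g (e (J Y) Z) X p = g (J (e Z X)) Y p"
    if "X \<in> VV" "Y \<in> VV" "Z \<in> VV" for X Y Z p
  proof -
    have "g (J (e Z (J X))) (J Y) p = - g (J (e Z X)) Y p"
      using that g_J_eta_J(2)[of Z "J X" Y p] by (simp add: eta_J2 g_minus1)
    then show ?thesis using J_eta_cyclic[of "J X" "J Y" Z p] that g_J_eta_J(1)[of "J X" Y Z p] g_J_eta_J(2)[of "J Y" Z X p]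
      by simp
  qed
  show "g (e (J X) Y) Z = g (- J (e X Y)) Z"
  proof
    fix p
    show "g (e (J X) Y) Z p = g (- J (e X Y)) Z p"
      using sum[OF V Z, of p] sum[OF V(2) Z V(1), of p] sum[OF Z V, of p] J_eta_cyclic[OF V Z, of p]
        V Z by (simp add: g_minus1)
  qed
qed (use V in auto)

lemma eta_cyc: assumes V: "X \<in> VV" "Y \<in> VV" "Z \<in> VV"
  shows "g (e X Y) Z p + g (e Y Z) X p + g (e Z X) Y p = 0"
proof -
  have "g (J (e (J Z) X)) Y p = g (e Z X) Y p" using V by (simp add: eta_J1)
  then show ?thesis
    using J_eta_cyclic[of X Y "J Z" p] g_J_eta_J(2)[of X Y Z p] g_J_eta_J(1)[of Y Z X p] V by simp
qed

lemma jacobi: assumes V: "X \<in> VV" "Y \<in> VV" "Z \<in> VV"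
  shows "lie_bracket X (lie_bracket Y Z) + lie_bracket Y (lie_bracket Z X) + lie_bracket Z (lie_bracket X Y) = 0"
proof
  fix f
  have z: "X 0 = 0" if "X \<in> VV" for X using VV_f0[OF that] .
  show "(lie_bracket X (lie_bracket Y Z) + lie_bracket Y (lie_bracket Z X) + lie_bracket Z (lie_bracket X Y)) f
      = (0 :: 'a vfield) f"
  proof (cases "f \<in> CC")
    case True
    have d: "P (Q (R f) - R (Q f)) = P (Q (R f)) - P (R (Q f))" if "P \<in> VV" "Q \<in> VV" "R \<in> VV" for P Q R
      using that True by (intro VV_fdiff) auto
    show ?thesis unfolding lie_bracket_def plus_fun_apply d[OF V] d[OF V(2,3,1)] d[OF V(3,1,2)] by (simp add: zero_fun_def)
  next
    case False
    then show ?thesis using V by (intro ext) (simp add: VV_out)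
  qed
qed

lemma D_J: assumes V: "X \<in> VV" "Y \<in> VV" shows "D X (J Y) = J (D X Y)"
proof -
  have "nabla X (J Y) = J (nabla X Y) + (J (e X Y) + J (e X Y))"
    unfolding J_eta_double[OF V] by simp
  then show ?thesis using V by (simp add: canonical_connection_def eta_J2)
qed

sublocale H: hermitian_ak2 VV CC g J D e lie_bracket "\<lambda>X. X"
proof
  fix X Y Z U :: "'a vfield" and p R
  show "lie_bracket X Y f = X (Y f) - Y (X f)" for f by (simp add: lie_bracket_def)
  assume X: "X \<in> VV"
  show "X (f + h) = X f + X h" if "f \<in> CC" "h \<in> CC" for f h using VV_fadd[OF X that] .
  show "X = 0" if "\<And>p. g X X p = 0" using g_definite[OF X that] .
  assume Y: "Y \<in> VV"
  show "g X Y p = g Y X p" using g_sym[OF X Y] by simp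
  show "D X (J Y) = J (D X Y)" using D_J[OF X Y] .
  show "lie_bracket X Y = D X Y - D Y X - (e X Y - e Y X)"
    using X Y by (simp add: canonical_connection_def torsion_free[symmetric])
  assume Z: "Z \<in> VV"
  show "g (X + Y) Z p = g X Z p + g Y Z p" using g_add[OF X Y Z] by simp
  show "g (e X Y) Z p = - g (e X Z) Y p" using eta_skew[OF X Y Z] .
  show "g (e X Y) Z p + g (e Y Z) X p + g (e Z X) Y p = 0" using eta_cyc[OF X Y Z] .
  show "lie_bracket X (lie_bracket Y Z) + lie_bracket Y (lie_bracket Z X) + lie_bracket Z (lie_bracket X Y) = 0"
    using jacobi[OF X Y Z] .
  show "X (g Y Z) = g (D X Y) Z + g Y (D X Z)"
  proof
    fix p
    show "X (g Y Z) p = (g (D X Y) Z + g Y (D X Z)) p"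
      using eta_skew[OF X Y Z, of p] nabla_metric[OF X Y Z] X Y Z g_sym[of Y "e X Z"]
      by (simp add: canonical_connection_def g_add g_add2)
  qed
  assume U: "U \<in> VV" and R: "R = (\<lambda>X Y Z. (D X (D Y Z - e Y Z) - e X (D Y Z - e Y Z))
          - (D Y (D X Z - e X Z) - e Y (D X Z - e X Z)) - (D (lie_bracket X Y) Z - e (lie_bracket X Y) Z))"
  have R: "R = curvature nabla" unfolding R by (intro ext) (simp add: curvature_def canonical_connection_def)
  have "g (R X Y Z) U - g (R (J X) (J Y) Z) U = g (R (J X) Y (J Z)) U + g (R (J X) Y Z) (J U)"
    using ak2 X Y Z U unfolding AK2_def Let_def R by blast
  then have "(g (R X Y Z) U - g (R (J X) (J Y) Z) U) p = (g (R (J X) Y (J Z)) U + g (R (J X) Y Z) (J U)) p"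
    by (rule fun_cong)
  then show "g (R X Y Z) U p - g (R (J X) (J Y) Z) U p = g (R (J X) Y (J Z)) U p + g (R (J X) Y Z) (J U) p" by simp
qed (simp_all add: g_JJ eta_add1 eta_add2 eta_J1 eta_J2 canonical_connection_def)

sublocale H: hermitian_ak2_null VV CC g J D e lie_bracket "\<lambda>X. X"
proof
  fix X Y Z a b p
  assume H: "X \<in> H.Null" "Y \<in> H.Null" "Z \<in> H.Null" and V: "a \<in> VV" "b \<in> VV"
  show "g (H.K X Z Y) (H.T a b) p = 0"
  proof (cases "p \<in> topspace M")
    case True
    obtain G :: "'a vfield \<Rightarrow> real ^ 'm" where G: "\<And>X Y. X \<in> VV \<Longrightarrow> Y \<in> VV \<Longrightarrow> g X Y p = G X \<bullet> G Y" "G ` VV = UNIV"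
      using frame_at[OF True] by metis
    show ?thesis by (rule H.curvature_null_vanishes[OF G]) (use H V in simp_all)
  next
    case False
    have "g (H.K X Z Y) (H.T a b) \<in> CC" using H V by simp
    then show ?thesis using CC_D(1) False by blast
  qed
qed

lemma torsion_parallel: "parallel_bilinear M A D (canonical_torsion nabla J)"
proof -
  have "canonical_torsion nabla J = H.T" by (intro ext) (simp add: canonical_torsion_def H.T_def)
  moreover have "cov_deriv_bilinear D H.T X Y Z = 0" if "X \<in> VV" "Y \<in> VV" "Z \<in> VV" for X Y Z
    using H.leibniz_T[of X Y Z] that H.tau_zero[OF that] by (simp add: cov_deriv_bilinear_def)
  ultimately show ?thesis by (simp add: parallel_bilinear_def)
qed

end

theorem theorem1p2:
  fixes M :: "'a topology"
    and A :: "('a, 'm::finite) chart set"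
    and g :: "'a vfield \<Rightarrow> 'a vfield \<Rightarrow> ('a \<Rightarrow> real)"
    and J :: "'a vfield \<Rightarrow> 'a vfield"
    and nabla :: "'a vfield \<Rightarrow> 'a vfield \<Rightarrow> 'a vfield"
    and n :: nat
  assumes "CARD('m) = 2 * n"
    and "almost_kahler M A g J"
    and "levi_civita M A g nabla"
    and "AK2 M A g J nabla"
  shows "parallel_bilinear M A (canonical_connection nabla J) (canonical_torsion nabla J)"
proof -
  interpret almost_kahler_ak2 M A g J nabla by unfold_locales (rule assms(2-4))+
  show ?thesis by (rule torsion_parallel)
qed

end
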